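(* Let $\mathbf{A}=\mathbb{F}_q[t]$, $A=\mathbb{F}_q[\theta]$, $E$ a finite extension of $K=\mathbb{F}_q(\theta)$, and let $\varphi:\mathbf{A}\to E[\tau]$ be a Drinfeld module with $\varphi_t=\theta+a_1\tau+\cdots+a_r\tau^r$ ($a_r\neq0$). Let $\rho:G_E\to\operatorname{GL}_n(\overline{\mathbb{F}}_q)$ be an Artin representation, $d=[\mathbb{F}_q(\rho):\mathbb{F}_q]$, $N=nd$, and let $\vec{\mathbf{u}}\in\operatorname{Sol}_E(\rho)$ be a fundamental solution. Then $\Phi(\vec{\mathbf{u}})\in\operatorname{GL}_N(E)$, and setting $\Psi=(\Phi(\vec{\mathbf{u}})^{\top})^{-1}$, the Artin twist $\mathcal{E}$ of $\varphi$ by $\rho$ (an abelian Anderson $t$-module over $E$ with $\mathbb{M}(\mathcal{E})\cong\mathbb{M}(\varphi,\rho)$ over $E$) has a model over $E$ given by $$\mathcal{E}_t=\theta I_N+a_1\Psi\tau+a_2\Psi\Psi^{(1)}\tau^2+\cdots+a_r\Psi\Psi^{(1)}\cdots\Psi^{(r-1)}\tau^r.$$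
   Context: Notation: $\tau$ is the $q$-Frobenius, $x^{(i)}$ ($x$ a scalar or matrix) is the entrywise $q^i$-th power; $G_E=\operatorname{Gal}(E^{\mathrm{sep}}/E)$; $\rho^{(\ell)}(g)=\rho(g)^{(\ell)}$. $\mathbb{F}_q(\rho)$ is the field generated over $\mathbb{F}_q$ by the entries of all $\rho(g)$. Fix an $\mathbb{F}_q$-basis $\alpha_1,\dots,\alpha_d$ of $\mathbb{F}_q(\rho)$ and $\vec{\boldsymbol{\alpha}}=(\alpha_1,\dots,\alpha_d)^\top$. $\operatorname{Sol}_E(\rho)=\{\vec{\mathbf{x}}\in\operatorname{Mat}_{n\times d}(E^{\mathrm{sep}}): g(\vec{\mathbf{x}})\vec{\boldsymbol{\alpha}}^{(\ell)}=\rho^{(\ell)}(g)^{-1}\vec{\mathbf{x}}\vec{\boldsymbol{\alpha}}^{(\ell)}\ \forall g\in G_E,\ 0\le\ell\le d-1\}$; an element is a fundamental solution if its $N$ entries are linearly independent over $\mathbb{F}_q$. Viewing $\vec{\mathbf{u}}$ as a column vector in $(E^{\mathrm{sep}})^N$, let $M(\vec{\mathbf{u}})=[\vec{\mathbf{u}},\vec{\mathbf{u}}^{(1)},\dots,\vec{\mathbf{u}}^{(N-1)}]$, $(f_0,\dots,f_{N-1})^\top=M(\vec{\mathbf{u}})^{-1}\vec{\mathbf{u}}^{(N)}$, and $\Phi(\vec{\mathbf{u}})$ the $N\times N$ companion matrix with $1$'s on the subdiagonal, last column $(f_0,\dots,f_{N-1})^\top$, zeros elsewhere. Motives: for an Anderson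 $t$-module $\mathcal{E}$ of dimension $N$ ($\mathcal{E}_t\in\operatorname{Mat}_N(E)[\tau]$, $(\partial\mathcal{E}_t-\theta I)^N=0$), $\mathbb{M}(\mathcal{E})=\operatorname{Mat}_{1\times N}(E[\tau])$ with $t$ acting by right multiplication by $\mathcal{E}_t$, $E$ on the left, $\tau$ by left multiplication. $\mathbb{M}(\rho)=(E^{\mathrm{sep}}\otimes_{\mathbb{F}_q}\operatorname{Res}V_\rho)^{G_E}\otimes_E E[t]$ with diagonal Galois action, $V_\rho=\mathbb{F}_q(\rho)^n$ via $\rho$, and $\tau$ the Frobenius on $E^{\mathrm{sep}}$ and on $E$; $\mathbb{M}(\varphi,\rho)=\mathbb{M}(\varphi)\otimes_{E[t]}\mathbb{M}(\rho)$ with diagonal $\tau$. *)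

theory Defs
  imports
    "HOL-Analysis.Abstract_Topology"
    "HOL-Algebra.Generated_Fields"
    "HOL-Algebra.Bij"
    "HOL-Algebra.Algebraic_Closure_Type"
    "Jordan_Normal_Form.Missing_VectorSpace"
    "Jordan_Normal_Form.Matrix"
begin

text \<open>
  All fields occurring here are subfields of one algebraically closed field, the type \<open>'a\<close>:
  \<open>F\<close> is \<open>F_q\<close>, and \<open>E\<close> is a finite extension of \<open>F_q(\<theta>)\<close>. In particular \<open>E^sep\<close> and the algebraic
  closure of \<open>F_q\<close> are formed inside \<open>'a\<close>.  Sub-objects are carrier sets in the sense of HOL-Algebra,
  matrices are those of \<^theory>\<open>Jordan_Normal_Form.Matrix\<close>.
\<close>

section \<open>Fields and the absolute Galois group\<close>

abbreviation ambient :: "'a::field ring" where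
  "ambient \<equiv> ring_of_type_algebra"

abbreviation ring_on :: "'a::comm_ring_1 set \<Rightarrow> 'a ring" where
  "ring_on S \<equiv> ring_of_type_algebra\<lparr>carrier := S\<rparr>"

definition polys_over :: "'a::zero set \<Rightarrow> 'a poly set" where
  "polys_over S = {p. \<forall>i. coeff p i \<in> S}"

definition finite_field_extension :: "'a::field set \<Rightarrow> 'a set \<Rightarrow> bool" where
  "finite_field_extension K L \<longleftrightarrow>
     subfield K ambient \<and> subfield L ambient \<and> K \<subseteq> L \<and> ring.finite_dimension ambient K L"

definition algebraic_elements :: "'a::field set \<Rightarrow> 'a set" where
  "algebraic_elements K = {x. \<not> ring.transcendental ambient K x}"

(* x is separable over E iff it is a root of a polynomial over E without repeated roots; since
   the ambient type is algebraically closed, rsquarefree refers to all roots. *)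
definition sep_closure :: "'a::alg_closed_field set \<Rightarrow> 'a set" where
  "sep_closure E = {x. \<exists>p \<in> polys_over E. rsquarefree p \<and> poly p x = 0}"

definition gal_group :: "'a::alg_closed_field set \<Rightarrow> ('a \<Rightarrow> 'a) monoid" where
  "gal_group E = BijGroup (sep_closure E)
     \<lparr>carrier := {g \<in> Bij (sep_closure E).
        g \<in> Ring.ring_hom (ring_on (sep_closure E)) (ring_on (sep_closure E)) \<and> (\<forall>x\<in>E. g x = x)}\<rparr>"

(* The Krull topology: generated by the cosets g Gal(E^sep/L), L/E finite. *)
definition krull_topology :: "'a::alg_closed_field set \<Rightarrow> ('a \<Rightarrow> 'a) topology" where
  "krull_topology E = topology_generated_by
     {{h \<in> carrier (gal_group E). \<forall>x\<in>L. h x = g x} | g L.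
        g \<in> carrier (gal_group E) \<and> finite_field_extension E L \<and> L \<subseteq> sep_closure E}"


section \<open>Matrices and Artin representations\<close>

definition mats_over :: "nat \<Rightarrow> nat \<Rightarrow> 'b set \<Rightarrow> 'b mat set" where
  "mats_over m n S = {A \<in> carrier_mat m n. elements_mat A \<subseteq> S}"

definition GL :: "nat \<Rightarrow> 'a::field set \<Rightarrow> 'a mat monoid" where
  "GL n S = units_of ((ring_mat TYPE('a) n ())\<lparr>carrier := mats_over n n S\<rparr>)"

definition mat_inv :: "nat \<Rightarrow> 'a::field mat \<Rightarrow> 'a mat" where
  "mat_inv n A = inv\<^bsub>GL n UNIV\<^esub> A"

definition frob_mat :: "nat \<Rightarrow> nat \<Rightarrow> 'a::field mat \<Rightarrow> 'a mat" where
  "frob_mat q i A = map_mat (\<lambda>x. x ^ q ^ i) A"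

definition frob_vec :: "nat \<Rightarrow> nat \<Rightarrow> 'a::field vec \<Rightarrow> 'a vec" where
  "frob_vec q i v = map_vec (\<lambda>x. x ^ q ^ i) v"

definition artin_representation ::
    "'a::alg_closed_field set \<Rightarrow> 'a set \<Rightarrow> nat \<Rightarrow> (('a \<Rightarrow> 'a) \<Rightarrow> 'a mat) \<Rightarrow> bool" where
  "artin_representation F E n \<rho> \<longleftrightarrow>
     \<rho> \<in> hom (gal_group E) (GL n (algebraic_elements F)) \<and>
     continuous_map (krull_topology E)
       (discrete_topology (carrier (GL n (algebraic_elements F)))) \<rho>"

definition coefficient_field ::
    "'a::alg_closed_field set \<Rightarrow> 'a set \<Rightarrow> (('a \<Rightarrow> 'a) \<Rightarrow> 'a mat) \<Rightarrow> 'a set" where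
  "coefficient_field F E \<rho> =
     generate_field ambient (F \<union> (\<Union>g\<in>carrier (gal_group E). elements_mat (\<rho> g)))"

definition is_basis :: "'a::field set \<Rightarrow> 'a set \<Rightarrow> 'a vec \<Rightarrow> bool" where
  "is_basis F L \<alpha> \<longleftrightarrow> ring.independent ambient F (list_of_vec \<alpha>) \<and>
     ring.Span ambient F (list_of_vec \<alpha>) = L"


section \<open>Solutions and the companion matrix\<close>

definition Sol ::
    "'a::alg_closed_field set \<Rightarrow> 'a set \<Rightarrow> nat \<Rightarrow> (('a \<Rightarrow> 'a) \<Rightarrow> 'a mat) \<Rightarrow> 'a vec \<Rightarrow> 'a mat set" where
  "Sol F E n \<rho> \<alpha> = {x \<in> mats_over n (dim_vec \<alpha>) (sep_closure E).
     \<forall>g \<in> carrier (gal_group E). \<forall>l < dim_vec \<alpha>.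
       map_mat g x *\<^sub>v frob_vec (card F) l \<alpha> =
       mat_inv n (frob_mat (card F) l (\<rho> g)) *\<^sub>v (x *\<^sub>v frob_vec (card F) l \<alpha>)}"

(* Entries are listed column by column; the companion matrix below does not depend on the order. *)
definition vectorize :: "'a mat \<Rightarrow> 'a vec" where
  "vectorize x = vec (dim_row x * dim_col x) (\<lambda>k. x $$ (k mod dim_row x, k div dim_row x))"

definition fundamental_solution ::
    "'a::alg_closed_field set \<Rightarrow> 'a set \<Rightarrow> nat \<Rightarrow> (('a \<Rightarrow> 'a) \<Rightarrow> 'a mat) \<Rightarrow> 'a vec \<Rightarrow> 'a mat \<Rightarrow> bool" where
  "fundamental_solution F E n \<rho> \<alpha> u \<longleftrightarrow>
     u \<in> Sol F E n \<rho> \<alpha> \<and> ring.independent ambient F (list_of_vec (vectorize u))"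

definition moore_matrix :: "nat \<Rightarrow> 'a::field vec \<Rightarrow> 'a mat" where
  "moore_matrix q v = mat_of_cols (dim_vec v) (map (\<lambda>j. frob_vec q j v) [0..<dim_vec v])"

definition companion :: "nat \<Rightarrow> 'a::field vec \<Rightarrow> 'a mat" where
  "companion N f = mat N N (\<lambda>(i, j).
     if j = N - 1 then f $ i else if i = Suc j then 1 else 0)"

definition Phi :: "nat \<Rightarrow> 'a::field mat \<Rightarrow> 'a mat" where
  "Phi q u = (let v = vectorize u; N = dim_vec v in
     companion N (mat_inv N (moore_matrix q v) *\<^sub>v frob_vec q N v))"


section \<open>Twisted polynomials, Drinfeld modules, Anderson modules\<close>

text \<open>
  \<open>\<Sum>\<^sub>i c\<^sub>i \<tau>\<^sup>i\<close> in \<open>E[\<tau>]\<close> is stored as the element of \<^typ>\<open>'a poly\<close> with coefficients \<open>c\<^sub>i\<close>.  Only the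
  additive structure of \<^typ>\<open>'a poly\<close> is used for it; products are formed with \<open>skew_mult\<close>,
  which implements \<open>\<tau> c = c\<^sup>q \<tau>\<close>.  Since \<open>Mat\<^sub>N(E)[\<tau>] = Mat\<^sub>N(E[\<tau>])\<close>, an element of it is a
  matrix of such polynomials.
\<close>

definition skew_mult :: "nat \<Rightarrow> 'a::field poly \<Rightarrow> 'a poly \<Rightarrow> 'a poly" where
  "skew_mult q f g =
     (\<Sum>i\<le>degree f. \<Sum>j\<le>degree g. monom (coeff f i * coeff g j ^ q ^ i) (i + j))"

definition skew_poly_ring :: "nat \<Rightarrow> 'a::field set \<Rightarrow> 'a poly ring" where
  "skew_poly_ring q E =
     \<lparr>carrier = polys_over E, monoid.mult = skew_mult q, one = 1, zero = 0, add = (+)\<rparr>"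

definition skew_mat_mult :: "nat \<Rightarrow> 'a::field poly mat \<Rightarrow> 'a poly mat \<Rightarrow> 'a poly mat" where
  "skew_mat_mult q A B = mat (dim_row A) (dim_col B)
     (\<lambda>(i, j). \<Sum>k<dim_col A. skew_mult q (A $$ (i, k)) (B $$ (k, j)))"

definition drinfeld_module ::
    "'a::field set \<Rightarrow> 'a set \<Rightarrow> 'a \<Rightarrow> ('a poly \<Rightarrow> 'a poly) \<Rightarrow> bool" where
  "drinfeld_module F E \<theta> \<phi> \<longleftrightarrow>
     \<phi> \<in> Ring.ring_hom (ring_on (polys_over F)) (skew_poly_ring (card F) E) \<and>
     (\<forall>c\<in>F. \<phi> [:c:] = [:c:]) \<and> coeff (\<phi> [:0, 1:]) 0 = \<theta> \<and> degree (\<phi> [:0, 1:]) > 0"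

(* an Anderson t-module of dimension N, given by the image Et of t *)
definition anderson_module :: "'a::field set \<Rightarrow> 'a \<Rightarrow> nat \<Rightarrow> 'a poly mat \<Rightarrow> bool" where
  "anderson_module E \<theta> N Et \<longleftrightarrow> Et \<in> mats_over N N (polys_over E) \<and>
     (map_mat (\<lambda>p. coeff p 0) Et - \<theta> \<cdot>\<^sub>m 1\<^sub>m N) ^\<^sub>m N = 0\<^sub>m N N"


section \<open>Tensor products\<close>

text \<open>
  The tensor product over a commutative ring \<open>R\<close>: finite formal sums of pairs \<open>(m, n)\<close>, i.e.
  multisets, modulo the congruence generated by the bilinearity relations.  As
  \<open>(\<ominus> m, n)\<close> is an additive inverse of \<open>(m, n)\<close>, there is no need for formal differences.
\<close>

inductive tensor_rel ::
    "('r, 'x) ring_scheme \<Rightarrow> ('r, 'm, 'y) module_scheme \<Rightarrow> ('r, 'n, 'z) module_scheme \<Rightarrow>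
     ('m \<times> 'n) multiset \<Rightarrow> ('m \<times> 'n) multiset \<Rightarrow> bool"
  for R M N where
  refl: "set_mset P \<subseteq> carrier M \<times> carrier N \<Longrightarrow> tensor_rel R M N P P"
| sym: "tensor_rel R M N P Q \<Longrightarrow> tensor_rel R M N Q P"
| trans: "tensor_rel R M N P Q \<Longrightarrow> tensor_rel R M N Q U \<Longrightarrow> tensor_rel R M N P U"
| cong: "tensor_rel R M N P Q \<Longrightarrow> set_mset U \<subseteq> carrier M \<times> carrier N \<Longrightarrow>
    tensor_rel R M N (P + U) (Q + U)"
| add_left: "m \<in> carrier M \<Longrightarrow> m' \<in> carrier M \<Longrightarrow> n \<in> carrier N \<Longrightarrow>
    tensor_rel R M N {#(m \<oplus>\<^bsub>M\<^esub> m', n)#} {#(m, n), (m', n)#}"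
| add_right: "m \<in> carrier M \<Longrightarrow> n \<in> carrier N \<Longrightarrow> n' \<in> carrier N \<Longrightarrow>
    tensor_rel R M N {#(m, n \<oplus>\<^bsub>N\<^esub> n')#} {#(m, n), (m, n')#}"
| balanced: "r \<in> carrier R \<Longrightarrow> m \<in> carrier M \<Longrightarrow> n \<in> carrier N \<Longrightarrow>
    tensor_rel R M N {#(r \<odot>\<^bsub>M\<^esub> m, n)#} {#(m, r \<odot>\<^bsub>N\<^esub> n)#}"
| zero: "n \<in> carrier N \<Longrightarrow> tensor_rel R M N {#(\<zero>\<^bsub>M\<^esub>, n)#} {#}"

definition tensor_class ::
    "('r, 'x) ring_scheme \<Rightarrow> ('r, 'm, 'y) module_scheme \<Rightarrow> ('r, 'n, 'z) module_scheme \<Rightarrow>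
     ('m \<times> 'n) multiset \<Rightarrow> ('m \<times> 'n) multiset set" where
  "tensor_class R M N P = {Q. tensor_rel R M N P Q}"

(* the map f \<otimes> g with values in the tensor product of M and N *)
definition tensor_map ::
    "('r, 'x) ring_scheme \<Rightarrow> ('r, 'm, 'y) module_scheme \<Rightarrow> ('r, 'n, 'z) module_scheme \<Rightarrow>
     ('m1 \<Rightarrow> 'm) \<Rightarrow> ('n1 \<Rightarrow> 'n) \<Rightarrow> ('m1 \<times> 'n1) multiset set \<Rightarrow> ('m \<times> 'n) multiset set" where
  "tensor_map R M N f g A = (\<Union>P\<in>A. tensor_class R M N (image_mset (map_prod f g) P))"

definition tensor ::
    "('r, 'x) ring_scheme \<Rightarrow> ('r, 'm, 'y) module_scheme \<Rightarrow> ('r, 'n, 'z) module_scheme \<Rightarrow>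
     ('r, ('m \<times> 'n) multiset set) module" where
  "tensor R M N =
     \<lparr>carrier = {tensor_class R M N P | P. set_mset P \<subseteq> carrier M \<times> carrier N},
      monoid.mult = undefined, one = undefined,
      zero = tensor_class R M N {#},
      add = (\<lambda>A B. \<Union>P\<in>A. \<Union>Q\<in>B. tensor_class R M N (P + Q)),
      module.smult = (\<lambda>r. tensor_map R M N (\<lambda>m. r \<odot>\<^bsub>M\<^esub> m) (\<lambda>n. n))\<rparr>"


section \<open>Motives\<close>

(* modules over E[t] (or over E) with a Frobenius-semilinear operator *)
record ('r, 'm) tau_module = "('r, 'm) module" + tau :: "'m \<Rightarrow> 'm"

definition tau_isomorphic ::
    "('r, 'x) ring_scheme \<Rightarrow> ('r, 'm) tau_module \<Rightarrow> ('r, 'n) tau_module \<Rightarrow> bool" where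
  "tau_isomorphic R M N \<longleftrightarrow> (\<exists>h \<in> module_hom R M N.
     bij_betw h (carrier M) (carrier N) \<and> (\<forall>m \<in> carrier M. h (tau M m) = tau N (h m)))"

definition anderson_motive ::
    "nat \<Rightarrow> 'a::field set \<Rightarrow> nat \<Rightarrow> 'a poly mat \<Rightarrow> ('a poly, 'a poly mat) tau_module" where
  "anderson_motive q E N Et =
     \<lparr>carrier = mats_over 1 N (polys_over E),
      monoid.mult = undefined, one = undefined,
      zero = 0\<^sub>m 1 N,
      add = (+),
      module.smult = (\<lambda>p v. mat 1 N (\<lambda>ij. \<Sum>k\<le>degree p.
        Polynomial.smult (coeff p k) (((\<lambda>w. skew_mat_mult q w Et) ^^ k) v $$ ij))),
      tau = map_mat (skew_mult q (monom 1 1))\<rparr>"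

(* free of finite rank over E[t], not just finitely generated *)
definition abelian_module :: "nat \<Rightarrow> 'a::field set \<Rightarrow> nat \<Rightarrow> 'a poly mat \<Rightarrow> bool" where
  "abelian_module q E N Et \<longleftrightarrow> (let R = ring_on (polys_over E); M = anderson_motive q E N Et in
     \<exists>B. finite B \<and> B \<subseteq> carrier M \<and> module.lin_indpt R M B \<and> module.gen_set R M B)"

definition scalars_as_module :: "'a::comm_ring_1 set \<Rightarrow> ('a, 'a) module" where
  "scalars_as_module S =
     \<lparr>carrier = S, monoid.mult = (*), one = 1, zero = 0, add = (+), module.smult = (*)\<rparr>"

definition polys_as_module :: "'a::comm_ring_1 set \<Rightarrow> ('a, 'a poly) module" where
  "polys_as_module S =
     \<lparr>carrier = polys_over S, monoid.mult = (*), one = 1, zero = 0, add = (+),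
      module.smult = Polynomial.smult\<rparr>"

(* Res V_rho for coefficient field L: the space L^n, with scalars taken from F_q only *)
definition rep_space :: "nat \<Rightarrow> 'a::field set \<Rightarrow> ('a, 'a vec) module" where
  "rep_space n L = (module_vec TYPE('a) n)\<lparr>carrier := {v \<in> carrier_vec n. set\<^sub>v v \<subseteq> L}\<rparr>"

(* (E^sep \<otimes> Res V_rho)^G_E as an E-space with the Frobenius of E^sep *)
definition rep_invariants ::
    "'a::alg_closed_field set \<Rightarrow> 'a set \<Rightarrow> nat \<Rightarrow> (('a \<Rightarrow> 'a) \<Rightarrow> 'a mat) \<Rightarrow>
     ('a, ('a \<times> 'a vec) multiset set) tau_module" where
  "rep_invariants F E n \<rho> =
     (let R = ring_on F;
          S = scalars_as_module (sep_closure E);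
          V = rep_space n (coefficient_field F E \<rho>);
          T = tensor R S V in
      \<lparr>carrier = {w \<in> carrier T. \<forall>g \<in> carrier (gal_group E).
          tensor_map R S V g (\<lambda>v. \<rho> g *\<^sub>v v) w = w},
       monoid.mult = undefined, one = undefined,
       zero = \<zero>\<^bsub>T\<^esub>,
       add = (\<oplus>\<^bsub>T\<^esub>),
       module.smult = (\<lambda>e. tensor_map R S V (\<lambda>x. e * x) (\<lambda>v. v)),
       tau = tensor_map R S V (\<lambda>x. x ^ card F) (\<lambda>v. v)\<rparr>)"

definition rep_motive ::
    "'a::alg_closed_field set \<Rightarrow> 'a set \<Rightarrow> nat \<Rightarrow> (('a \<Rightarrow> 'a) \<Rightarrow> 'a mat) \<Rightarrow>
     ('a poly, (('a \<times> 'a vec) multiset set \<times> 'a poly) multiset set) tau_module" where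
  "rep_motive F E n \<rho> =
     (let R = ring_on E; W = rep_invariants F E n \<rho>; L = polys_as_module E; T = tensor R W L in
      \<lparr>carrier = carrier T,
       monoid.mult = undefined, one = undefined,
       zero = \<zero>\<^bsub>T\<^esub>,
       add = (\<oplus>\<^bsub>T\<^esub>),
       module.smult = (\<lambda>p. tensor_map R W L (\<lambda>w. w) (\<lambda>f. p * f)),
       tau = tensor_map R W L (tau W) (map_poly (\<lambda>c. c ^ card F))\<rparr>)"

definition tau_tensor ::
    "('r, 'x) ring_scheme \<Rightarrow> ('r, 'm) tau_module \<Rightarrow> ('r, 'n) tau_module \<Rightarrow>
     ('r, ('m \<times> 'n) multiset set) tau_module" where
  "tau_tensor R M N = module.extend (tensor R M N) \<lparr>tau = tensor_map R M N (tau M) (tau N)\<rparr>"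

(* M(phi): phi is the one-dimensional t-module with phi_t as 1 x 1 matrix *)
definition twisted_motive ::
    "'a::alg_closed_field set \<Rightarrow> 'a set \<Rightarrow> ('a poly \<Rightarrow> 'a poly) \<Rightarrow> nat \<Rightarrow> (('a \<Rightarrow> 'a) \<Rightarrow> 'a mat) \<Rightarrow>
     ('a poly, ('a poly mat \<times> (('a \<times> 'a vec) multiset set \<times> 'a poly) multiset set) multiset set)
       tau_module" where
  "twisted_motive F E \<phi> n \<rho> = tau_tensor (ring_on (polys_over E))
     (anderson_motive (card F) E 1 (mat 1 1 (\<lambda>_. \<phi> [:0, 1:]))) (rep_motive F E n \<rho>)"

definition artin_twist ::
    "'a::alg_closed_field set \<Rightarrow> 'a set \<Rightarrow> 'a \<Rightarrow> ('a poly \<Rightarrow> 'a poly) \<Rightarrow> nat \<Rightarrow>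
     (('a \<Rightarrow> 'a) \<Rightarrow> 'a mat) \<Rightarrow> nat \<Rightarrow> 'a poly mat \<Rightarrow> bool" where
  "artin_twist F E \<theta> \<phi> n \<rho> N Et \<longleftrightarrow>
     anderson_module E \<theta> N Et \<and> abelian_module (card F) E N Et \<and>
     tau_isomorphic (ring_on (polys_over E))
       (anderson_motive (card F) E N Et) (twisted_motive F E \<phi> n \<rho>)"


section \<open>The explicit model\<close>

(* frob_prod q N \<Psi> i = \<Psi> \<Psi>^(1) ... \<Psi>^(i-1) *)
primrec frob_prod :: "nat \<Rightarrow> nat \<Rightarrow> 'a::field mat \<Rightarrow> nat \<Rightarrow> 'a mat" where
  "frob_prod q N \<Psi> 0 = 1\<^sub>m N"
| "frob_prod q N \<Psi> (Suc i) = frob_prod q N \<Psi> i * frob_mat q i \<Psi>"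

definition model_t :: "nat \<Rightarrow> nat \<Rightarrow> 'a::field \<Rightarrow> (nat \<Rightarrow> 'a) \<Rightarrow> nat \<Rightarrow> 'a mat \<Rightarrow> 'a poly mat" where
  "model_t q N \<theta> a r \<Psi> = mat N N (\<lambda>jk.
     monom ((\<theta> \<cdot>\<^sub>m 1\<^sub>m N) $$ jk) 0 +
     (\<Sum>i = 1..r. monom ((a i \<cdot>\<^sub>m frob_prod q N \<Psi> i) $$ jk) i))"

end

theory Submission
  imports Defs "Jordan_Normal_Form.Determinant" "HOL-Library.Function_Algebras"
begin

text \<open>
  Let \<open>L\<close> be the coefficient field of \<open>\<rho>\<close>. In terms of an \<open>F\<^sub>q\<close>-basis of \<open>L\<^sup>n\<close>, the defining equations
  of a solution \<open>u\<close>, one for each conjugate of \<open>\<alpha>\<close>, say that \<open>u\<close> is a Galois invariant element of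
  \<open>E^sep \<otimes> L\<^sup>n\<close>. If its entries are linearly independent, its Moore matrix \<open>M\<close> is invertible, and since
  \<open>E\<close> is the fixed field of the Galois group, the invariants have the \<open>E\<close>-basis \<open>u, u^(1), \<dots>, u^(N-1)\<close>.
  The Frobenius maps each of these to the next one and \<open>u^(N-1)\<close> to \<open>u^(N) = \<Sum>\<^sub>i f\<^sub>i u^(i)\<close>, so its matrix is
  the companion matrix \<open>\<Phi> = M\<inverse> M^(1)\<close>, which therefore is invertible over \<open>E\<close>.

  Consequently the twisted motive is \<open>E[\<tau>]\<^sup>N\<close> with \<open>t\<close> acting by right multiplication by \<open>\<phi>\<^sub>t\<close>, but with
  \<open>\<Phi> \<tau>\<close> in place of \<open>\<tau>\<close>. Multiplying the coefficients at \<open>\<tau>\<^sup>k\<close> by \<open>(\<Phi> \<Phi>^(1) \<dots> \<Phi>^(k-1))\<inverse>\<close> restores the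
  usual \<open>\<tau>\<close> and turns \<open>t\<close> into right multiplication by the matrix of the model.
\<close>

section \<open>Subfields and polynomials over them\<close>

text \<open>Everything is computed in coordinates, because a tensor product is given as a set of
  classes of multisets: a bilinear map with normal forms identifies each of the three that occur
  with vectors of length N, over E^sep, over E[t] and over E[\<tau>] in turn, and all operations are
  read off there. The scalar axioms for the motive of the model are likewise pulled back along a
  bijection with coordinates.

  The transpose in \<Psi> comes from a change of sides: \<Phi> acts on columns of coordinates,
  whereas elements of the motive are rows on which the t-module acts from the right.

  Descent needs that E^sep is a field and that the Galois group fixes nothing outside E. Both come
  down to one count: a polynomial without repeated roots has as many roots as its degree.
  Automorphisms are obtained by extending homomorphisms with Zorn's lemma inside the ambient
  algebraically closed field.

  Freeness over E[t] is a matter of degrees in \<tau>: multiplication by t adds the degree r of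
  \<open>\<phi>\<^sub>t\<close>, so the powers of \<tau> below the r-th form a basis of
  E[\<tau>].\<close>

locale subfld =
  fixes K :: "'a::field set"
  assumes zero [simp, intro]: "0 \<in> K" and one [simp, intro]: "1 \<in> K"
    and add [simp, intro]: "x \<in> K \<Longrightarrow> y \<in> K \<Longrightarrow> x + y \<in> K"
    and mult [simp, intro]: "x \<in> K \<Longrightarrow> y \<in> K \<Longrightarrow> x * y \<in> K"
    and uminus [simp, intro]: "x \<in> K \<Longrightarrow> - x \<in> K"
    and inverse [simp, intro]: "x \<in> K \<Longrightarrow> inverse x \<in> K"
begin

lemma diff [simp, intro]: "x \<in> K \<Longrightarrow> y \<in> K \<Longrightarrow> x - y \<in> K"
  using add[of x "- y"] uminus[of y] by simp

lemma divide [simp, intro]: "x \<in> K \<Longrightarrow> y \<in> K \<Longrightarrow> x / y \<in> K"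
  by (simp add: divide_inverse)

lemma power [simp, intro]: "x \<in> K \<Longrightarrow> x ^ n \<in> K"
  by (induction n) auto

lemma of_nat [simp, intro]: "of_nat n \<in> K"
  by (induction n) auto

lemma sum [intro]: "(\<And>i. i \<in> I \<Longrightarrow> f i \<in> K) \<Longrightarrow> sum f I \<in> K"
  by (induction I rule: infinite_finite_induct) auto

lemma prod [intro]: "(\<And>i. i \<in> I \<Longrightarrow> f i \<in> K) \<Longrightarrow> prod f I \<in> K"
  by (induction I rule: infinite_finite_induct) auto

lemma polys_add [simp, intro]: "f \<in> polys_over K \<Longrightarrow> g \<in> polys_over K \<Longrightarrow> f + g \<in> polys_over K"
  and polys_diff [simp, intro]: "f \<in> polys_over K \<Longrightarrow> g \<in> polys_over K \<Longrightarrow> f - g \<in> polys_over K"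
  and polys_minus [simp, intro]: "f \<in> polys_over K \<Longrightarrow> - f \<in> polys_over K"
  and polys_zero [simp, intro]: "0 \<in> polys_over K"
  and polys_monom [simp, intro]: "c \<in> K \<Longrightarrow> monom c n \<in> polys_over K"
  and polys_smult [simp, intro]: "c \<in> K \<Longrightarrow> f \<in> polys_over K \<Longrightarrow> Polynomial.smult c f \<in> polys_over K"
  by (auto simp: polys_over_def)

lemma polys_one [simp, intro]: "1 \<in> polys_over K"
  by (simp add: polys_over_def coeff_1)

lemma polys_pCons [simp, intro]: "c \<in> K \<Longrightarrow> f \<in> polys_over K \<Longrightarrow> pCons c f \<in> polys_over K"
  by (auto simp: polys_over_def coeff_pCons split: nat.split)

lemma polys_mult [simp, intro]: "f \<in> polys_over K \<Longrightarrow> g \<in> polys_over K \<Longrightarrow> f * g \<in> polys_over K"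
  by (auto simp: polys_over_def coeff_mult)

lemma polys_power [simp, intro]: "f \<in> polys_over K \<Longrightarrow> f ^ n \<in> polys_over K"
  by (induction n) auto

lemma polys_sum [intro]: "(\<And>i. i \<in> I \<Longrightarrow> f i \<in> polys_over K) \<Longrightarrow> sum f I \<in> polys_over K"
  by (induction I rule: infinite_finite_induct) auto

lemma polys_pderiv [simp, intro]: "f \<in> polys_over K \<Longrightarrow> pderiv f \<in> polys_over K"
  by (simp add: polys_over_def coeff_pderiv del: of_nat_Suc)

lemma polys_coeff [intro]: "f \<in> polys_over K \<Longrightarrow> coeff f i \<in> K"
  by (auto simp: polys_over_def)

lemma polys_pcompose [intro]:
  assumes "f \<in> polys_over K" "g \<in> polys_over K"
  shows "f \<circ>\<^sub>p g \<in> polys_over K"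
  using assms(1)
proof (induction f)
  case (pCons a f)
  then have "coeff (pCons a f) 0 \<in> K" "\<And>i. coeff (pCons a f) (Suc i) \<in> K"
    by (blast intro: polys_coeff)+
  then show ?case using pCons.IH assms(2) unfolding pcompose_pCons
    by (intro polys_add polys_mult) (auto simp: polys_over_def)
qed simp

lemma poly_closed [intro]: "f \<in> polys_over K \<Longrightarrow> x \<in> K \<Longrightarrow> poly f x \<in> K"
  by (auto simp: poly_altdef polys_over_def)

text \<open>The leading term of f is cancelled by a monomial multiple of p whose coefficient is a
  quotient of leading coefficients. That quotient lies in K, so quotient and remainder keep their
  coefficients in K although \<open>poly\<close> is formed over the whole ambient type.\<close>

lemma division:
  assumes p: "p \<in> polys_over K" "p \<noteq> 0" and f: "f \<in> polys_over K"
  shows "\<exists>s\<in>polys_over K. \<exists>h\<in>polys_over K. f = p * s + h \<and> (h = 0 \<or> degree h < degree p)"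
  using f
proof (induction "degree f" arbitrary: f rule: less_induct)
  case less
  show ?case
  proof (cases "f = 0 \<or> degree f < degree p")
    case True
    then show ?thesis using less.prems by (intro bexI[of _ 0] bexI[of _ f]) auto
  next
    case False
    define c where "c = lead_coeff f / lead_coeff p"
    define m where "m = monom c (degree f - degree p)"
    have m: "m \<in> polys_over K" using less.prems p by (auto simp: m_def c_def)
    have c: "c \<noteq> 0" using False p by (auto simp: c_def)
    have dm: "degree m = degree f - degree p" using c by (simp add: m_def degree_monom_eq)
    have "m \<noteq> 0" using c by (simp add: m_def)
    then have dpm: "degree (p * m) = degree f"
      using False p dm by (simp add: degree_mult_eq)
    have lc: "coeff (p * m) (degree f) = lead_coeff f"
      using p dpm by (metis c_def lead_coeff_mult lead_coeff_monom m_def nonzero_mult_div_cancel_left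
          times_divide_eq_right leading_coeff_0_iff)
    have "f - p * m = 0 \<or> degree (f - p * m) < degree f"
      by (rule eq_zero_or_degree_less) (use dpm lc in \<open>auto intro: degree_diff_le\<close>)
    then show ?thesis
    proof
      assume "f - p * m = 0"
      then show ?thesis using m by (intro bexI[of _ m] bexI[of _ 0]) auto
    next
      assume "degree (f - p * m) < degree f"
      from less.hyps[OF this] less.prems p m obtain s h where sh: "s \<in> polys_over K" "h \<in> polys_over K"
        "f - p * m = p * s + h" "h = 0 \<or> degree h < degree p" by auto
      have "f = p * (s + m) + h" using sh(3) by (simp add: algebra_simps)
      then show ?thesis using sh m by blast
    qed
  qed
qed

end

lemma subfld_of_subfield:
  assumes "subfield K (ambient :: 'a::field ring)"
  shows "subfld K"
proof -
  interpret R: Ring.field "ambient :: 'a ring" by (rule field_from_type_algebra)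
  note sr = subringE[OF subfieldE(1)[OF assms]]
  have um: "- x \<in> K" if "x \<in> K" for x
  proof -
    have "\<ominus>\<^bsub>ambient\<^esub> x = - x"
      by (rule R.minus_equality) (auto simp: ring_of_type_algebra_def)
    then show ?thesis using sr(5)[OF that] by simp
  qed
  have iv: "inverse x \<in> K" if "x \<in> K" for x
  proof (cases "x = 0")
    case True then show ?thesis using that by simp
  next
    case False
    have "inv\<^bsub>ambient\<^esub> x = inverse x"
      by (rule R.comm_inv_char) (use False in \<open>auto simp: ring_of_type_algebra_def\<close>)
    then show ?thesis using R.subfield_m_inv(1)[OF assms, of x] that False
      by (simp add: ring_of_type_algebra_def)
  qed
  show ?thesis
    by unfold_locales (use sr um iv in \<open>auto simp: ring_of_type_algebra_def\<close>)
qed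

text \<open>Least degree takes the place of irreducibility. There is no monic normalisation, so P is
  determined only up to a scalar; hence a predicate instead of a function.\<close>

definition minpoly :: "'a::field set \<Rightarrow> 'a \<Rightarrow> 'a poly \<Rightarrow> bool" where
  "minpoly K x P \<longleftrightarrow> P \<in> polys_over K \<and> P \<noteq> 0 \<and> poly P x = 0 \<and>
     (\<forall>f \<in> polys_over K. poly f x = 0 \<longrightarrow> f = 0 \<or> degree P \<le> degree f)"

lemma minpoly_exists:
  assumes "f \<in> polys_over K" "f \<noteq> 0" "poly f x = 0"
  obtains P where "minpoly K x P"
proof -
  let ?Q = "\<lambda>f. f \<in> polys_over K \<and> f \<noteq> 0 \<and> poly f x = 0"
  from ex_has_least_nat[of ?Q f degree] assms
  obtain P where "?Q P" "\<forall>g. ?Q g \<longrightarrow> degree P \<le> degree g" by auto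
  then show thesis using that by (auto simp: minpoly_def)
qed

context subfld
begin

lemma minpoly_dvd:
  assumes "minpoly K x P" "f \<in> polys_over K" "poly f x = 0"
  obtains s where "s \<in> polys_over K" "f = P * s"
proof -
  from division[of P f] assms obtain s h where sh: "s \<in> polys_over K" "h \<in> polys_over K"
    "f = P * s + h" "h = 0 \<or> degree h < degree P" by (auto simp: minpoly_def)
  have "poly h x = 0" using sh assms by (simp add: minpoly_def)
  then have "h = 0" using sh assms by (fastforce simp: minpoly_def)
  then show thesis using sh that by auto
qed

lemma minpoly_degree_pos: "minpoly K x P \<Longrightarrow> degree P > 0"
  by (auto simp: minpoly_def elim!: degree_eq_zeroE intro!: Nat.gr0I)

text \<open>Divide P by a minimal polynomial Q of a, P = Q s. One of Q and s vanishes at x and so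
  has degree at least that of P; it cannot be s, because Q has positive degree. So Q and P have the
  same degree.\<close>

lemma minpoly_conj:
  assumes "minpoly K x P" "poly P a = 0"
  shows "minpoly K a P"
proof -
  from minpoly_exists[of P K a] assms obtain Q where Q: "minpoly K a Q" by (auto simp: minpoly_def)
  from minpoly_dvd[OF Q _ assms(2)] assms obtain s where s: "s \<in> polys_over K" "P = Q * s"
    by (auto simp: minpoly_def)
  have "P \<noteq> 0" using assms by (auto simp: minpoly_def)
  then have deg: "degree P = degree Q + degree s" "s \<noteq> 0" "Q \<noteq> 0"
    using s by (auto simp: degree_mult_eq)
  have "poly Q x = 0 \<or> poly s x = 0" using s assms by (auto simp: minpoly_def)
  then have "degree P \<le> degree Q"
    using assms s deg Q minpoly_degree_pos[OF Q] unfolding minpoly_def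
    by (metis add.commute le_add_same_cancel1 less_le_not_le linorder_not_less nat_less_le add_le_same_cancel1 le_numeral_extra(3))
  then show ?thesis using Q assms unfolding minpoly_def by (metis order_trans)
qed

end

lemma rsquarefree_poly_pderiv:
  assumes "rsquarefree (G :: 'a::idom poly)" "poly G x = 0"
  shows "poly (pderiv G) x \<noteq> 0"
proof -
  have "order x G = 1" using assms unfolding rsquarefree_def by (metis order_root)
  then have "[:-x, 1:] ^ 1 dvd G" "\<not> [:-x, 1:] ^ 2 dvd G"
    using order_1[of x G] order_2[of G x] assms by (auto simp: rsquarefree_def numeral_2_eq_2)
  then obtain r where r: "G = [:-x, 1:] * r" by (auto elim: dvdE)
  have "poly r x \<noteq> 0"
  proof
    assume "poly r x = 0"
    then have "[:-x, 1:] dvd r" by (simp add: poly_eq_0_iff_dvd)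
    then have "[:-x, 1:] ^ 2 dvd G" unfolding r power2_eq_square by (rule mult_dvd_mono[OF dvd_refl])
    then show False using \<open>\<not> [:-x, 1:] ^ 2 dvd G\<close> by blast
  qed
  then show ?thesis unfolding r pderiv_mult by (simp add: pderiv_pCons)
qed

lemma degree_pderiv_le: "degree (pderiv p) \<le> degree p - 1"
  by (rule degree_le) (auto simp: coeff_pderiv coeff_eq_0)

lemma rsquarefreeI_pderiv:
  assumes "G \<noteq> (0 :: 'a::idom poly)" "\<And>x. poly G x = 0 \<Longrightarrow> poly (pderiv G) x \<noteq> 0"
  shows "rsquarefree G"
  unfolding rsquarefree_def
proof (intro conjI allI assms(1))
  fix a show "order a G = 0 \<or> order a G = 1"
  proof (rule ccontr)
    assume H: "\<not> ?thesis"
    then have "[:-a, 1:] ^ 2 dvd G" using order_1[of a G] by (metis One_nat_def dvd_trans le_imp_power_dvd less_2_cases not_less)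
    then obtain r where r: "G = [:-a, 1:] ^ 2 * r" by (auto elim: dvdE)
    have "poly G a = 0" "poly (pderiv G) a = 0"
      unfolding r power2_eq_square mult.assoc pderiv_mult by simp_all
    then show False using assms by blast
  qed
qed

text \<open>Over an algebraically closed field a polynomial without repeated roots has as many roots
  as its degree, too many for a nonzero f of smaller degree. This is how separability enters: facts
  about all conjugates of an element become polynomial identities.\<close>

lemma rsquarefree_dvd_of_roots:
  assumes "rsquarefree (P :: 'a::alg_closed_field poly)" "\<And>a. poly P a = 0 \<Longrightarrow> poly f a = 0"
    "degree f < degree P"
  shows "f = 0"
proof (rule ccontr)
  assume f: "f \<noteq> 0"
  have P: "P \<noteq> 0" using assms by (auto simp: rsquarefree_def)
  from alg_closed_imp_factorization[OF P] obtain A where A: "size A = degree P"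
    "P = Polynomial.smult (lead_coeff P) (\<Prod>x\<in>#A. [:-x, 1:])" by blast
  have "count A a \<le> 1" for a
  proof (rule ccontr)
    assume "\<not> count A a \<le> 1"
    then have "replicate_mset 2 a \<subseteq># A"
      by (simp add: count_le_replicate_mset_subset_eq[symmetric])
    then obtain B where B: "A = add_mset a (add_mset a B)"
      by (auto simp: mset_subset_eq_exists_conv numeral_2_eq_2)
    have "[:-a,1:] ^ 2 dvd P"
      by (subst A(2)) (simp add: B power2_eq_square dvd_smult del: mult_pCons_left mult_pCons_right flip: mult.assoc)
    then have "order a P \<ge> 2" using P by (simp add: order_divides)
    then show False using assms(1) unfolding rsquarefree_def by (metis not_numeral_le_zero numeral_le_one_iff semiring_norm(69))
  qed
  then have "A = mset_set (set_mset A)"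
    by (intro multiset_eqI) (metis count_eq_zero_iff count_mset_set(1) count_mset_set(3) finite_set_mset le_antisym
        less_one linorder_not_less)
  then have "card (set_mset A) = degree P" using A by (metis size_mset_set)
  moreover have "set_mset A \<subseteq> {x. poly f x = 0}"
  proof
    fix x assume "x \<in># A"
    then have "poly P x = 0" by (subst A(2)) (auto simp: poly_prod_mset prod_mset_zero_iff)
    then show "x \<in> {x. poly f x = 0}" using assms by auto
  qed
  ultimately have "degree P \<le> card {x. poly f x = 0}"
    using card_mono[OF poly_roots_finite[OF f]] by metis
  also have "\<dots> \<le> degree f" by (rule card_poly_roots_bound[OF f])
  finally have "degree P \<le> degree f" .
  then show False using assms by simp
qed

section \<open>The separable closure\<close>

text \<open>G = P s gives G'(x) = P'(x) s(x), so P' is not zero. Every root a of P has P as minimal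
  polynomial, and the nonzero P' has smaller degree, so it cannot vanish at a.\<close>

lemma minpoly_rsquarefree:
  fixes K :: "'b::alg_closed_field set" assumes K: "subfld K"
  assumes "G \<in> polys_over K" "poly G x = 0" "poly (pderiv G) x \<noteq> 0" "minpoly K x P"
  shows "rsquarefree P"
proof (rule rsquarefreeI_pderiv)
  interpret subfld K by fact
  show "P \<noteq> 0" using assms by (auto simp: minpoly_def)
  from minpoly_dvd[OF assms(5,2,3)] obtain s where s: "s \<in> polys_over K" "G = P * s" by blast
  have "poly (pderiv P) x \<noteq> 0"
    using assms(4,5) by (auto simp: s pderiv_mult minpoly_def)
  then have P': "pderiv P \<noteq> 0" by auto
  fix a assume "poly P a = 0"
  then have a: "minpoly K a P" using minpoly_conj assms by blast
  show "poly (pderiv P) a \<noteq> 0"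
  proof
    assume "poly (pderiv P) a = 0"
    then have "degree P \<le> degree (pderiv P)" using a P' by (auto simp: minpoly_def)
    then show False using degree_pderiv_le[of P] minpoly_degree_pos[OF a] by linarith
  qed
qed

text \<open>Only the root x of G has to be simple here, which makes the condition easy to verify and
  to transport to larger fields; the minimal polynomial then supplies a polynomial all of whose
  roots are simple.\<close>

lemma sep_closure_iff:
  fixes K :: "'b::alg_closed_field set" assumes K: "subfld K"
  shows "x \<in> sep_closure K \<longleftrightarrow> (\<exists>G\<in>polys_over K. poly G x = 0 \<and> poly (pderiv G) x \<noteq> 0)"
proof
  assume "x \<in> sep_closure K"
  then show "\<exists>G\<in>polys_over K. poly G x = 0 \<and> poly (pderiv G) x \<noteq> 0"
    using rsquarefree_poly_pderiv unfolding sep_closure_def by blast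
next
  assume "\<exists>G\<in>polys_over K. poly G x = 0 \<and> poly (pderiv G) x \<noteq> 0"
  then obtain G where G: "G\<in>polys_over K" "poly G x = 0" "poly (pderiv G) x \<noteq> 0" by blast
  then have "G \<noteq> 0" by auto
  with minpoly_exists G obtain P where P: "minpoly K x P" by metis
  show "x \<in> sep_closure K"
    using minpoly_rsquarefree[OF K G P] P by (auto simp: sep_closure_def minpoly_def)
qed

text \<open>The ring K[x]; it is a field as soon as x has a minimal polynomial.\<close>

definition adjoin :: "'a::field set \<Rightarrow> 'a \<Rightarrow> 'a set" where
  "adjoin K x = (\<lambda>f. poly f x) ` polys_over K"

context subfld
begin

lemma adjoin_base: "K \<subseteq> adjoin K x"
proof
  fix c assume "c \<in> K"
  then have "[:c:] \<in> polys_over K" by auto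
  then show "c \<in> adjoin K x" unfolding adjoin_def by (intro image_eqI[of _ _ "[:c:]"]) auto
qed

lemma adjoin_self: "x \<in> adjoin K x"
proof -
  have "[:0, 1:] \<in> polys_over K" by auto
  then show ?thesis unfolding adjoin_def by (intro image_eqI[of _ _ "[:0, 1:]"]) auto
qed

text \<open>Euclid's algorithm: for f of positive degree the remainder in P = f s + h is nonzero by
  minimality of P, and h(x) = - f(x) s(x). By induction 1/h(x) lies in K[x], and 1/f(x) = -
  s(x)/h(x).\<close>

lemma adjoin_inverse:
  assumes P: "minpoly K x P"
  assumes "f \<in> polys_over K" "degree f < degree P" "f \<noteq> 0"
  shows "inverse (poly f x) \<in> adjoin K x"
  using assms(2-)
proof (induction "degree f" arbitrary: f rule: less_induct)
  case less
  show ?case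
  proof (cases "degree f = 0")
    case True
    then obtain c where "f = [:c:]" by (auto elim: degree_eq_zeroE)
    then show ?thesis using less.prems adjoin_base[of x] by (auto simp: polys_over_def coeff_pCons split: nat.splits)
  next
    case False
    have Px: "P \<in> polys_over K" "poly P x = 0" "P \<noteq> 0" using P by (auto simp: minpoly_def)
    obtain s h where sh: "s \<in> polys_over K" "h \<in> polys_over K" "P = f * s + h" "h = 0 \<or> degree h < degree f"
      using division[of f P] less.prems Px by auto
    have "h \<noteq> 0"
    proof
      assume h: "h = 0"
      then have deg: "degree P = degree f + degree s" "s \<noteq> 0" using sh Px by (auto simp: degree_mult_eq)
      have "poly f x = 0 \<or> poly s x = 0" using sh h Px by auto
      then show False using P sh less.prems deg False unfolding minpoly_def
        by (metis add_diff_cancel_left' diff_is_0_eq' less_add_same_cancel2 less_le_not_le linorder_not_less neq0_conv)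
    qed
    then have "degree h < degree f" using sh by auto
    from less.hyps[OF this] sh \<open>h \<noteq> 0\<close> less.prems obtain k where k: "k \<in> polys_over K" "inverse (poly h x) = poly k x"
      unfolding adjoin_def using \<open>degree h < degree f\<close> by force
    have hx: "poly h x = - (poly f x * poly s x)" using sh Px by (metis add.inverse_unique add.commute minus_minus neg_eq_iff_add_eq_0 poly_add poly_mult)
    have "poly h x \<noteq> 0" using P sh \<open>h \<noteq> 0\<close> \<open>degree h < degree f\<close> less.prems by (fastforce simp: minpoly_def)
    then have "inverse (poly f x) = poly (- s * k) x"
    proof -
      have "1 = poly k x * poly h x" using k(2) \<open>poly h x \<noteq> 0\<close> by (metis left_inverse)
      then have "poly f x * poly (- s * k) x = 1" by (simp add: hx ac_simps)
      then show ?thesis by (rule inverse_unique)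
    qed
    then show ?thesis unfolding adjoin_def using sh k by blast
  qed
qed

lemma adjoin_reduce:
  assumes "minpoly K x P" "z \<in> adjoin K x"
  obtains f where "f \<in> polys_over K" "poly f x = z" "degree f < degree P"
proof -
  from assms obtain g where g: "g \<in> polys_over K" "poly g x = z" by (auto simp: adjoin_def)
  from division[of P g] assms g obtain s h where sh: "s \<in> polys_over K" "h \<in> polys_over K"
    "g = P * s + h" "h = 0 \<or> degree h < degree P" by (auto simp: minpoly_def)
  then have "poly h x = z" using g assms by (auto simp: minpoly_def)
  moreover have "degree h < degree P" using sh(4) minpoly_degree_pos[OF assms(1)] by auto
  ultimately show thesis using that sh(2) by blast
qed

lemma adjoin_subfld:
  assumes P: "minpoly K x P"
  shows "subfld (adjoin K x)"
proof
  show "0 \<in> adjoin K x" "1 \<in> adjoin K x" using adjoin_base by auto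
  fix a b assume "a \<in> adjoin K x" "b \<in> adjoin K x"
  then obtain f g where fg: "f \<in> polys_over K" "g \<in> polys_over K" "a = poly f x" "b = poly g x"
    by (auto simp: adjoin_def)
  show "a + b \<in> adjoin K x" unfolding adjoin_def using fg by (intro image_eqI[of _ _ "f + g"]) auto
  show "a * b \<in> adjoin K x" unfolding adjoin_def using fg by (intro image_eqI[of _ _ "f * g"]) auto
next
  fix a assume a: "a \<in> adjoin K x"
  then obtain f where fg: "f \<in> polys_over K" "a = poly f x" by (auto simp: adjoin_def)
  show "- a \<in> adjoin K x" unfolding adjoin_def using fg by (intro image_eqI[of _ _ "- f"]) auto
  obtain g where g: "g \<in> polys_over K" "poly g x = a" "degree g < degree P"
    using adjoin_reduce[OF P a] .
  show "inverse a \<in> adjoin K x"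
    using adjoin_inverse[OF P g(1,3)] g(2) adjoin_base[of x] by (cases "g = 0") auto
qed

end

lemma polys_over_mono: "K \<subseteq> L \<Longrightarrow> polys_over K \<subseteq> polys_over L"
  by (auto simp: polys_over_def)


lemma adjoin_mono: "K \<subseteq> L \<Longrightarrow> adjoin K x \<subseteq> adjoin L x"
  using polys_over_mono[of K L] by (auto simp: adjoin_def)

text \<open>K(w) as a set of fractions, which is a field whether or not w is algebraic. It is used
  with w = \<open>z ^ q\<close>, where the separability of z is still to be shown.\<close>

definition simple_ext_field :: "'a::field set \<Rightarrow> 'a \<Rightarrow> 'a set" where
  "simple_ext_field K w = {poly f w / poly g w | f g. f \<in> polys_over K \<and> g \<in> polys_over K \<and> poly g w \<noteq> 0}"

lemma (in subfld) simple_ext_fieldI: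
  "f \<in> polys_over K \<Longrightarrow> g \<in> polys_over K \<Longrightarrow> poly g w \<noteq> 0 \<Longrightarrow> z = poly f w / poly g w
    \<Longrightarrow> z \<in> simple_ext_field K w"
  by (auto simp: simple_ext_field_def)

lemma (in subfld) simple_ext_field_subfld: "subfld (simple_ext_field K w)"
proof
  show "0 \<in> simple_ext_field K w" by (rule simple_ext_fieldI[of 0 1]) auto
  show "1 \<in> simple_ext_field K w" by (rule simple_ext_fieldI[of 1 1]) auto
next
  fix a b assume "a \<in> simple_ext_field K w" "b \<in> simple_ext_field K w"
  then obtain f g h k where fg: "f \<in> polys_over K" "g \<in> polys_over K" "poly g w \<noteq> 0" "a = poly f w / poly g w"
    "h \<in> polys_over K" "k \<in> polys_over K" "poly k w \<noteq> 0" "b = poly h w / poly k w"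
    by (auto simp: simple_ext_field_def)
  show "a + b \<in> simple_ext_field K w"
    by (rule simple_ext_fieldI[of "f * k + h * g" "g * k"]) (use fg in \<open>auto simp: add_frac_eq ac_simps\<close>)
  show "a * b \<in> simple_ext_field K w"
    by (rule simple_ext_fieldI[of "f * h" "g * k"]) (use fg in auto)
next
  fix a assume "a \<in> simple_ext_field K w"
  then obtain f g where fg: "f \<in> polys_over K" "g \<in> polys_over K" "poly g w \<noteq> 0" "a = poly f w / poly g w"
    by (auto simp: simple_ext_field_def)
  show "- a \<in> simple_ext_field K w"
    by (rule simple_ext_fieldI[of "- f" "g"]) (use fg in \<open>auto simp: field_simps\<close>)
  show "inverse a \<in> simple_ext_field K w"
  proof (cases "poly f w = 0")
    case True
    then show ?thesis by (intro simple_ext_fieldI[of 0 1]) (use fg in auto)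
  next
    case False
    then show ?thesis by (intro simple_ext_fieldI[of g f]) (use fg in auto)
  qed
qed

lemma (in subfld) simple_ext_field_base: "K \<subseteq> simple_ext_field K w" and simple_ext_field_self: "w \<in> simple_ext_field K w"
proof -
  show "K \<subseteq> simple_ext_field K w"
  proof
    fix c assume "c \<in> K" then show "c \<in> simple_ext_field K w"
      by (intro simple_ext_fieldI[of "[:c:]" 1]) auto
  qed
  show "w \<in> simple_ext_field K w" by (intro simple_ext_fieldI[of "[:0,1:]" 1]) auto
qed

lemma sep_closure_mono:
  assumes "subfld K" "subfld L" "K \<subseteq> L" "x \<in> sep_closure K"
  shows "x \<in> sep_closure L"
  using assms polys_over_mono[OF assms(3)] by (auto simp: sep_closure_iff)

lemma sep_minpoly:
  assumes "subfld K" "x \<in> sep_closure K"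
  obtains P where "minpoly K x P" "rsquarefree P"
proof -
  from assms obtain G where G: "G \<in> polys_over K" "poly G x = 0" "poly (pderiv G) x \<noteq> 0"
    by (auto simp: sep_closure_iff)
  then have "G \<noteq> 0" by auto
  with minpoly_exists G obtain P where P: "minpoly K x P" by metis
  with minpoly_rsquarefree[OF assms(1) G P] that show thesis by blast
qed

text \<open>If \<open>w = f(x)\<close> then all conjugates \<open>a\<close> of \<open>x\<close> satisfy \<open>f(a)\<^sup>q = w\<^sup>q\<close>, so \<open>f - w\<close> has more roots
  than its degree allows.\<close>

lemma sep_purely_inseparable:
  fixes K :: "'a::alg_closed_field set"
  assumes K: "subfld K" and x: "x \<in> sep_closure K" and w: "w \<in> adjoin K x" "w ^ q \<in> K"
    and inj: "\<And>a b :: 'a. a ^ q = b ^ q \<Longrightarrow> a = b"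
  shows "w \<in> K"
proof -
  interpret subfld K by fact
  obtain P where P: "minpoly K x P" "rsquarefree P" using sep_minpoly[OF K x] .
  obtain f where f: "f \<in> polys_over K" "poly f x = w" "degree f < degree P"
    using adjoin_reduce[OF P(1) w(1)] .
  have "f ^ q - [:w ^ q:] \<in> polys_over K" "poly (f ^ q - [:w ^ q:]) x = 0"
    using f w by (auto simp: poly_power)
  with minpoly_dvd[OF P(1)] obtain s where s: "f ^ q - [:w ^ q:] = P * s" by metis
  have "f - [:w:] = 0"
  proof (rule rsquarefree_dvd_of_roots[OF P(2)])
    fix a assume "poly P a = 0"
    then have "poly (f ^ q - [:w ^ q:]) a = 0" unfolding s by simp
    then show "poly (f - [:w:]) a = 0" using inj[of "poly f a" w] by (simp add: poly_power)
  next
    show "degree (f - [:w:]) < degree P" using f(3) by (intro le_less_trans[OF degree_diff_le_max]) auto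
  qed
  then have "coeff f 0 = w" by simp
  then show ?thesis using f(1) by blast
qed

lemma pderiv_power_char:
  assumes "of_nat q = (0 :: 'a::idom)"
  shows "pderiv ((p :: 'a poly) ^ q) = 0"
  by (cases q) (use assms in \<open>auto simp: pderiv_power simp del: of_nat_Suc power_Suc\<close>)

text \<open>The trick is that \<open>z\<close> is purely inseparable over \<open>K(z\<^sup>q)\<close>, so it lies in \<open>K(z\<^sup>q)\<close>; this yields an
  equation \<open>z g(z\<^sup>q) = f(z\<^sup>q)\<close> whose derivative \<open>g(X\<^sup>q)\<close> does not vanish at \<open>z\<close>.\<close>

lemma sep_adjoin_adjoin:
  fixes K :: "'a::alg_closed_field set"
  assumes K: "subfld K" and x: "x \<in> sep_closure K" and y: "y \<in> sep_closure K"
    and z: "z \<in> adjoin (adjoin K x) y"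
    and inj: "\<And>a b :: 'a. a ^ q = b ^ q \<Longrightarrow> a = b" and q: "of_nat q = (0 :: 'a)"
  shows "z \<in> sep_closure K"
proof -
  interpret subfld K by fact
  define L where "L = simple_ext_field K (z ^ q)"
  have L: "subfld L" "K \<subseteq> L" "z ^ q \<in> L"
    using simple_ext_field_subfld simple_ext_field_base simple_ext_field_self by (auto simp: L_def)
  have xL: "x \<in> sep_closure L" using sep_closure_mono[OF K L(1,2) x] .
  then obtain P where P: "minpoly L x P" using sep_minpoly[OF L(1)] by blast
  have M: "subfld (adjoin L x)" "L \<subseteq> adjoin L x"
    using subfld.adjoin_subfld[OF L(1) P] subfld.adjoin_base[OF L(1)] by auto
  have yM: "y \<in> sep_closure (adjoin L x)" using sep_closure_mono[OF K M(1) _ y] L M by blast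
  \<comment> \<open>x and y stay separable over the larger fields, and \<open>z ^ q\<close> lies in
    L. So z descends from L(x)(y) to L(x), then from L(x) to L.\<close>
  have "z \<in> adjoin (adjoin L x) y" using z adjoin_mono[OF adjoin_mono[OF L(2)]] by blast
  then have "z \<in> adjoin L x"
    using sep_purely_inseparable[OF M(1) yM _ _ inj] L M by blast
  then have "z \<in> L" using sep_purely_inseparable[OF L(1) xL _ L(3) inj] by blast
  then obtain f g where fg: "f \<in> polys_over K" "g \<in> polys_over K" "poly g (z ^ q) \<noteq> 0"
    "z = poly f (z ^ q) / poly g (z ^ q)" by (auto simp: L_def simple_ext_field_def)
  define Y where "Y = ([:0, 1:] :: 'a poly)"
  define G where "G = Y * (g \<circ>\<^sub>p (Y ^ q)) - f \<circ>\<^sub>p (Y ^ q)"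
  have Y: "Y \<in> polys_over K" by (auto simp: Y_def)
  have "G \<in> polys_over K" unfolding G_def
    by (intro polys_diff polys_mult polys_pcompose polys_power Y fg)
  moreover have "poly G z = 0" using fg by (simp add: G_def Y_def poly_pcompose poly_power field_simps)
  moreover have "pderiv G = g \<circ>\<^sub>p (Y ^ q)"
    by (simp add: G_def pderiv_diff pderiv_mult pderiv_pcompose pderiv_power_char[OF q])
       (simp add: Y_def pderiv_pCons)
  then have "poly (pderiv G) z \<noteq> 0" using fg by (simp add: Y_def poly_pcompose poly_power)
  ultimately show ?thesis using sep_closure_iff[OF K] by blast
qed

text \<open>Any two separable elements lie in the field K(x)(y), all of whose elements are
  separable, so closure under the operations is inherited. The hypotheses on q hold for the order of
  a finite subfield: q vanishes in the field and the q-th power is injective.\<close>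

lemma sep_closure_subfld:
  fixes K :: "'a::alg_closed_field set"
  assumes K: "subfld K" and inj: "\<And>a b :: 'a. a ^ q = b ^ q \<Longrightarrow> a = b" and q: "of_nat q = (0 :: 'a)"
  shows "subfld (sep_closure K)" and "K \<subseteq> sep_closure K"
proof -
  interpret subfld K by fact
  show *: "K \<subseteq> sep_closure K"
  proof
    fix c assume "c \<in> K"
    then show "c \<in> sep_closure K"
      unfolding sep_closure_iff[OF K] by (intro bexI[of _ "[:- c, 1:]"]) (auto simp: pderiv_pCons)
  qed
  have ex: "\<exists>M. subfld M \<and> x \<in> M \<and> y \<in> M \<and> M \<subseteq> sep_closure K"
    if xy: "x \<in> sep_closure K" "y \<in> sep_closure K" for x y
  proof -
    obtain P where P: "minpoly K x P" using sep_minpoly[OF K xy(1)] by blast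
    have L: "subfld (adjoin K x)" "K \<subseteq> adjoin K x" "x \<in> adjoin K x"
      using adjoin_subfld[OF P] adjoin_base adjoin_self by auto
    obtain Q where Q: "minpoly (adjoin K x) y Q"
      using sep_minpoly[OF L(1) sep_closure_mono[OF K L(1,2) xy(2)]] by blast
    show ?thesis
      using subfld.adjoin_subfld[OF L(1) Q] subfld.adjoin_base[OF L(1), of y] subfld.adjoin_self[OF L(1), of y]
        L sep_adjoin_adjoin[OF K xy _ inj q] by (intro exI[of _ "adjoin (adjoin K x) y"]) blast
  qed
  show "subfld (sep_closure K)"
  proof
    show "0 \<in> sep_closure K" "1 \<in> sep_closure K" using * by auto
    fix x y assume "x \<in> sep_closure K" "y \<in> sep_closure K"
    from ex[OF this] show "x + y \<in> sep_closure K" "x * y \<in> sep_closure K"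
      using subfld.add subfld.mult by blast+
  next
    fix x assume "x \<in> sep_closure K"
    from ex[OF this this] show "- x \<in> sep_closure K" "inverse x \<in> sep_closure K"
      using subfld.uminus subfld.inverse by blast+
  qed
qed

section \<open>Extending field homomorphisms\<close>

locale fhom = subfld K for K :: "'a::field set" +
  fixes \<sigma> :: "'a \<Rightarrow> 'a"
  assumes hom_one [simp]: "\<sigma> 1 = 1"
    and hom_add: "x \<in> K \<Longrightarrow> y \<in> K \<Longrightarrow> \<sigma> (x + y) = \<sigma> x + \<sigma> y"
    and hom_mult: "x \<in> K \<Longrightarrow> y \<in> K \<Longrightarrow> \<sigma> (x * y) = \<sigma> x * \<sigma> y"
begin

lemma hom_zero [simp]: "\<sigma> 0 = 0"
  using hom_add[of 0 0] by (metis add_cancel_right_left add_0 zero)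

lemma hom_uminus: "x \<in> K \<Longrightarrow> \<sigma> (- x) = - \<sigma> x"
  using hom_add[of x "- x"] by (simp add: eq_neg_iff_add_eq_0 add.commute)

lemma hom_diff: "x \<in> K \<Longrightarrow> y \<in> K \<Longrightarrow> \<sigma> (x - y) = \<sigma> x - \<sigma> y"
  using hom_add[of x "- y"] hom_uminus[of y] by simp

lemma hom_eq_0: "x \<in> K \<Longrightarrow> \<sigma> x = 0 \<longleftrightarrow> x = 0"
  using hom_mult[of x "inverse x"] by (metis hom_one hom_zero inverse mult_zero_left right_inverse zero_neq_one)

lemma hom_inverse: "x \<in> K \<Longrightarrow> \<sigma> (inverse x) = inverse (\<sigma> x)"
  using hom_mult[of x "inverse x"] by (cases "x = 0") (auto intro!: inverse_unique[symmetric])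

lemma hom_inj: "x \<in> K \<Longrightarrow> y \<in> K \<Longrightarrow> \<sigma> x = \<sigma> y \<Longrightarrow> x = y"
  using hom_diff[of x y] hom_eq_0[of "x - y"] by simp

lemma hom_power: "x \<in> K \<Longrightarrow> \<sigma> (x ^ n) = \<sigma> x ^ n"
  by (induction n) (auto simp: hom_mult)

lemma hom_sum: "(\<And>i. i \<in> I \<Longrightarrow> f i \<in> K) \<Longrightarrow> \<sigma> (sum f I) = (\<Sum>i\<in>I. \<sigma> (f i))"
proof (induction I rule: infinite_finite_induct)
  case (insert i I)
  then show ?case using sum[of I f] by (simp add: hom_add)
qed auto

lemma map_poly_add: "f \<in> polys_over K \<Longrightarrow> g \<in> polys_over K
    \<Longrightarrow> map_poly \<sigma> (f + g) = map_poly \<sigma> f + map_poly \<sigma> g"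
  by (intro poly_eqI) (simp add: coeff_map_poly hom_add polys_coeff)

lemma map_poly_mult: "f \<in> polys_over K \<Longrightarrow> g \<in> polys_over K
    \<Longrightarrow> map_poly \<sigma> (f * g) = map_poly \<sigma> f * map_poly \<sigma> g"
  by (intro poly_eqI) (simp add: coeff_map_poly coeff_mult hom_sum hom_mult polys_coeff)

lemma hom_poly: "f \<in> polys_over K \<Longrightarrow> x \<in> K \<Longrightarrow> \<sigma> (poly f x) = poly (map_poly \<sigma> f) (\<sigma> x)"
proof (induction f)
  case (pCons a f)
  then have "a \<in> K" "f \<in> polys_over K"
    by (auto simp: polys_over_def coeff_pCons split: nat.splits)
  then show ?case using pCons by (simp add: hom_add hom_mult map_poly_pCons poly_closed)
qed simp

text \<open>The map sends f(x) to the value at y of f with \<sigma> applied to its coefficients. It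
  is well defined because two polynomials with the same value at x differ by a multiple of
  P.\<close>

lemma extend:
  assumes P: "minpoly K x P" and y: "poly (map_poly \<sigma> P) y = 0"
  obtains \<tau> where "fhom (adjoin K x) \<tau>" "\<And>z. z \<in> K \<Longrightarrow> \<tau> z = \<sigma> z" "\<tau> x = y"
proof -
  have PK: "P \<in> polys_over K" using P by (simp add: minpoly_def)
  define \<tau> where "\<tau> z = poly (map_poly \<sigma> (SOME f. f \<in> polys_over K \<and> poly f x = z)) y" for z
  have \<tau>: "\<tau> (poly f x) = poly (map_poly \<sigma> f) y" if f: "f \<in> polys_over K" for f
  proof -
    define g where "g = (SOME g. g \<in> polys_over K \<and> poly g x = poly f x)"
    have g: "g \<in> polys_over K \<and> poly g x = poly f x" unfolding g_def by (rule someI[of _ f]) (use f in auto)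
    then have "g - f \<in> polys_over K" "poly (g - f) x = 0" using f by auto
    from minpoly_dvd[OF P this] obtain s where s: "s \<in> polys_over K" "g - f = P * s" .
    then have "g = f + P * s" by (simp add: algebra_simps)
    then have "poly (map_poly \<sigma> g) y = poly (map_poly \<sigma> f) y"
      using f s PK y by (simp add: map_poly_add map_poly_mult)
    then show ?thesis by (simp add: \<tau>_def g_def)
  qed
  have "fhom (adjoin K x) \<tau>"
  proof (intro fhom.intro fhom_axioms.intro adjoin_subfld[OF P])
    show "\<tau> 1 = 1" using \<tau>[of 1] by simp
    fix a b assume "a \<in> adjoin K x" "b \<in> adjoin K x"
    then obtain f g where fg: "f \<in> polys_over K" "g \<in> polys_over K" "a = poly f x" "b = poly g x"
      by (auto simp: adjoin_def)
    show "\<tau> (a + b) = \<tau> a + \<tau> b" using fg \<tau>[of "f + g"] by (simp add: \<tau> map_poly_add)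
    show "\<tau> (a * b) = \<tau> a * \<tau> b" using fg \<tau>[of "f * g"] by (simp add: \<tau> map_poly_mult)
  qed
  moreover have "\<tau> z = \<sigma> z" if "z \<in> K" for z using \<tau>[of "[:z:]"] that by (auto simp: map_poly_pCons)
  moreover have "\<tau> x = y" using \<tau>[of "[:0, 1:]"] by (auto simp: map_poly_pCons)
  ultimately show thesis using that by blast
qed

end

text \<open>Partial homomorphisms are represented by their graphs: extension is then inclusion, and
  Zorn's lemma applies with unions of chains. Closure under negation and inverses makes the domain a
  field.\<close>

definition hom_graph :: "('a::field \<times> 'a) set \<Rightarrow> bool" where
  "hom_graph \<Gamma> \<longleftrightarrow> single_valued \<Gamma> \<and> (0, 0) \<in> \<Gamma> \<and> (1, 1) \<in> \<Gamma> \<and>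
     (\<forall>(x, y)\<in>\<Gamma>. (- x, - y) \<in> \<Gamma> \<and> (inverse x, inverse y) \<in> \<Gamma>) \<and>
     (\<forall>(x, y)\<in>\<Gamma>. \<forall>(x', y')\<in>\<Gamma>. (x + x', y + y') \<in> \<Gamma> \<and> (x * x', y * y') \<in> \<Gamma>)"

lemma hom_graph_of_fhom:
  assumes "fhom K \<sigma>" shows "hom_graph ((\<lambda>x. (x, \<sigma> x)) ` K)"
proof -
  interpret fhom K \<sigma> by fact
  show ?thesis
    by (auto simp: hom_graph_def single_valued_def hom_add hom_mult hom_uminus hom_inverse image_iff Bex_def)
qed

lemma fhom_of_hom_graph:
  assumes \<Gamma>: "hom_graph \<Gamma>"
  obtains \<sigma> where "fhom (Domain \<Gamma>) \<sigma>" "\<Gamma> = (\<lambda>x. (x, \<sigma> x)) ` Domain \<Gamma>"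
proof -
  define \<sigma> where "\<sigma> x = (THE y. (x, y) \<in> \<Gamma>)" for x
  have \<sigma>: "\<sigma> x = y" if "(x, y) \<in> \<Gamma>" for x y
    unfolding \<sigma>_def using that \<Gamma> by (auto simp: hom_graph_def dest: single_valuedD)
  have S: "subfld (Domain \<Gamma>)"
    by unfold_locales (use \<Gamma> in \<open>fastforce simp: hom_graph_def Domain_iff split_beta\<close>)+
  have "fhom (Domain \<Gamma>) \<sigma>"
  proof (intro fhom.intro fhom_axioms.intro S)
    show "\<sigma> 1 = 1" by (rule \<sigma>) (use \<Gamma> in \<open>simp add: hom_graph_def\<close>)
    fix x y assume "x \<in> Domain \<Gamma>" "y \<in> Domain \<Gamma>"
    then obtain x' y' where xy: "(x, x') \<in> \<Gamma>" "(y, y') \<in> \<Gamma>" by auto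
    then have "(x + y, x' + y') \<in> \<Gamma>" "(x * y, x' * y') \<in> \<Gamma>" using \<Gamma> unfolding hom_graph_def by blast+
    then show "\<sigma> (x + y) = \<sigma> x + \<sigma> y" "\<sigma> (x * y) = \<sigma> x * \<sigma> y" using \<sigma> xy by auto
  qed
  moreover have "\<Gamma> = (\<lambda>x. (x, \<sigma> x)) ` Domain \<Gamma>"
  proof (intro equalityI subsetI)
    fix p assume "p \<in> \<Gamma>"
    then show "p \<in> (\<lambda>x. (x, \<sigma> x)) ` Domain \<Gamma>" using \<sigma>[of "fst p" "snd p"] by (cases p) auto
  next
    fix p assume "p \<in> (\<lambda>x. (x, \<sigma> x)) ` Domain \<Gamma>"
    then show "p \<in> \<Gamma>" using \<sigma> by auto
  qed
  ultimately show thesis using that by blast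
qed

lemma chain_two:
  assumes "subset.chain A C" "Y1 \<in> C" "Y2 \<in> C" obtains Z where "Z \<in> C" "Y1 \<subseteq> Z" "Y2 \<subseteq> Z"
proof -
  have "Y1 \<subseteq> Y2 \<or> Y2 \<subseteq> Y1" using assms by (auto simp: subset_chain_def)
  then show thesis using assms that by blast
qed

text \<open>Members of a chain are comparable, so any two pairs in the union already lie in one
  common graph.\<close>

lemma hom_graph_Union:
  assumes C: "subset.chain A C" "C \<noteq> {}" and A: "\<And>Y. Y \<in> C \<Longrightarrow> hom_graph Y"
  shows "hom_graph (\<Union>C)"
proof -
  have two: "\<exists>Z\<in>C. p \<in> Z \<and> p' \<in> Z \<and> hom_graph Z" if p: "p \<in> \<Union>C" "p' \<in> \<Union>C" for p p'
  proof -
    from p obtain Y1 Y2 where Y: "Y1 \<in> C" "p \<in> Y1" "Y2 \<in> C" "p' \<in> Y2" by blast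
    obtain Z where "Z \<in> C" "Y1 \<subseteq> Z" "Y2 \<subseteq> Z" using chain_two[OF C(1) Y(1,3)] .
    then show ?thesis using Y A by blast
  qed
  show ?thesis
    unfolding hom_graph_def
  proof (intro conjI)
    show "single_valued (\<Union>C)"
    proof (rule single_valuedI)
      fix x y z assume "(x, y) \<in> \<Union>C" "(x, z) \<in> \<Union>C"
      from two[OF this] show "y = z" by (auto simp: hom_graph_def dest: single_valuedD)
    qed
    show "(0, 0) \<in> \<Union>C" "(1, 1) \<in> \<Union>C" using C(2) A by (auto simp: hom_graph_def)
    show "\<forall>(x, y)\<in>\<Union>C. (- x, - y) \<in> \<Union>C \<and> (inverse x, inverse y) \<in> \<Union>C"
    proof (intro ballI, clarify)
      fix x y Y assume "(x, y) \<in> Y" "Y \<in> C"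
      then show "(- x, - y) \<in> \<Union>C \<and> (inverse x, inverse y) \<in> \<Union>C"
        using A unfolding hom_graph_def by blast
    qed
    have "(x + x', y + y') \<in> \<Union>C \<and> (x * x', y * y') \<in> \<Union>C" if xy: "(x, y) \<in> \<Union>C" "(x', y') \<in> \<Union>C" for x x' y y'
    proof -
      from two[OF xy] obtain Z where Z: "Z \<in> C" "(x, y) \<in> Z" "(x', y') \<in> Z" "hom_graph Z" by blast
      then have "(x + x', y + y') \<in> Z \<and> (x * x', y * y') \<in> Z" unfolding hom_graph_def by blast
      then show ?thesis using Z by blast
    qed
    then show "\<forall>(x, y)\<in>\<Union>C. \<forall>(x', y')\<in>\<Union>C. (x + x', y + y') \<in> \<Union>C \<and> (x * x', y * y') \<in> \<Union>C"
      by blast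
  qed
qed

text \<open>The domain of a maximal extension is closed under adjoining roots: for z algebraic over
  it, the minimal polynomial with \<tau> applied to its coefficients has a root in the ambient
  field, and \<open>extend\<close> would yield a larger graph.\<close>

lemma fhom_extend_algebraic:
  fixes K :: "'a::alg_closed_field set"
  assumes "fhom K \<sigma>"
  obtains L \<tau> where "fhom L \<tau>" "K \<subseteq> L" "\<And>x. x \<in> K \<Longrightarrow> \<tau> x = \<sigma> x"
    "\<And>z f. f \<in> polys_over L \<Longrightarrow> f \<noteq> 0 \<Longrightarrow> poly f z = 0 \<Longrightarrow> z \<in> L"
proof -
  define \<Gamma>0 where "\<Gamma>0 = (\<lambda>x. (x, \<sigma> x)) ` K"
  define A where "A = {\<Gamma>. hom_graph \<Gamma> \<and> \<Gamma>0 \<subseteq> \<Gamma>}"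
  have "\<Gamma>0 \<in> A" using hom_graph_of_fhom[OF assms] by (simp add: A_def \<Gamma>0_def)
  moreover have "\<Union>C \<in> A" if "C \<noteq> {}" "subset.chain A C" for C
  proof -
    have "C \<subseteq> A" using that by (simp add: subset_chain_def)
    then show ?thesis using hom_graph_Union[OF that(2,1)] that(1) unfolding A_def by blast
  qed
  ultimately obtain \<Gamma> where \<Gamma>: "\<Gamma> \<in> A" and max: "\<And>Y. Y \<in> A \<Longrightarrow> \<Gamma> \<subseteq> Y \<Longrightarrow> Y = \<Gamma>"
    using subset_Zorn_nonempty[of A] by blast
  obtain \<tau> where \<tau>: "fhom (Domain \<Gamma>) \<tau>" "\<Gamma> = (\<lambda>x. (x, \<tau> x)) ` Domain \<Gamma>"
    using fhom_of_hom_graph \<Gamma> unfolding A_def by blast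
  interpret T: fhom "Domain \<Gamma>" \<tau> by fact
  have sub: "\<Gamma>0 \<subseteq> \<Gamma>" using \<Gamma> by (simp add: A_def)
  have "K \<subseteq> Domain \<Gamma>" using sub unfolding \<Gamma>0_def by auto
  moreover have "\<tau> x = \<sigma> x" if "x \<in> K" for x
  proof -
    have "(x, \<sigma> x) \<in> \<Gamma>" using that sub by (auto simp: \<Gamma>0_def)
    then have "(x, \<sigma> x) \<in> (\<lambda>x. (x, \<tau> x)) ` Domain \<Gamma>" using \<tau>(2) by simp
    then show ?thesis by auto
  qed
  moreover have "z \<in> Domain \<Gamma>" if f: "f \<in> polys_over (Domain \<Gamma>)" "f \<noteq> 0" "poly f z = 0" for z f
  proof -
    obtain P where P: "minpoly (Domain \<Gamma>) z P" using minpoly_exists[OF f] .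
    \<comment> \<open>\<tau> does not kill the leading coefficient, so the transformed polynomial
      still has positive degree and therefore a root.\<close>
    have "coeff (map_poly \<tau> P) (degree P) \<noteq> 0"
      using P T.hom_eq_0[of "lead_coeff P"] by (simp add: coeff_map_poly minpoly_def T.polys_coeff)
    then have "degree P \<le> degree (map_poly \<tau> P)" by (rule le_degree)
    with T.minpoly_degree_pos[OF P] obtain y where "poly (map_poly \<tau> P) y = 0"
      using alg_closed_imp_poly_has_root[of "map_poly \<tau> P"] by auto
    from T.extend[OF P this] obtain \<tau>' where \<tau>': "fhom (adjoin (Domain \<Gamma>) z) \<tau>'"
      "\<And>x. x \<in> Domain \<Gamma> \<Longrightarrow> \<tau>' x = \<tau> x" by metis
    let ?Y = "(\<lambda>x. (x, \<tau>' x)) ` adjoin (Domain \<Gamma>) z"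
    have sub': "\<Gamma> \<subseteq> ?Y"
    proof
      fix p assume "p \<in> \<Gamma>"
      then obtain x where x: "x \<in> Domain \<Gamma>" "p = (x, \<tau> x)" using \<tau>(2) by blast
      then show "p \<in> ?Y" using \<tau>'(2)[of x] T.adjoin_base[of z] by (intro image_eqI[of _ _ x]) auto
    qed
    then have "?Y = \<Gamma>" using hom_graph_of_fhom[OF \<tau>'(1)] sub by (intro max) (auto simp: A_def)
    then have "(z, \<tau>' z) \<in> \<Gamma>" using T.adjoin_self[of z] by blast
    then show ?thesis by blast
  qed
  ultimately show thesis by (rule that[OF \<tau>(1)])
qed

section \<open>The Galois group moves elements outside the base field\<close>

lemma gal_group_carrier:
  "g \<in> carrier (gal_group E) \<longleftrightarrow> g \<in> extensional (sep_closure E) \<and>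
     bij_betw g (sep_closure E) (sep_closure E) \<and> g 1 = 1 \<and>
     (\<forall>x\<in>sep_closure E. \<forall>y\<in>sep_closure E. g (x + y) = g x + g y \<and> g (x * y) = g x * g y) \<and>
     (\<forall>x\<in>E. g x = x)"
  by (auto simp: gal_group_def Bij_def Ring.ring_hom_def ring_of_type_algebra_def dest: bij_betwE)

text \<open>Sending x to y defines a homomorphism on E(x). Its extension \<tau> to a domain
  containing all roots of polynomials over it is defined on all of E^sep, and the restriction of
  \<tau> is the automorphism.\<close>

lemma gal_group_conj:
  fixes E :: "'a::alg_closed_field set"
  assumes E: "subfld E" and S: "subfld (sep_closure E)" "E \<subseteq> sep_closure E"
    and P: "minpoly E x P" and y: "poly P y = 0"
    and x: "x \<in> sep_closure E"
  obtains g where "g \<in> carrier (gal_group E)" "g x = y"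
proof -
  interpret E: subfld E by fact
  have idE: "fhom E (\<lambda>x. x)" by (intro fhom.intro fhom_axioms.intro E) auto
  have "map_poly (\<lambda>x. x) P = P" by (intro poly_eqI) (simp add: coeff_map_poly)
  then obtain \<sigma> where \<sigma>: "fhom (adjoin E x) \<sigma>" "\<And>z. z \<in> E \<Longrightarrow> \<sigma> z = z" "\<sigma> x = y"
    using fhom.extend[OF idE P] y by metis
  obtain L \<tau> where \<tau>: "fhom L \<tau>" "adjoin E x \<subseteq> L" "\<And>z. z \<in> adjoin E x \<Longrightarrow> \<tau> z = \<sigma> z"
    "\<And>z f. f \<in> polys_over L \<Longrightarrow> f \<noteq> 0 \<Longrightarrow> poly f z = 0 \<Longrightarrow> z \<in> L"
    using fhom_extend_algebraic[OF \<sigma>(1)] by metis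
  interpret T: fhom L \<tau> by fact
  have EL: "E \<subseteq> L" using E.adjoin_base \<tau>(2) by blast
  have \<tau>E: "\<tau> z = z" if "z \<in> E" for z using \<tau>(3)[of z] \<sigma>(2)[of z] E.adjoin_base[of x] that by auto
  have SL: "z \<in> L" if "z \<in> sep_closure E" for z
  proof -
    from that obtain G where "G \<in> polys_over E" "rsquarefree G" "poly G z = 0"
      unfolding sep_closure_def by blast
    then have "G \<in> polys_over L" "G \<noteq> 0" "poly G z = 0"
      using polys_over_mono[OF EL] unfolding rsquarefree_def by blast+
    then show ?thesis by (rule \<tau>(4))
  qed
  have \<tau>root: "poly G (\<tau> z) = 0" if "G \<in> polys_over E" "poly G z = 0" "z \<in> L" for G z
  proof -
    have "map_poly \<tau> G = G"
    proof (rule poly_eqI)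
      fix i show "coeff (map_poly \<tau> G) i = coeff G i"
        using \<tau>E[OF E.polys_coeff[OF that(1)], of i] by (simp only: coeff_map_poly[of \<tau>, OF T.hom_zero])
    qed
    moreover have "G \<in> polys_over L" using that(1) polys_over_mono[OF EL] by (rule subsetD[rotated])
    ultimately show ?thesis using T.hom_poly[of G z] that(2,3) by simp
  qed
  have \<tau>S: "\<tau> z \<in> sep_closure E" if z: "z \<in> sep_closure E" for z
    using z \<tau>root SL[OF z] unfolding sep_closure_def by auto
  \<comment> \<open>\<tau> is injective and maps the finite set of roots of a polynomial over E into
    itself, so it permutes these roots.\<close>
  have surj: "\<exists>z\<in>sep_closure E. \<tau> z = w" if w: "w \<in> sep_closure E" for w
  proof -
    obtain G where G: "G \<in> polys_over E" "rsquarefree G" "poly G w = 0"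
      using w unfolding sep_closure_def by blast
    define Rt where "Rt = {z. poly G z = 0}"
    have RS: "Rt \<subseteq> sep_closure E" using G by (auto simp: Rt_def sep_closure_def)
    have "finite Rt" using G by (auto simp: Rt_def rsquarefree_def poly_roots_finite)
    moreover have "\<tau> ` Rt \<subseteq> Rt" using \<tau>root[OF G(1)] RS SL by (auto simp: Rt_def)
    moreover have "inj_on \<tau> Rt" using T.hom_inj RS SL by (meson inj_onI subsetD)
    ultimately have "\<tau> ` Rt = Rt" by (simp add: endo_inj_surj)
    moreover have "w \<in> Rt" using G by (simp add: Rt_def)
    ultimately obtain z where "z \<in> Rt" "w = \<tau> z" by (metis imageE)
    then show ?thesis using RS by blast
  qed
  \<comment> \<open>Elements of \<open>Bij\<close> are extensional, so \<tau> has to be cut off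
    outside E^sep.\<close>
  define g where "g = restrict \<tau> (sep_closure E)"
  have "bij_betw g (sep_closure E) (sep_closure E)"
    unfolding bij_betw_def
  proof
    show "inj_on g (sep_closure E)" using T.hom_inj SL by (auto simp: g_def inj_on_def)
    show "g ` sep_closure E = sep_closure E" 
    proof (intro equalityI subsetI)
      fix w assume "w \<in> sep_closure E"
      from surj[OF this] show "w \<in> g ` sep_closure E" by (auto simp: g_def)
    qed (use \<tau>S in \<open>auto simp: g_def\<close>)
  qed
  then have "g \<in> carrier (gal_group E)"
    unfolding gal_group_carrier
    using S SL \<tau>E by (auto simp: g_def T.hom_add T.hom_mult subfld.add subfld.mult subfld.one)
  moreover have "g x = y" using x \<sigma>(3) \<tau>(3)[OF E.adjoin_self] by (simp add: g_def)
  ultimately show thesis using that by blast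
qed

text \<open>By \<open>gal_group_conj\<close> every root of the minimal polynomial P is an image of
  x, hence equal to x. As P has no repeated roots, its degree is 1 and x is a quotient of its
  coefficients up to sign.\<close>

lemma gal_group_fixed:
  fixes E :: "'a::alg_closed_field set"
  assumes E: "subfld E" and S: "subfld (sep_closure E)" "E \<subseteq> sep_closure E"
    and x: "x \<in> sep_closure E" "\<And>g. g \<in> carrier (gal_group E) \<Longrightarrow> g x = x"
  shows "x \<in> E"
proof -
  interpret subfld E by fact
  obtain P where P: "minpoly E x P" "rsquarefree P" using sep_minpoly[OF E x(1)] .
  have root: "a = x" if "poly P a = 0" for a
    using gal_group_conj[OF E S P(1) that x(1)] x(2) by metis
  have "degree P \<le> 1"
  proof (rule ccontr)
    assume "\<not> degree P \<le> 1"
    then have "[:-x, 1:] = 0"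
      by (intro rsquarefree_dvd_of_roots[OF P(2)]) (use root in auto)
    then show False by simp
  qed
  then have deg: "degree P = 1" using minpoly_degree_pos[OF P(1)] by simp
  define a b where "a = coeff P 0" and "b = coeff P 1"
  have ab: "P = [:a, b:]"
    by (intro poly_eqI) (use deg in \<open>auto simp: a_def b_def coeff_pCons coeff_eq_0 split: nat.split\<close>)
  then have "b \<noteq> 0" using deg by auto
  have "coeff P 0 \<in> E" "coeff P 1 \<in> E" using P by (auto simp: minpoly_def polys_over_def)
  then have "a \<in> E" "b \<in> E" by (simp_all add: ab)
  moreover have "a + b * x = 0" using P(1) by (simp add: minpoly_def ab mult.commute)
  then have "b * x = - a" by (simp add: eq_neg_iff_add_eq_0 add.commute)
  then have "x = - a / b" using \<open>b \<noteq> 0\<close> by (metis nonzero_mult_div_cancel_left)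
  ultimately show ?thesis by auto
qed

section \<open>The Frobenius of a finite subfield\<close>

locale finite_subfld = subfld F for F :: "'a::field set" +
  fixes q :: nat
  assumes fin: "finite F" and card_F: "card F = q"
begin

lemma q_gt_1: "q > 1"
proof -
  have "card {0, 1 :: 'a} \<le> card F" by (rule card_mono) (use fin in auto)
  then show ?thesis using card_F by simp
qed

lemma q_pos [simp]: "q > 0"
  using q_gt_1 by simp

text \<open>Multiplication by a nonzero c permutes the nonzero elements of F, so their product is
  unchanged by the factor c^(q-1), which is therefore 1.\<close>

lemma pow_q: assumes c: "c \<in> F" shows "c ^ q = c"
proof (cases "c = 0")
  case False
  have bij: "bij_betw (\<lambda>x. c * x) (F - {0}) (F - {0})"
    by (rule bij_betwI[of _ _ _ "\<lambda>x. inverse c * x"]) (use c False in auto)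
  have "(\<Prod>x\<in>F - {0}. x) = (\<Prod>x\<in>F - {0}. c * x)"
    using prod.reindex_bij_betw[OF bij, of "\<lambda>x. x"] by simp
  also have "\<dots> = c ^ card (F - {0}) * (\<Prod>x\<in>F - {0}. x)" by (simp add: prod.distrib)
  finally have "c ^ card (F - {0}) = 1" using fin by (simp add: prod_zero_iff)
  moreover have "card (F - {0}) = q - 1" using fin card_F by (simp add: card_Diff_singleton)
  ultimately have "c ^ Suc (q - 1) = c" unfolding power_Suc by (metis mult.right_neutral)
  moreover have "Suc (q - 1) = q" using q_pos by simp
  ultimately show ?thesis by metis
qed (use q_pos in auto)

lemma pow_q_pow: "c \<in> F \<Longrightarrow> c ^ q ^ i = c"
  by (induction i) (auto simp: power_mult pow_q mult.commute)

text \<open>Translation by 1 permutes F, so the sum of all elements equals itself plus q times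
  1.\<close>

lemma of_nat_q: "of_nat q = (0 :: 'a)"
proof -
  have bij: "bij_betw (\<lambda>x. x + 1) F F"
    by (rule bij_betwI[of _ _ _ "\<lambda>x. x - 1"]) auto
  have "(\<Sum>x\<in>F. x) = (\<Sum>x\<in>F. x + 1)" using sum.reindex_bij_betw[OF bij, of "\<lambda>x. x"] by simp
  also have "\<dots> = (\<Sum>x\<in>F. x) + of_nat q" by (simp add: sum.distrib card_F)
  finally show ?thesis by simp
qed

text \<open>As a polynomial in \<open>x\<close>, \<open>(x + y)\<^sup>q - x\<^sup>q - y\<^sup>q\<close> has degree less than \<open>q = |F|\<close>, so it vanishes
  identically as soon as it vanishes on \<open>F\<close>.\<close>

lemma frob_add_aux:
  assumes "\<And>x. x \<in> F \<Longrightarrow> (x + y) ^ q = x ^ q + y ^ q"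
  shows "(x + y) ^ q = x ^ q + y ^ q"
proof -
  define p where "p = [:y, 1:] ^ q - monom 1 q - [:y ^ q:]"
  have poly_p: "poly p x = (x + y) ^ q - x ^ q - y ^ q" for x
    by (simp add: p_def poly_power poly_monom add.commute)
  have "p = 0 \<or> degree p < q"
  proof (rule eq_zero_or_degree_less)
    show "degree p \<le> q" unfolding p_def
      by (intro degree_diff_le) (auto simp: degree_linear_power degree_monom_le)
    show "coeff p q = 0" using q_pos
      by (simp add: p_def coeff_linear_power coeff_pCons split: nat.split)
  qed
  moreover have "q \<le> degree p" if "p \<noteq> 0"
  proof -
    have "F \<subseteq> {x. poly p x = 0}" using assms by (auto simp: poly_p)
    then have "q \<le> card {x. poly p x = 0}"
      using card_mono[OF poly_roots_finite[OF that]] card_F by blast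
    then show ?thesis using card_poly_roots_bound[OF that] by linarith
  qed
  ultimately have "p = 0" by force
  then show ?thesis using poly_p[of x] by (simp add: algebra_simps)
qed

text \<open>\<open>frob_add_aux\<close> is applied twice. On F the q-th power is the identity, which
  gives the formula for one summand in F and the other arbitrary; exchanging the summands then frees
  the second one.\<close>

lemma frob_add: "(x + y) ^ q = x ^ q + (y :: 'a) ^ q"
proof -
  have "(x + y) ^ q = x ^ q + y ^ q" if "y \<in> F" for x y
    using that by (rule_tac frob_add_aux) (simp add: pow_q)
  then show ?thesis by (rule_tac frob_add_aux) (metis add.commute)
qed

lemma frob_pow_add: "(x + y) ^ q ^ i = x ^ q ^ i + (y :: 'a) ^ q ^ i"
  by (induction i arbitrary: x y) (auto simp: power_mult frob_add)

lemma frob_inj: "a ^ q = b ^ q \<Longrightarrow> a = (b :: 'a)"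
  using frob_add[of "a - b" b] q_pos by simp

lemma frob_fhom: "fhom (UNIV :: 'a set) (\<lambda>x. x ^ q ^ i)"
  by unfold_locales (auto simp: frob_pow_add power_mult_distrib)

lemma frob_sum: "(\<Sum>j\<in>I. f j) ^ q ^ i = (\<Sum>j\<in>I. (f j :: 'a) ^ q ^ i)"
  using fhom.hom_sum[OF frob_fhom, of I f i] by simp

end

section \<open>Matrices over subfields\<close>

lemma mats_over_iff:
  "A \<in> mats_over m n S \<longleftrightarrow> A \<in> carrier_mat m n \<and> (\<forall>i<m. \<forall>j<n. A $$ (i, j) \<in> S)"
  unfolding mats_over_def by (auto dest!: elements_matD)

lemma mats_over_UNIV [simp]: "mats_over m n UNIV = carrier_mat m n"
  by (auto simp: mats_over_def)

lemma mats_over_carrier: "A \<in> mats_over m n S \<Longrightarrow> A \<in> carrier_mat m n"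
  by (simp add: mats_over_def)

context subfld
begin

lemma mats_over_mult:
  "A \<in> mats_over m n K \<Longrightarrow> B \<in> mats_over n l K \<Longrightarrow> A * B \<in> mats_over m l K"
  by (auto simp: mats_over_iff scalar_prod_def intro!: sum)

lemma mats_over_one: "1\<^sub>m n \<in> mats_over n n K"
  by (auto simp: mats_over_iff)

lemma mats_over_transpose: "A \<in> mats_over m n K \<Longrightarrow> transpose_mat A \<in> mats_over n m K"
  by (auto simp: mats_over_iff)

lemma det_closed: assumes "A \<in> mats_over n n K" shows "det A \<in> K"
proof -
  have A: "A \<in> carrier_mat n n" using assms by (simp add: mats_over_iff)
  have "signof p \<in> K" for p :: "nat \<Rightarrow> nat" by (auto simp: sign_def)
  then show ?thesis unfolding det_def'[OF A]
    by (intro sum mult prod) (use assms in \<open>auto simp: mats_over_iff\<close>)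
qed

text \<open>The inverse is the adjugate divided by the determinant; both are polynomial expressions
  in the entries, so everything stays in K.\<close>

lemma inverse_over:
  assumes A: "A \<in> mats_over n n K" and d: "det A \<noteq> 0"
  shows "\<exists>B \<in> mats_over n n K. A * B = 1\<^sub>m n \<and> B * A = 1\<^sub>m n"
proof -
  have Ac: "A \<in> carrier_mat n n" using A by (simp add: mats_over_iff)
  have "mat_delete A i j \<in> mats_over (n - 1) (n - 1) K" if "i < n" "j < n" for i j
    using A that by (auto simp: mats_over_iff mat_delete_def)
  then have "cofactor A i j \<in> K" if "i < n" "j < n" for i j
    using det_closed that unfolding cofactor_def by (auto intro!: mult power)
  then have adj: "adj_mat A \<in> mats_over n n K" using Ac by (auto simp: mats_over_iff adj_mat_def)
  define B where "B = inverse (det A) \<cdot>\<^sub>m adj_mat A"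
  have "B \<in> mats_over n n K" using adj det_closed[OF A] by (auto simp: mats_over_iff B_def)
  moreover have "A * B = 1\<^sub>m n" "B * A = 1\<^sub>m n"
    using adj_mat[OF Ac] d unfolding B_def
    by (auto simp: mult_smult_distrib[OF Ac] mult_smult_assoc_mat[OF _ Ac] intro: eq_matI)
  ultimately show ?thesis by blast
qed

end

lemma det_nonzero_of_inverse:
  assumes "A \<in> carrier_mat n n" "B \<in> carrier_mat n n" "A * B = 1\<^sub>m n"
  shows "det (A :: 'a::field mat) \<noteq> 0"
  using det_mult[OF assms(1,2)] assms(3) by auto

lemma GL_carrier_iff:
  "A \<in> carrier (GL n S) \<longleftrightarrow> A \<in> mats_over n n S \<and> (\<exists>B \<in> mats_over n n S. A * B = 1\<^sub>m n \<and> B * A = 1\<^sub>m n)"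
  by (auto simp: GL_def units_of_carrier Units_def ring_mat_simps)

lemma (in subfld) GL_iff_det: "A \<in> carrier (GL n K) \<longleftrightarrow> A \<in> mats_over n n K \<and> det A \<noteq> 0"
  unfolding GL_carrier_iff using inverse_over[of A n] det_nonzero_of_inverse mats_over_carrier by metis

lemma subfld_UNIV: "subfld (UNIV :: 'a::field set)"
  by unfold_locales auto

lemma mat_inv_unique:
  fixes A :: "'a::field mat"
  assumes A: "A \<in> carrier_mat n n" and B: "B \<in> carrier_mat n n" "A * B = 1\<^sub>m n" "B * A = 1\<^sub>m n"
  shows "mat_inv n A = B"
proof -
  have eq: "C = B" if "C \<in> carrier_mat n n" "C * A = 1\<^sub>m n" for C
  proof -
    have "C = C * (A * B)" using that B by simp
    also have "\<dots> = (C * A) * B" using that A B by (intro assoc_mult_mat[symmetric])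
    also have "\<dots> = B" using that B by simp
    finally show ?thesis .
  qed
  have G: "carrier (GL n (UNIV :: 'a set)) = {A \<in> carrier_mat n n. \<exists>B\<in>carrier_mat n n. A * B = 1\<^sub>m n \<and> B * A = 1\<^sub>m n}"
    by (auto simp: GL_carrier_iff)
  have ops: "monoid.mult (GL n (UNIV :: 'a set)) = (*)" "one (GL n (UNIV :: 'a set)) = 1\<^sub>m n"
    by (simp_all add: GL_def units_of_def ring_mat_simps)
  show ?thesis
    unfolding mat_inv_def m_inv_def G ops
  proof (rule the_equality)
    show "B \<in> {A \<in> carrier_mat n n. \<exists>B\<in>carrier_mat n n. A * B = 1\<^sub>m n \<and> B * A = 1\<^sub>m n} \<and>
        A * B = 1\<^sub>m n \<and> B * A = 1\<^sub>m n"
      using A B by blast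
  qed (use eq in blast)
qed

lemma mat_inv_props:
  fixes A :: "'a::field mat"
  assumes A: "A \<in> carrier_mat n n" and d: "det A \<noteq> 0"
  shows "mat_inv n A \<in> carrier_mat n n" "A * mat_inv n A = 1\<^sub>m n" "mat_inv n A * A = 1\<^sub>m n"
proof -
  obtain B where "B \<in> carrier_mat n n" "A * B = 1\<^sub>m n" "B * A = 1\<^sub>m n"
    using subfld.inverse_over[OF subfld_UNIV, of A n] A d by auto
  with mat_inv_unique[OF A this]
  show "mat_inv n A \<in> carrier_mat n n" "A * mat_inv n A = 1\<^sub>m n" "mat_inv n A * A = 1\<^sub>m n" by auto
qed

lemma (in subfld) mat_inv_over:
  assumes A: "A \<in> mats_over n n K" and d: "det A \<noteq> 0"
  shows "mat_inv n A \<in> mats_over n n K"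
  using inverse_over[OF A d] mat_inv_unique mats_over_carrier[OF A] mats_over_carrier by metis

context fhom
begin

lemma map_mat_mult:
  assumes "A \<in> mats_over m n K" "B \<in> mats_over n l K"
  shows "map_mat \<sigma> (A * B) = map_mat \<sigma> A * map_mat \<sigma> B"
proof (rule eq_matI)
  have AB: "A \<in> carrier_mat m n" "B \<in> carrier_mat n l" using assms by (auto simp: mats_over_iff)
  fix i j assume "i < dim_row (map_mat \<sigma> A * map_mat \<sigma> B)" "j < dim_col (map_mat \<sigma> A * map_mat \<sigma> B)"
  then have ij: "i < m" "j < l" using AB by auto
  have "\<sigma> (\<Sum>k<n. A $$ (i, k) * B $$ (k, j)) = (\<Sum>k<n. \<sigma> (A $$ (i, k)) * \<sigma> (B $$ (k, j)))"
    using assms ij by (subst hom_sum) (auto simp: mats_over_iff hom_mult)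
  then show "map_mat \<sigma> (A * B) $$ (i, j) = (map_mat \<sigma> A * map_mat \<sigma> B) $$ (i, j)"
    using AB ij by (simp add: scalar_prod_def lessThan_atLeast0)
qed (use assms in \<open>auto simp: mats_over_iff\<close>)

lemma map_mat_one: "map_mat \<sigma> (1\<^sub>m n) = 1\<^sub>m n"
  by (intro eq_matI) auto

lemma map_mat_det_nonzero:
  assumes "A \<in> mats_over n n K" "det A \<noteq> 0"
  shows "det (map_mat \<sigma> A) \<noteq> 0"
proof -
  obtain B where B: "B \<in> mats_over n n K" "A * B = 1\<^sub>m n" using inverse_over[OF assms] by blast
  have "map_mat \<sigma> A * map_mat \<sigma> B = 1\<^sub>m n"
    using map_mat_mult[OF assms(1) B(1)] B(2) map_mat_one by simp
  then show ?thesis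
    by (rule det_nonzero_of_inverse[rotated 2]) (use assms B in \<open>auto simp: mats_over_iff\<close>)
qed

end

lemma mult_right_cancel_mat:
  fixes A :: "'a::field mat"
  assumes "A \<in> carrier_mat n n" "det A \<noteq> 0" "B \<in> carrier_mat m n" "C \<in> carrier_mat m n" "B * A = C * A"
  shows "B = C"
proof -
  note I = mat_inv_props[OF assms(1,2)]
  have "B = B * (A * mat_inv n A)" using I assms by simp
  also have "\<dots> = (B * A) * mat_inv n A" using I assms by (intro assoc_mult_mat[symmetric]) auto
  also have "\<dots> = (C * A) * mat_inv n A" using assms by simp
  also have "\<dots> = C * (A * mat_inv n A)" using I assms by (intro assoc_mult_mat) auto
  finally show ?thesis using I assms by simp
qed

section \<open>Moore matrices\<close>

lemma moore_carrier [simp]: "v \<in> carrier_vec N \<Longrightarrow> moore_matrix q v \<in> carrier_mat N N"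
  by (auto simp: moore_matrix_def)

lemma moore_index: "v \<in> carrier_vec N \<Longrightarrow> i < N \<Longrightarrow> j < N \<Longrightarrow> moore_matrix q v $$ (i, j) = v $ i ^ q ^ j"
  by (auto simp: moore_matrix_def mat_of_cols_index frob_vec_def)

definition lin_indep :: "'a::field set \<Rightarrow> 'a vec \<Rightarrow> bool" where
  "lin_indep F v \<longleftrightarrow> (\<forall>c. (\<forall>i<dim_vec v. c i \<in> F) \<longrightarrow> (\<Sum>i<dim_vec v. c i * v $ i) = 0
     \<longrightarrow> (\<forall>i<dim_vec v. c i = 0))"

text \<open>A kernel vector of the Moore matrix is an \<open>F\<close>-linear polynomial of degree at most \<open>q^(N-1)\<close> which
  vanishes on the \<open>q^N\<close> elements of the \<open>F\<close>-span of the entries of \<open>v\<close>.\<close>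

lemma (in finite_subfld) moore_det:
  assumes v: "v \<in> carrier_vec N" and ind: "lin_indep F v"
  shows "det (moore_matrix q v) \<noteq> 0"
proof
  assume "det (moore_matrix q v) = 0"
  then obtain c where c: "c \<in> carrier_vec N" "c \<noteq> 0\<^sub>v N" "moore_matrix q v *\<^sub>v c = 0\<^sub>v N"
    using det_0_iff_vec_prod_zero_field[OF moore_carrier[OF v]] by blast
  obtain j0 where j0: "j0 < N" "c $ j0 \<noteq> 0" using c by (metis carrier_vecD eq_vecI index_zero_vec(1) index_zero_vec(2))
  define p where "p = (\<Sum>j<N. monom (c $ j) (q ^ j))"
  have poly_p: "poly p x = (\<Sum>j<N. c $ j * x ^ q ^ j)" for x
    by (simp add: p_def poly_sum poly_monom)
  have root: "poly p (v $ i) = 0" if "i < N" for i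
  proof -
    have "poly p (v $ i) = (moore_matrix q v *\<^sub>v c) $ i" using that v c(1) carrier_matD[OF moore_carrier[OF v, of q]]
      by (simp add: poly_p scalar_prod_def moore_index lessThan_atLeast0 mult.commute)
    then show ?thesis using c(3) that by simp
  qed
  \<comment> \<open>The exponents \<open>q ^ j\<close> are distinct, so no two terms of p merge and
    p inherits the nonzero coefficient \<open>c $ j0\<close>.\<close>
  have "inj (\<lambda>j. q ^ j)" using q_gt_1 by (auto intro: injI simp: power_inject_exp)
  then have "coeff p (q ^ j0) = (\<Sum>j<N. if j = j0 then c $ j else 0)"
    unfolding p_def coeff_sum coeff_monom by (intro sum.cong) (auto simp: inj_eq)
  then have p0: "p \<noteq> 0" using j0 by auto
  have deg: "degree p \<le> q ^ (N - 1)"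
    unfolding p_def by (intro degree_sum_le) (auto intro!: order_trans[OF degree_monom_le] power_increasing simp: Suc_leI)
  define \<Lambda> where "\<Lambda> = (\<lambda>f. \<Sum>i<N. f i * v $ i) ` ({..<N} \<rightarrow>\<^sub>E F)"
  have "inj_on (\<lambda>f. \<Sum>i<N. f i * v $ i) ({..<N} \<rightarrow>\<^sub>E F)"
  proof (rule inj_onI)
    fix f g assume fg: "f \<in> {..<N} \<rightarrow>\<^sub>E F" "g \<in> {..<N} \<rightarrow>\<^sub>E F"
      and eq: "(\<Sum>i<N. f i * v $ i) = (\<Sum>i<N. g i * v $ i)"
    have "(\<Sum>i<N. (f i - g i) * v $ i) = 0" using eq by (simp add: left_diff_distrib sum_subtractf)
    moreover have "\<forall>i<N. f i - g i \<in> F" using fg by (auto simp: PiE_iff)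
    ultimately have "\<forall>i<N. f i - g i = 0"
      using ind[unfolded lin_indep_def, rule_format, of "\<lambda>i. f i - g i"] v by auto
    then show "f = g" using fg by (intro PiE_ext[OF fg]) auto
  qed
  then have "card \<Lambda> = q ^ N" by (simp add: \<Lambda>_def card_image card_PiE card_F)
  moreover have "\<Lambda> \<subseteq> {x. poly p x = 0}"
  proof
    fix x assume "x \<in> \<Lambda>"
    then obtain f where f: "f \<in> {..<N} \<rightarrow>\<^sub>E F" "x = (\<Sum>i<N. f i * v $ i)" by (auto simp: \<Lambda>_def)
    have "poly p x = (\<Sum>j<N. c $ j * (\<Sum>i<N. f i * (v $ i) ^ q ^ j))"
      unfolding poly_p f(2) frob_sum power_mult_distrib using f(1)
      by (intro sum.cong refl arg_cong2[of _ _ _ _ "(*)"]) (auto simp: pow_q_pow PiE_iff)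
    also have "\<dots> = (\<Sum>i<N. f i * poly p (v $ i))"
      unfolding poly_p sum_distrib_left by (subst sum.swap) (simp add: ac_simps)
    finally show "x \<in> {x. poly p x = 0}" using root by simp
  qed
  ultimately have "q ^ N \<le> card {x. poly p x = 0}" using card_mono[OF poly_roots_finite[OF p0]] by metis
  also have "\<dots> \<le> q ^ (N - 1)" using card_poly_roots_bound[OF p0] deg by linarith
  also have "\<dots> < q ^ N" using q_gt_1 j0 by (intro power_strict_increasing) auto
  finally show False by simp
qed

section \<open>Linear independence and span over a subfield as explicit sums\<close>

lemma combine_ambient:
  "length Ks = length Us \<Longrightarrow> ring.combine (ambient :: 'a::field ring) Ks Us = (\<Sum>i<length Us. Ks ! i * Us ! i)"
proof -
  interpret R: ring "ambient :: 'a ring" by (rule ring_from_type_algebra)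
  show "length Ks = length Us \<Longrightarrow> R.combine Ks Us = (\<Sum>i<length Us. Ks ! i * Us ! i)"
  proof (induction Ks Us rule: list_induct2)
    case Nil
    show ?case unfolding R.combine.simps by (simp add: ring_of_type_algebra_def)
  next
    case (Cons k Ks u Us)
    have "R.combine (k # Ks) (u # Us) = k * u + R.combine Ks Us"
      unfolding R.combine.simps by (simp add: ring_of_type_algebra_def)
    then show ?case using Cons by (simp add: sum.lessThan_Suc_shift del: sum.lessThan_Suc)
  qed
qed

lemma lin_indep_of_independent:
  assumes F: "subfield F (ambient :: 'a::field ring)" and "ring.independent ambient F (list_of_vec v)"
  shows "lin_indep F v"
  unfolding lin_indep_def
proof (intro allI impI)
  interpret R: ring "ambient :: 'a ring" by (rule ring_from_type_algebra)
  have zero: "\<zero>\<^bsub>ambient\<^esub> = (0 :: 'a)" by (simp add: ring_of_type_algebra_def)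
  fix c i assume c: "\<forall>i<dim_vec v. c i \<in> F" and s: "(\<Sum>i<dim_vec v. c i * v $ i) = 0" and i: "i < dim_vec v"
  define Ks where "Ks = map c [0..<dim_vec v]"
  have "R.combine Ks (list_of_vec v) = 0"
    using s by (subst combine_ambient) (auto simp: Ks_def list_of_vec_index)
  moreover have "set Ks \<subseteq> F" using c by (auto simp: Ks_def)
  ultimately have "set (take (length (list_of_vec v)) Ks) \<subseteq> {0}"
    using R.independent_imp_trivial_combine[OF F assms(2), of Ks] zero by simp
  then show "c i = 0" using i by (auto simp: Ks_def image_subset_iff)
qed

lemma span_ambient:
  assumes F: "subfield F (ambient :: 'a::field ring)"
  shows "ring.Span ambient F (list_of_vec v) =
    {\<Sum>i<dim_vec v. c i * v $ i | c. \<forall>i<dim_vec v. c i \<in> F}"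
proof -
  interpret R: ring "ambient :: 'a ring" by (rule ring_from_type_algebra)
  have "R.Span F (list_of_vec v) =
      {R.combine Ks (list_of_vec v) | Ks. length Ks = length (list_of_vec v) \<and> set Ks \<subseteq> F}"
    by (rule R.Span_eq_combine_set_length_version[OF F]) (simp add: ring_of_type_algebra_def)
  also have "\<dots> = {\<Sum>i<dim_vec v. c i * v $ i | c. \<forall>i<dim_vec v. c i \<in> F}"
  proof (intro equalityI subsetI; clarify)
    fix Ks assume "length Ks = length (list_of_vec v)" "set Ks \<subseteq> F"
    then show "\<exists>c. R.combine Ks (list_of_vec v) = (\<Sum>i<dim_vec v. c i * v $ i) \<and> (\<forall>i<dim_vec v. c i \<in> F)"
      by (intro exI[of _ "\<lambda>i. Ks ! i"]) (auto simp: combine_ambient list_of_vec_index)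
  next
    fix c assume "\<forall>i<dim_vec v. c i \<in> F"
    then show "\<exists>Ks. (\<Sum>i<dim_vec v. c i * v $ i) = R.combine Ks (list_of_vec v) \<and>
        length Ks = length (list_of_vec v) \<and> set Ks \<subseteq> F"
      by (intro exI[of _ "map c [0..<dim_vec v]"]) (auto simp: combine_ambient list_of_vec_index)
  qed
  finally show ?thesis .
qed

section \<open>Tensor products in coordinates\<close>

text \<open>A bilinear map \<open>\<beta>\<close> on \<open>M \<times> N\<close> identifies the tensor product with a set \<open>C\<close> of coordinates as soon as
  every coordinate \<open>c\<close> has a normal form \<open>nf c\<close> to which all formal sums with value \<open>c\<close> can be reduced.\<close>

locale tensor_bilinear =
  fixes R :: "('r, 'x) ring_scheme" and M :: "('r, 'm, 'y) module_scheme"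
    and N :: "('r, 'n, 'z) module_scheme"
    and \<beta> :: "'m \<Rightarrow> 'n \<Rightarrow> 'c::comm_monoid_add"
  assumes addM: "m \<in> carrier M \<Longrightarrow> m' \<in> carrier M \<Longrightarrow> m \<oplus>\<^bsub>M\<^esub> m' \<in> carrier M"
    and addN: "n \<in> carrier N \<Longrightarrow> n' \<in> carrier N \<Longrightarrow> n \<oplus>\<^bsub>N\<^esub> n' \<in> carrier N"
    and smultM: "r \<in> carrier R \<Longrightarrow> m \<in> carrier M \<Longrightarrow> r \<odot>\<^bsub>M\<^esub> m \<in> carrier M"
    and smultN: "r \<in> carrier R \<Longrightarrow> n \<in> carrier N \<Longrightarrow> r \<odot>\<^bsub>N\<^esub> n \<in> carrier N"
    and zeroM: "\<zero>\<^bsub>M\<^esub> \<in> carrier M"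
    and \<beta>_add_left: "m \<in> carrier M \<Longrightarrow> m' \<in> carrier M \<Longrightarrow> n \<in> carrier N \<Longrightarrow> \<beta> (m \<oplus>\<^bsub>M\<^esub> m') n = \<beta> m n + \<beta> m' n"
    and \<beta>_add_right: "m \<in> carrier M \<Longrightarrow> n \<in> carrier N \<Longrightarrow> n' \<in> carrier N \<Longrightarrow> \<beta> m (n \<oplus>\<^bsub>N\<^esub> n') = \<beta> m n + \<beta> m n'"
    and \<beta>_balanced: "r \<in> carrier R \<Longrightarrow> m \<in> carrier M \<Longrightarrow> n \<in> carrier N \<Longrightarrow> \<beta> (r \<odot>\<^bsub>M\<^esub> m) n = \<beta> m (r \<odot>\<^bsub>N\<^esub> n)"
    and \<beta>_zero: "n \<in> carrier N \<Longrightarrow> \<beta> \<zero>\<^bsub>M\<^esub> n = 0"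

locale tensor_coords = tensor_bilinear R M N \<beta>
  for R :: "('r, 'x) ring_scheme" and M :: "('r, 'm, 'y) module_scheme"
    and N :: "('r, 'n, 'z) module_scheme"
    and \<beta> :: "'m \<Rightarrow> 'n \<Rightarrow> 'c::comm_monoid_add" +
  fixes C :: "'c set" and nf :: "'c \<Rightarrow> ('m \<times> 'n) multiset"
  assumes C_zero: "0 \<in> C" and C_add: "x \<in> C \<Longrightarrow> y \<in> C \<Longrightarrow> x + y \<in> C"
    and \<beta>_C: "m \<in> carrier M \<Longrightarrow> n \<in> carrier N \<Longrightarrow> \<beta> m n \<in> C"
    and nf_carrier: "x \<in> C \<Longrightarrow> set_mset (nf x) \<subseteq> carrier M \<times> carrier N"
    and nf_value: "x \<in> C \<Longrightarrow> (\<Sum>(m, n)\<in>#nf x. \<beta> m n) = x"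
    and nf_add: "x \<in> C \<Longrightarrow> y \<in> C \<Longrightarrow> tensor_rel R M N (nf x + nf y) (nf (x + y))"
    and nf_zero: "tensor_rel R M N {#} (nf 0)"
    and nf_pure: "m \<in> carrier M \<Longrightarrow> n \<in> carrier N \<Longrightarrow> tensor_rel R M N {#(m, n)#} (nf (\<beta> m n))"

lemma tensor_rel_plus:
  assumes "tensor_rel R M N P Q" "tensor_rel R M N P' Q'"
    "set_mset P' \<subseteq> carrier M \<times> carrier N" "set_mset Q \<subseteq> carrier M \<times> carrier N"
  shows "tensor_rel R M N (P + P') (Q + Q')"
proof -
  have "tensor_rel R M N (P + P') (Q + P')" by (rule tensor_rel.cong[OF assms(1,3)])
  moreover have "tensor_rel R M N (P' + Q) (Q' + Q)" by (rule tensor_rel.cong[OF assms(2,4)])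
  ultimately show ?thesis by (metis tensor_rel.trans add.commute)
qed

lemma tensor_rel_sum:
  assumes "finite I" "\<And>i. i \<in> I \<Longrightarrow> tensor_rel R M N (P i) (Q i)"
    "\<And>i. i \<in> I \<Longrightarrow> set_mset (P i) \<subseteq> carrier M \<times> carrier N"
    "\<And>i. i \<in> I \<Longrightarrow> set_mset (Q i) \<subseteq> carrier M \<times> carrier N"
  shows "tensor_rel R M N (\<Sum>i\<in>I. P i) (\<Sum>i\<in>I. Q i)"
  using assms
proof (induction I rule: finite_induct)
  case empty
  then show ?case by (auto intro: tensor_rel.refl)
next
  case (insert i I)
  have "set_mset (\<Sum>i\<in>I. P i) \<subseteq> carrier M \<times> carrier N"
    using insert.hyps(1) insert.prems(2) by (auto simp: set_mset_sum)
  moreover have "set_mset (Q i) \<subseteq> carrier M \<times> carrier N" using insert.prems(3)[of i] by simp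
  ultimately have "tensor_rel R M N (P i + sum P I) (Q i + sum Q I)"
    using insert.IH insert.prems by (intro tensor_rel_plus) blast+
  then show ?case using insert.hyps by simp
qed

context tensor_coords
begin

definition val :: "('m \<times> 'n) multiset \<Rightarrow> 'c" where
  "val P = (\<Sum>(m, n)\<in>#P. \<beta> m n)"

lemma val_simps [simp]: "val {#} = 0" "val (P + Q) = val P + val Q" "val (add_mset (m, n) P) = \<beta> m n + val P"
  by (simp_all add: val_def)

lemma val_C: "set_mset P \<subseteq> carrier M \<times> carrier N \<Longrightarrow> val P \<in> C"
proof (induction P)
  case (add p P)
  then show ?case using \<beta>_C C_add by (cases p) auto
qed (simp add: C_zero)

lemma rel_imp:
  assumes "tensor_rel R M N P Q"
  shows "set_mset P \<subseteq> carrier M \<times> carrier N \<and> set_mset Q \<subseteq> carrier M \<times> carrier N \<and> val P = val Q"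
  using assms
  by induction (auto simp: addM addN smultM smultN zeroM \<beta>_add_left \<beta>_add_right \<beta>_balanced \<beta>_zero)

lemma rel_nf:
  assumes "set_mset P \<subseteq> carrier M \<times> carrier N"
  shows "tensor_rel R M N P (nf (val P))"
  using assms
proof (induction P)
  case empty
  then show ?case by (simp add: nf_zero)
next
  case (add p P)
  obtain m n where p: "p = (m, n)" by (cases p)
  have mn: "m \<in> carrier M" "n \<in> carrier N" "set_mset P \<subseteq> carrier M \<times> carrier N" using add.prems by (auto simp: p)
  have "tensor_rel R M N ({#p#} + P) (nf (\<beta> m n) + nf (val P))"
    using add.IH mn nf_pure[OF mn(1,2)] nf_carrier[OF \<beta>_C[OF mn(1,2)]]
    by (intro tensor_rel_plus) (auto simp: p)
  then have "tensor_rel R M N ({#p#} + P) (nf (\<beta> m n + val P))"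
    by (rule tensor_rel.trans) (intro nf_add \<beta>_C val_C mn)
  then show ?case by (simp add: p)
qed

text \<open>The value is constant on classes by induction over the relation; conversely, both sums
  reduce to the normal form of their common value.\<close>

lemma rel_iff:
  assumes "set_mset P \<subseteq> carrier M \<times> carrier N" "set_mset Q \<subseteq> carrier M \<times> carrier N"
  shows "tensor_rel R M N P Q \<longleftrightarrow> val P = val Q"
  using rel_imp[of P Q] rel_nf[OF assms(1)] rel_nf[OF assms(2)] by (metis tensor_rel.sym tensor_rel.trans)

text \<open>The class with coordinate c, taken as the whole fibre of \<open>val\<close> so that no
  representative has to be chosen.\<close>

definition elt :: "'c \<Rightarrow> ('m \<times> 'n) multiset set" where
  "elt c = {P. set_mset P \<subseteq> carrier M \<times> carrier N \<and> val P = c}"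

lemma tensor_class_elt:
  assumes "set_mset P \<subseteq> carrier M \<times> carrier N"
  shows "tensor_class R M N P = elt (val P)"
proof -
  have "tensor_rel R M N P Q \<longleftrightarrow> set_mset Q \<subseteq> carrier M \<times> carrier N \<and> val Q = val P" for Q
    using rel_iff[OF assms, of Q] rel_imp[of P Q] by (metis (no_types))
  then show ?thesis unfolding tensor_class_def elt_def by (intro Collect_cong)
qed

lemma nf_elt: "c \<in> C \<Longrightarrow> nf c \<in> elt c"
  using nf_carrier nf_value by (auto simp: elt_def val_def)

lemma elt_inj: "c \<in> C \<Longrightarrow> elt c = elt c' \<Longrightarrow> c = c'"
  using nf_elt[of c] by (auto simp: elt_def)

lemma carrier_tensor: "carrier (tensor R M N) = elt ` C"
proof (intro equalityI subsetI)
  fix A assume "A \<in> carrier (tensor R M N)"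
  then show "A \<in> elt ` C" using tensor_class_elt val_C by (auto simp: tensor_def)
next
  fix A assume "A \<in> elt ` C"
  then obtain c where c: "c \<in> C" "A = elt c" by blast
  then have "A = tensor_class R M N (nf c)"
    using tensor_class_elt[OF nf_carrier[OF c(1)]] nf_value[OF c(1)] by (simp add: val_def)
  then show "A \<in> carrier (tensor R M N)" using nf_carrier[OF c(1)] by (auto simp: tensor_def)
qed

lemma zero_tensor: "\<zero>\<^bsub>tensor R M N\<^esub> = elt 0"
  using tensor_class_elt[of "{#}"] by (simp add: tensor_def)

lemma add_tensor:
  assumes "c \<in> C" "c' \<in> C"
  shows "elt c \<oplus>\<^bsub>tensor R M N\<^esub> elt c' = elt (c + c')"
proof -
  have "tensor_class R M N (P + Q) = elt (c + c')" if "P \<in> elt c" "Q \<in> elt c'" for P Q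
    using that tensor_class_elt[of "P + Q"] by (auto simp: elt_def)
  then show ?thesis using nf_elt[OF assms(1)] nf_elt[OF assms(2)] by (auto simp: tensor_def)
qed

text \<open>\<open>tensor_map\<close> is a union over all representatives; it collapses to a single
  class because the image of every representative has value \<psi> c. Of \<psi> only additivity is
  required, so the lemma covers semilinear maps such as the Frobenius and the Galois action.\<close>

lemma tensor_map_elt:
  assumes f: "\<And>m. m \<in> carrier M \<Longrightarrow> f m \<in> carrier M" and g: "\<And>n. n \<in> carrier N \<Longrightarrow> g n \<in> carrier N"
    and \<psi>: "\<psi> 0 = 0" "\<And>x y. x \<in> C \<Longrightarrow> y \<in> C \<Longrightarrow> \<psi> (x + y) = \<psi> x + \<psi> y"
    "\<And>m n. m \<in> carrier M \<Longrightarrow> n \<in> carrier N \<Longrightarrow> \<beta> (f m) (g n) = \<psi> (\<beta> m n)"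
    and c: "c \<in> C"
  shows "tensor_map R M N f g (elt c) = elt (\<psi> c)"
proof -
  have carr: "set_mset (image_mset (map_prod f g) P) \<subseteq> carrier M \<times> carrier N"
    if "set_mset P \<subseteq> carrier M \<times> carrier N" for P
    using that f g by auto
  have "val (image_mset (map_prod f g) P) = \<psi> (val P)" if "set_mset P \<subseteq> carrier M \<times> carrier N" for P
    using that
  proof (induction P)
    case (add p P)
    then show ?case using \<psi> \<beta>_C val_C[of P] by (cases p) auto
  qed (simp add: \<psi>)
  then have "tensor_class R M N (image_mset (map_prod f g) P) = elt (\<psi> c)" if "P \<in> elt c" for P
    using that tensor_class_elt[OF carr] by (auto simp: elt_def)
  then show ?thesis using nf_elt[OF c] by (auto simp: tensor_map_def)
qed

definition co :: "('m \<times> 'n) multiset set \<Rightarrow> 'c" where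
  "co A = (THE c. c \<in> C \<and> elt c = A)"

lemma co_elt: "c \<in> C \<Longrightarrow> co (elt c) = c"
  unfolding co_def by (rule the_equality) (auto dest: elt_inj)

end

text \<open>Coordinate vectors are functions that vanish from N on: pointwise addition makes their
  type a commutative monoid, as required of the values of \<beta>, and two vectors agree exactly if
  they are equal as functions.\<close>

definition coord_space :: "nat \<Rightarrow> 'b::zero set \<Rightarrow> (nat \<Rightarrow> 'b) set" where
  "coord_space N S = {x. \<forall>i. if i < N then x i \<in> S else x i = 0}"

lemma coord_spaceI: "(\<And>i. i < N \<Longrightarrow> x i \<in> S) \<Longrightarrow> (\<And>i. i \<ge> N \<Longrightarrow> x i = 0) \<Longrightarrow> x \<in> coord_space N S"
  by (auto simp: coord_space_def)

lemma coord_spaceD: "x \<in> coord_space N S \<Longrightarrow> i < N \<Longrightarrow> x i \<in> S"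
  and coord_space_outside: "x \<in> coord_space N S \<Longrightarrow> i \<ge> N \<Longrightarrow> x i = 0"
  by (auto simp: coord_space_def split: if_splits dest: spec[of _ i])

lemma coord_space_eqI:
  "x \<in> coord_space N S \<Longrightarrow> y \<in> coord_space N S \<Longrightarrow> (\<And>i. i < N \<Longrightarrow> x i = y i) \<Longrightarrow> x = y"
  by (metis coord_space_outside ext linorder_not_less)

lemma sum_fun_apply: "(\<Sum>i\<in>I. f i) j = (\<Sum>i\<in>I. f i j)"
  for f :: "'i \<Rightarrow> 'j \<Rightarrow> 'b::comm_monoid_add"
  by (induction I rule: infinite_finite_induct) auto

text \<open>Used with \<open>p i x = (\<iota> x, b\<^sub>i)\<close> if the second factor is free with basis \<open>b\<close>, and with
  \<open>p i x = (b\<^sub>i, \<iota> x)\<close> if the first one is.\<close>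

lemma tensor_coords_basis:
  fixes \<gamma> :: "'m \<Rightarrow> 'n \<Rightarrow> nat \<Rightarrow> 'b::comm_monoid_add"
  assumes \<gamma>: "tensor_bilinear R M N \<gamma>"
    and S: "0 \<in> S" "\<And>x y. x \<in> S \<Longrightarrow> y \<in> S \<Longrightarrow> x + y \<in> S"
    and p: "\<And>i x. i < k \<Longrightarrow> x \<in> S \<Longrightarrow> p i x \<in> carrier M \<times> carrier N"
    and p_add: "\<And>i x y. i < k \<Longrightarrow> x \<in> S \<Longrightarrow> y \<in> S \<Longrightarrow> tensor_rel R M N {#p i x, p i y#} {#p i (x + y)#}"
    and p_zero: "\<And>i. i < k \<Longrightarrow> tensor_rel R M N {#} {#p i 0#}"
    and p_val: "\<And>i x. i < k \<Longrightarrow> x \<in> S \<Longrightarrow> case_prod \<gamma> (p i x) = (\<lambda>j. if j = i then x else 0)"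
    and \<gamma>_C: "\<And>m n. m \<in> carrier M \<Longrightarrow> n \<in> carrier N \<Longrightarrow> \<gamma> m n \<in> coord_space k S"
    and pure: "\<And>m n. m \<in> carrier M \<Longrightarrow> n \<in> carrier N \<Longrightarrow>
      tensor_rel R M N {#(m, n)#} (\<Sum>i<k. {#p i (\<gamma> m n i)#})"
  shows "tensor_coords R M N \<gamma> (coord_space k S) (\<lambda>x. \<Sum>i<k. {#p i (x i)#})"
proof (intro tensor_coords.intro tensor_coords_axioms.intro \<gamma> pure \<gamma>_C)
  let ?C = "coord_space k S"
  show "0 \<in> ?C" "\<And>x y. x \<in> ?C \<Longrightarrow> y \<in> ?C \<Longrightarrow> x + y \<in> ?C"
    using S by (auto intro!: coord_spaceI simp: coord_spaceD coord_space_outside)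
  fix x assume x: "x \<in> ?C"
  show "set_mset (\<Sum>i<k. {#p i (x i)#}) \<subseteq> carrier M \<times> carrier N"
    using p coord_spaceD[OF x] by (fastforce simp: set_mset_sum)
  have "(\<Sum>z\<in>#(\<Sum>i\<in>I. {#p i (x i)#}). case_prod \<gamma> z) = (\<Sum>i\<in>I. case_prod \<gamma> (p i (x i)))" for I
    by (induction I rule: infinite_finite_induct) auto
  then have "(\<Sum>z\<in>#(\<Sum>i<k. {#p i (x i)#}). case_prod \<gamma> z) = (\<Sum>i<k. case_prod \<gamma> (p i (x i)))" .
  also have "\<dots> = (\<Sum>i<k. (\<lambda>j. if j = i then x i else 0))"
    using coord_spaceD[OF x] by (intro sum.cong refl p_val) auto
  also have "\<dots> = x"
    using coord_space_outside[OF x] by (auto simp: fun_eq_iff sum_fun_apply not_less)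
  finally show "(\<Sum>(m, n)\<in>#(\<Sum>i<k. {#p i (x i)#}). \<gamma> m n) = x" .
  fix y assume y: "y \<in> ?C"
  have "tensor_rel R M N (\<Sum>i<k. {#p i (x i), p i (y i)#}) (\<Sum>i<k. {#p i ((x + y) i)#})"
    using p p_add coord_spaceD[OF x] coord_spaceD[OF y] S by (intro tensor_rel_sum) auto
  moreover have "(\<Sum>i<k. {#p i (x i), p i (y i)#}) = (\<Sum>i<k. {#p i (x i)#}) + (\<Sum>i<k. {#p i (y i)#})"
    unfolding sum.distrib[symmetric] by (intro sum.cong) auto
  ultimately show "tensor_rel R M N ((\<Sum>i<k. {#p i (x i)#}) + (\<Sum>i<k. {#p i (y i)#})) (\<Sum>i<k. {#p i ((x + y) i)#})"
    by simp
next
  have "tensor_rel R M N (\<Sum>i<k. {#}) (\<Sum>i<k. {#p i (0 i)#})"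
    using p p_zero S by (intro tensor_rel_sum) auto
  then show "tensor_rel R M N {#} (\<Sum>i<k. {#p i (0 i)#})" by simp
qed

text \<open>Partial sums stand in for \<open>finsum\<close>, which would need the module axioms.\<close>

primrec psum :: "('r, 'm, 'y) module_scheme \<Rightarrow> (nat \<Rightarrow> 'm) \<Rightarrow> nat \<Rightarrow> 'm" where
  "psum M f 0 = \<zero>\<^bsub>M\<^esub>"
| "psum M f (Suc k) = psum M f k \<oplus>\<^bsub>M\<^esub> f k"

context tensor_bilinear
begin

lemma pure_expand_left:
  assumes n: "n \<in> carrier N" and b: "\<And>i. i < k \<Longrightarrow> b i \<in> carrier M" and r: "\<And>i. i < k \<Longrightarrow> r i \<in> carrier R"
  shows "psum M (\<lambda>i. r i \<odot>\<^bsub>M\<^esub> b i) k \<in> carrier M \<and>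
    tensor_rel R M N {#(psum M (\<lambda>i. r i \<odot>\<^bsub>M\<^esub> b i) k, n)#} (\<Sum>i<k. {#(b i, r i \<odot>\<^bsub>N\<^esub> n)#})"
  using b r
proof (induction k)
  case 0
  then show ?case using n by (auto intro: zeroM tensor_rel.zero)
next
  case (Suc k)
  define m where "m = psum M (\<lambda>i. r i \<odot>\<^bsub>M\<^esub> b i) k"
  have m: "m \<in> carrier M" "tensor_rel R M N {#(m, n)#} (\<Sum>i<k. {#(b i, r i \<odot>\<^bsub>N\<^esub> n)#})"
    using Suc unfolding m_def by auto
  have bk: "b k \<in> carrier M" "r k \<in> carrier R" using Suc.prems by auto
  then have rb: "r k \<odot>\<^bsub>M\<^esub> b k \<in> carrier M" using smultM by auto
  have "tensor_rel R M N {#(m \<oplus>\<^bsub>M\<^esub> (r k \<odot>\<^bsub>M\<^esub> b k), n)#} ({#(m, n)#} + {#(r k \<odot>\<^bsub>M\<^esub> b k, n)#})"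
    using tensor_rel.add_left[of m M "r k \<odot>\<^bsub>M\<^esub> b k" n N R] m rb n by (simp add: add_mset_commute)
  moreover have "tensor_rel R M N ({#(m, n)#} + {#(r k \<odot>\<^bsub>M\<^esub> b k, n)#})
      ((\<Sum>i<k. {#(b i, r i \<odot>\<^bsub>N\<^esub> n)#}) + {#(b k, r k \<odot>\<^bsub>N\<^esub> n)#})"
    using m rb n bk Suc.prems smultN by (intro tensor_rel_plus tensor_rel.balanced) (auto simp: set_mset_sum)
  ultimately show ?case using m rb addM by (auto simp: m_def[symmetric] intro: tensor_rel.trans)
qed

text \<open>The generating relations kill a zero in the first factor only. The scalar z, in all
  applications 0, carries the zero of the second factor over to the first.\<close>

lemma pure_expand_right:
  assumes m: "m \<in> carrier M" and b: "\<And>i. i < k \<Longrightarrow> b i \<in> carrier N" and r: "\<And>i. i < k \<Longrightarrow> r i \<in> carrier R"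
    and z: "\<zero>\<^bsub>N\<^esub> \<in> carrier N" "z \<in> carrier R" "z \<odot>\<^bsub>N\<^esub> \<zero>\<^bsub>N\<^esub> = \<zero>\<^bsub>N\<^esub>" "z \<odot>\<^bsub>M\<^esub> m = \<zero>\<^bsub>M\<^esub>"
  shows "psum N (\<lambda>i. r i \<odot>\<^bsub>N\<^esub> b i) k \<in> carrier N \<and>
    tensor_rel R M N {#(m, psum N (\<lambda>i. r i \<odot>\<^bsub>N\<^esub> b i) k)#} (\<Sum>i<k. {#(r i \<odot>\<^bsub>M\<^esub> m, b i)#})"
  using b r
proof (induction k)
  case 0
  have "tensor_rel R M N {#(m, \<zero>\<^bsub>N\<^esub>)#} {#(\<zero>\<^bsub>M\<^esub>, \<zero>\<^bsub>N\<^esub>)#}"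
    using tensor_rel.balanced[OF z(2) m z(1)] z by (auto intro: tensor_rel.sym)
  then show ?case using z by (auto intro: tensor_rel.trans tensor_rel.zero)
next
  case (Suc k)
  define n where "n = psum N (\<lambda>i. r i \<odot>\<^bsub>N\<^esub> b i) k"
  have n: "n \<in> carrier N" "tensor_rel R M N {#(m, n)#} (\<Sum>i<k. {#(r i \<odot>\<^bsub>M\<^esub> m, b i)#})"
    using Suc unfolding n_def by auto
  have bk: "b k \<in> carrier N" "r k \<in> carrier R" using Suc.prems by auto
  then have rb: "r k \<odot>\<^bsub>N\<^esub> b k \<in> carrier N" using smultN by auto
  have "tensor_rel R M N {#(m, n \<oplus>\<^bsub>N\<^esub> (r k \<odot>\<^bsub>N\<^esub> b k))#} ({#(m, n)#} + {#(m, r k \<odot>\<^bsub>N\<^esub> b k)#})"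
    using tensor_rel.add_right[of m M n N "r k \<odot>\<^bsub>N\<^esub> b k" R] m rb n by (simp add: add_mset_commute)
  moreover have "tensor_rel R M N ({#(m, n)#} + {#(m, r k \<odot>\<^bsub>N\<^esub> b k)#})
      ((\<Sum>i<k. {#(r i \<odot>\<^bsub>M\<^esub> m, b i)#}) + {#(r k \<odot>\<^bsub>M\<^esub> m, b k)#})"
    using m rb n bk Suc.prems smultM
    by (intro tensor_rel_plus tensor_rel.sym[OF tensor_rel.balanced]) (auto simp: set_mset_sum)
  ultimately show ?case using n rb addN by (auto simp: n_def[symmetric] intro: tensor_rel.trans)
qed

end

section \<open>Skew polynomials\<close>

text \<open>The scalar multiplication of the motive of a Drinfeld module, written on E[\<tau>] in
  place of 1 x 1 matrices: the coefficients of p multiply from the left, t multiplies by \<phi> from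
  the right.\<close>

definition skew_act :: "nat \<Rightarrow> 'a::field poly \<Rightarrow> 'a poly \<Rightarrow> 'a poly \<Rightarrow> 'a poly" where
  "skew_act q \<phi> p f = (\<Sum>k\<le>degree p. Polynomial.smult (coeff p k) (((\<lambda>w. skew_mult q w \<phi>) ^^ k) f))"

definition tau_poly :: "nat \<Rightarrow> 'a::field poly \<Rightarrow> 'a poly" where
  "tau_poly q f = skew_mult q (monom 1 1) f"

context finite_subfld
begin

lemma coeff_skew_mult:
  "coeff (skew_mult q f g) k = (\<Sum>i\<le>k. coeff f i * coeff g (k - i) ^ q ^ i)"
proof -
  have inner: "(\<Sum>j\<le>degree g. if i + j = k then coeff f i * coeff g j ^ q ^ i else 0) =
      (if i \<le> k then coeff f i * coeff g (k - i) ^ q ^ i else 0)" for i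
  proof (cases "i \<le> k")
    case True
    have "(\<Sum>j\<le>degree g. if i + j = k then coeff f i * coeff g j ^ q ^ i else 0) =
        (\<Sum>j\<le>degree g. if j = k - i then coeff f i * coeff g j ^ q ^ i else 0)"
      using True by (intro sum.cong) auto
    also have "\<dots> = coeff f i * coeff g (k - i) ^ q ^ i"
      by (cases "k - i \<le> degree g") (auto simp: sum.delta coeff_eq_0)
    finally show ?thesis using True by simp
  qed (auto intro!: sum.neutral)
  have "coeff (skew_mult q f g) k = (\<Sum>i\<le>degree f. if i \<le> k then coeff f i * coeff g (k - i) ^ q ^ i else 0)"
    by (simp add: skew_mult_def coeff_sum inner)
  also have "\<dots> = (\<Sum>i\<le>max k (degree f). if i \<le> k then coeff f i * coeff g (k - i) ^ q ^ i else 0)"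
    by (rule sum.mono_neutral_left) (auto simp: coeff_eq_0)
  also have "\<dots> = (\<Sum>i\<le>k. if i \<le> k then coeff f i * coeff g (k - i) ^ q ^ i else 0)"
    by (rule sum.mono_neutral_right) auto
  finally show ?thesis by simp
qed

lemma skew_add_left: "skew_mult q (f + f') g = skew_mult q f g + skew_mult q f' g"
  by (rule poly_eqI) (simp add: coeff_skew_mult algebra_simps sum.distrib)

lemma skew_zero_left [simp]: "skew_mult q 0 g = 0"
  by (rule poly_eqI) (simp add: coeff_skew_mult)

lemma skew_smult_left: "skew_mult q (Polynomial.smult c f) g = Polynomial.smult c (skew_mult q f g)"
  by (rule poly_eqI) (simp add: coeff_skew_mult algebra_simps sum_distrib_left)

lemma skew_closed:
  "subfld E \<Longrightarrow> f \<in> polys_over E \<Longrightarrow> g \<in> polys_over E \<Longrightarrow> skew_mult q f g \<in> polys_over E"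
  unfolding polys_over_def by (auto simp: coeff_skew_mult intro!: subfld.sum subfld.mult subfld.power)

lemma coeff_tau: "coeff (tau_poly q f) k = (if k = 0 then 0 else coeff f (k - 1) ^ q)"
proof (cases k)
  case (Suc m)
  have "coeff (tau_poly q f) k = (\<Sum>i\<le>k. if i = 1 then coeff f (k - i) ^ q ^ i else 0)"
    unfolding tau_poly_def coeff_skew_mult coeff_monom by (intro sum.cong) auto
  then show ?thesis using Suc by simp
qed (simp add: coeff_skew_mult tau_poly_def)

lemma tau_add: "tau_poly q (f + g :: 'a poly) = tau_poly q f + tau_poly q g"
  by (rule poly_eqI) (simp add: coeff_tau frob_add)

lemma tau_zero [simp]: "tau_poly q 0 = 0"
  by (rule poly_eqI) (simp add: coeff_tau)

lemma tau_smult: "tau_poly q (Polynomial.smult c f) = Polynomial.smult (c ^ q) (tau_poly q f)"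
  by (rule poly_eqI) (simp add: coeff_tau power_mult_distrib)

lemma tau_skew: "tau_poly q (skew_mult q f (g :: 'a poly)) = skew_mult q (tau_poly q f) g"
proof (rule poly_eqI)
  fix k show "coeff (tau_poly q (skew_mult q f g)) k = coeff (skew_mult q (tau_poly q f) g) k"
  proof (cases k)
    case (Suc m)
    have "coeff (tau_poly q (skew_mult q f g)) k = (\<Sum>i\<le>m. coeff f i * coeff g (m - i) ^ q ^ i) ^ q ^ 1"
      by (simp add: coeff_tau Suc coeff_skew_mult)
    also have "\<dots> = (\<Sum>i\<le>m. coeff f i ^ q * coeff g (m - i) ^ q ^ Suc i)"
      unfolding frob_sum by (simp add: power_mult_distrib flip: power_mult) (simp add: mult.commute)
    also have "\<dots> = (\<Sum>i\<le>Suc m. coeff (tau_poly q f) i * coeff g (Suc m - i) ^ q ^ i)"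
      unfolding sum.atMost_Suc_shift by (simp add: coeff_tau)
    finally show ?thesis by (simp add: Suc coeff_skew_mult)
  qed (simp add: coeff_skew_mult coeff_tau)
qed

lemma skew_pow_add: "((\<lambda>w. skew_mult q w \<phi>) ^^ k) (f + g) =
    ((\<lambda>w. skew_mult q w \<phi>) ^^ k) f + ((\<lambda>w. skew_mult q w \<phi>) ^^ k) g"
  by (induction k) (auto simp: skew_add_left)

lemma skew_pow_closed: "subfld E \<Longrightarrow> f \<in> polys_over E \<Longrightarrow> \<phi> \<in> polys_over E \<Longrightarrow>
    ((\<lambda>w. skew_mult q w \<phi>) ^^ k) f \<in> polys_over E"
  by (induction k) (auto simp: skew_closed)

lemma tau_skew_pow: "tau_poly q (((\<lambda>w. skew_mult q w (\<phi> :: 'a poly)) ^^ k) f) =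
    ((\<lambda>w. skew_mult q w \<phi>) ^^ k) (tau_poly q f)"
  by (induction k) (auto simp: tau_skew)

lemma skew_act_bound:
  assumes "degree p \<le> n"
  shows "skew_act q \<phi> p f = (\<Sum>k\<le>n. Polynomial.smult (coeff p k) (((\<lambda>w. skew_mult q w \<phi>) ^^ k) f))"
  unfolding skew_act_def
  by (rule sum.mono_neutral_left) (use assms in \<open>auto simp: coeff_eq_0\<close>)

lemma skew_act_add_right: "skew_act q \<phi> p (f + g) = skew_act q \<phi> p f + skew_act q \<phi> p g"
  by (simp add: skew_act_def skew_pow_add smult_add_right sum.distrib)

lemma skew_act_add_left: "skew_act q \<phi> (p + p') f = skew_act q \<phi> p f + skew_act q \<phi> p' f"
proof -
  let ?n = "max (degree p) (degree p')"
  show ?thesis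
    by (subst (1 2 3) skew_act_bound[of _ ?n])
       (auto simp: smult_add_left sum.distrib degree_add_le_max)
qed

lemma skew_act_zero_left [simp]: "skew_act q \<phi> 0 f = 0"
  by (simp add: skew_act_def)

lemma skew_act_zero_right [simp]: "skew_act q \<phi> p 0 = 0"
  using skew_act_add_right[of \<phi> p 0 0] by (metis add_0 add_cancel_right_right)

lemma smult_sum_right: "Polynomial.smult c (\<Sum>i\<in>I. f i) = (\<Sum>i\<in>I. Polynomial.smult c (f i))"
  by (induction I rule: infinite_finite_induct) (auto simp: smult_add_right)

lemma skew_act_smult_left: "skew_act q \<phi> (Polynomial.smult c p) f = Polynomial.smult c (skew_act q \<phi> p f)"
  by (subst (1 2) skew_act_bound[of _ "degree p"]) (auto simp: smult_sum_right)

lemma skew_act_pCons: "skew_act q \<phi> (pCons c p) f = Polynomial.smult c f + skew_act q \<phi> p (skew_mult q f \<phi>)"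
proof -
  have "skew_act q \<phi> (pCons c p) f =
      (\<Sum>k\<le>Suc (degree p). Polynomial.smult (coeff (pCons c p) k) (((\<lambda>w. skew_mult q w \<phi>) ^^ k) f))"
    by (rule skew_act_bound) (rule degree_pCons_le)
  also have "\<dots> = Polynomial.smult c f + skew_act q \<phi> p (skew_mult q f \<phi>)"
    unfolding sum.atMost_Suc_shift by (simp add: skew_act_def funpow_Suc_right del: funpow.simps)
  finally show ?thesis .
qed

lemma skew_act_const [simp]: "skew_act q \<phi> [:c:] f = Polynomial.smult c f"
  by (simp add: skew_act_pCons)

lemma skew_act_one [simp]: "skew_act q \<phi> 1 f = f"
  by (simp add: one_pCons)

text \<open>Right multiplication by \<phi> commutes with left multiplication by scalars, hence with
  the action of every p. This makes \<open>skew_act\<close> an action of the commutative ring E[t]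
  on the noncommutative ring E[\<tau>].\<close>

lemma skew_act_skew: "skew_act q \<phi> p (skew_mult q f \<phi>) = skew_mult q (skew_act q \<phi> p f) \<phi>"
  by (induction p arbitrary: f) (simp_all add: skew_act_pCons skew_add_left skew_smult_left)

lemma skew_act_mult: "skew_act q \<phi> (p * p') f = skew_act q \<phi> p (skew_act q \<phi> p' f)"
  by (induction p arbitrary: f)
     (simp_all add: skew_act_pCons skew_act_add_left skew_act_smult_left skew_act_skew)

lemma skew_act_closed:
  assumes "subfld E" "p \<in> polys_over E" "f \<in> polys_over E" "\<phi> \<in> polys_over E"
  shows "skew_act q \<phi> p f \<in> polys_over E"
  unfolding skew_act_def using assms
  by (intro subfld.polys_sum subfld.polys_smult skew_pow_closed) (auto simp: polys_over_def)

lemma tau_sum: "tau_poly q (\<Sum>i\<in>I. f i :: 'a poly) = (\<Sum>i\<in>I. tau_poly q (f i))"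
  by (induction I rule: infinite_finite_induct) (auto simp: tau_add)

text \<open>Left multiplication by \<tau> commutes with t, which multiplies from the right, and
  turns a left scalar c into c^q.\<close>

lemma tau_skew_act:
  "tau_poly q (skew_act q \<phi> p (f :: 'a poly)) = skew_act q \<phi> (map_poly (\<lambda>c. c ^ q) p) (tau_poly q f)"
proof -
  have "degree (map_poly (\<lambda>c. c ^ q) p) \<le> degree p"
    using q_pos by (intro degree_le) (auto simp: coeff_map_poly coeff_eq_0)
  then show ?thesis
    using q_pos by (subst skew_act_bound[of _ "degree p"])
      (auto simp: skew_act_def tau_sum tau_smult tau_skew_pow coeff_map_poly)
qed

end

section \<open>Untwisting the motive of the explicit model\<close>

definition coeff_scale :: "(nat \<Rightarrow> 'a::comm_semiring_0) \<Rightarrow> 'a poly \<Rightarrow> 'a poly" where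
  "coeff_scale c f = (\<Sum>k\<le>degree f. monom (c k * coeff f k) k)"

lemma coeff_coeff_scale [simp]: "coeff (coeff_scale c f) k = c k * coeff f k"
proof -
  have "coeff (coeff_scale c f) k = (\<Sum>i\<le>degree f. if i = k then c k * coeff f k else 0)"
    unfolding coeff_scale_def coeff_sum coeff_monom by (intro sum.cong) auto
  then show ?thesis by (auto simp: coeff_eq_0)
qed

lemma coeff_scale_zero [simp]: "coeff_scale c 0 = 0"
  by (rule poly_eqI) simp

lemma frob_mat_carrier [simp]: "frob_mat q i A \<in> carrier_mat m n \<longleftrightarrow> A \<in> carrier_mat m n"
  by (simp add: frob_mat_def)

lemma frob_mat_dims [simp]: "dim_row (frob_mat q i A) = dim_row A" "dim_col (frob_mat q i A) = dim_col A"
  by (simp_all add: frob_mat_def)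

lemma frob_mat_index [simp]: "i < dim_row A \<Longrightarrow> j < dim_col A \<Longrightarrow> frob_mat q k A $$ (i, j) = A $$ (i, j) ^ q ^ k"
  by (simp add: frob_mat_def)

lemma frob_mat_zero [simp]: "frob_mat q 0 A = A"
  by (rule eq_matI) (auto simp: frob_mat_def)

lemma frob_mat_frob_mat: "frob_mat q i (frob_mat q j A) = frob_mat q (i + j) A"
  by (rule eq_matI) (auto simp: power_mult[symmetric] power_add mult.commute)

lemma frob_mat_transpose: "frob_mat q i (transpose_mat A) = transpose_mat (frob_mat q i A)"
  by (rule eq_matI) auto

lemma (in finite_subfld) frob_mat_mult:
  "A \<in> carrier_mat m n \<Longrightarrow> B \<in> carrier_mat n l \<Longrightarrow> frob_mat q i (A * B) = frob_mat q i A * frob_mat q i (B :: 'a mat)"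
  unfolding frob_mat_def by (rule fhom.map_mat_mult[OF frob_fhom]) auto

lemma (in finite_subfld) frob_mat_one: "frob_mat q i (1\<^sub>m n) = (1\<^sub>m n :: 'a mat)"
  unfolding frob_mat_def by (rule fhom.map_mat_one[OF frob_fhom])

lemma (in subfld) frob_mat_over: "A \<in> mats_over m n K \<Longrightarrow> frob_mat q i A \<in> mats_over m n K"
  by (auto simp: mats_over_iff)

lemma sum_swap3:
  "(\<Sum>j\<in>A. \<Sum>l\<in>B. \<Sum>s\<in>C. f j l s) = (\<Sum>s\<in>C. \<Sum>l\<in>B. \<Sum>j\<in>A. f j l s)"
proof -
  have "(\<Sum>j\<in>A. \<Sum>l\<in>B. \<Sum>s\<in>C. f j l s) = (\<Sum>l\<in>B. \<Sum>j\<in>A. \<Sum>s\<in>C. f j l s)" by (rule sum.swap)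
  also have "\<dots> = (\<Sum>l\<in>B. \<Sum>s\<in>C. \<Sum>j\<in>A. f j l s)" by (rule sum.cong[OF HOL.refl sum.swap])
  also have "\<dots> = (\<Sum>s\<in>C. \<Sum>l\<in>B. \<Sum>j\<in>A. f j l s)" by (rule sum.swap)
  finally show ?thesis .
qed

text \<open>\<Phi> is any invertible matrix over E, without reference to a representation. The
  locale is used twice: with the companion matrix, and with N = 1 and \<Phi> = 1, where it describes
  the motive of the Drinfeld module itself.\<close>

locale twist_data = finite_subfld F q for F :: "'a::field set" and q +
  fixes E :: "'a set" and N :: nat and \<Phi> :: "'a mat" and \<phi> :: "'a poly"
  assumes E: "subfld E" and \<Phi>: "\<Phi> \<in> mats_over N N E" "det \<Phi> \<noteq> 0" and \<phi>: "\<phi> \<in> polys_over E"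
begin

definition \<Psi> :: "'a mat" where "\<Psi> = mat_inv N (transpose_mat \<Phi>)"

definition tw :: "nat \<Rightarrow> 'a mat" where "tw = frob_prod q N \<Phi>"

definition untw :: "nat \<Rightarrow> 'a mat" where "untw = frob_prod q N \<Psi>"

text \<open>The matrix of the model in a form that does not mention r: the coefficient at
  \<open>\<tau>\<^sup>m\<close> is that of \<phi> times \<open>untw m\<close>, for every m.\<close>

definition Et :: "'a poly mat" where
  "Et = mat N N (\<lambda>jk. coeff_scale (\<lambda>m. untw m $$ jk) \<phi>)"

lemma \<Phi>c: "\<Phi> \<in> carrier_mat N N"
  using \<Phi> mats_over_carrier by blast

lemma \<Psi>: "\<Psi> \<in> mats_over N N E" "\<Psi> * transpose_mat \<Phi> = 1\<^sub>m N" "\<Psi> \<in> carrier_mat N N"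
proof -
  have T: "transpose_mat \<Phi> \<in> mats_over N N E" "det (transpose_mat \<Phi>) \<noteq> 0"
    using subfld.mats_over_transpose[OF E \<Phi>(1)] det_transpose[OF \<Phi>c] \<Phi>(2) by auto
  show "\<Psi> \<in> mats_over N N E" "\<Psi> * transpose_mat \<Phi> = 1\<^sub>m N"
    using subfld.mat_inv_over[OF E T] mat_inv_props(3)[OF mats_over_carrier[OF T(1)] T(2)] by (auto simp: \<Psi>_def)
  then show "\<Psi> \<in> carrier_mat N N" using mats_over_carrier by blast
qed

lemma frob_prod_over: "A \<in> mats_over N N E \<Longrightarrow> frob_prod q N A k \<in> mats_over N N E"
  by (induction k) (auto simp: subfld.mats_over_one[OF E] intro!: subfld.mats_over_mult[OF E] subfld.frob_mat_over[OF E])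

lemma tw_over: "tw k \<in> mats_over N N E" and untw_over: "untw k \<in> mats_over N N E"
  using frob_prod_over \<Phi>(1) \<Psi>(1) by (auto simp: tw_def untw_def)

lemma tw_carrier [simp]: "tw k \<in> carrier_mat N N" and untw_carrier [simp]: "untw k \<in> carrier_mat N N"
  using tw_over untw_over mats_over_carrier by blast+

lemma tw_dims [simp]: "dim_row (tw k) = N" "dim_col (tw k) = N" "dim_row (untw k) = N" "dim_col (untw k) = N"
  using tw_carrier untw_carrier by (meson carrier_matD)+

lemma tw_0: "tw 0 = 1\<^sub>m N" and untw_0: "untw 0 = 1\<^sub>m N"
  by (simp_all add: tw_def untw_def)

lemma tw_add: "tw (i + j) = tw i * frob_mat q i (tw j)"
proof (induction j)
  case 0
  then show ?case using right_mult_one_mat[OF tw_carrier] by (simp add: tw_0 frob_mat_one)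
next
  case (Suc j)
  have "tw (i + Suc j) = tw i * frob_mat q i (tw j) * frob_mat q (i + j) \<Phi>"
    using Suc by (simp add: tw_def)
  also have "\<dots> = tw i * (frob_mat q i (tw j) * frob_mat q (i + j) \<Phi>)"
    using \<Phi>c by (intro assoc_mult_mat) auto
  also have "frob_mat q i (tw j) * frob_mat q (i + j) \<Phi> = frob_mat q i (tw j * frob_mat q j \<Phi>)"
    using \<Phi>c by (subst frob_mat_mult) (auto simp: frob_mat_frob_mat)
  also have "tw j * frob_mat q j \<Phi> = tw (Suc j)" by (simp add: tw_def)
  finally show ?case .
qed

text \<open>\<open>frob_prod\<close> grows on the right by conjugates of \<Phi>. This is the
  recursion on the left, the form in which \<Phi> can be split off after a Frobenius.\<close>

lemma tw_Suc: "tw (Suc k) = \<Phi> * frob_mat q 1 (tw k)"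
proof -
  have "tw 1 = \<Phi>" using \<Phi>c by (simp add: tw_def)
  then show ?thesis using tw_add[of 1 k] by simp
qed

text \<open>Transposing reverses the product of the conjugates of \<Phi>, so \<Psi>^(k) and the
  transpose of \<Phi>^(k) meet in the middle and cancel, then the factors around them. This is why
  \<Psi> is the inverse of the transpose.\<close>

lemma untw_tw: "untw k * transpose_mat (tw k) = 1\<^sub>m N"
proof (induction k)
  case 0
  then show ?case by (simp add: tw_0 untw_0)
next
  case (Suc k)
  have "transpose_mat (tw (Suc k)) = transpose_mat (frob_mat q k \<Phi>) * transpose_mat (tw k)"
  proof -
    have "tw (Suc k) = tw k * frob_mat q k \<Phi>" by (simp add: tw_def)
    then show ?thesis using \<Phi>c by (simp add: transpose_mult[of _ N N _ N])
  qed
  moreover have "frob_mat q k \<Psi> * transpose_mat (frob_mat q k \<Phi>) = 1\<^sub>m N"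
    using \<Psi> \<Phi>c frob_mat_mult[of \<Psi> N N "transpose_mat \<Phi>" N k] by (simp add: frob_mat_transpose frob_mat_one)
  moreover have "untw (Suc k) = untw k * frob_mat q k \<Psi>" by (simp add: untw_def)
  ultimately have "untw (Suc k) * transpose_mat (tw (Suc k)) =
      untw k * frob_mat q k \<Psi> * (transpose_mat (frob_mat q k \<Phi>) * transpose_mat (tw k))" by simp
  also have "\<dots> = untw k * (frob_mat q k \<Psi> * (transpose_mat (frob_mat q k \<Phi>) * transpose_mat (tw k)))"
    using \<Psi> \<Phi>c by (intro assoc_mult_mat) auto
  also have "frob_mat q k \<Psi> * (transpose_mat (frob_mat q k \<Phi>) * transpose_mat (tw k)) =
      frob_mat q k \<Psi> * transpose_mat (frob_mat q k \<Phi>) * transpose_mat (tw k)"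
    using \<Psi> \<Phi>c by (intro assoc_mult_mat[symmetric]) auto
  also have "\<dots> = transpose_mat (tw k)"
    using \<open>frob_mat q k \<Psi> * transpose_mat (frob_mat q k \<Phi>) = 1\<^sub>m N\<close> by simp
  finally show ?case using Suc by simp
qed

lemma tw_untw: "transpose_mat (tw k) * untw k = 1\<^sub>m N"
  by (rule mat_mult_left_right_inverse[OF _ _ untw_tw]) auto

text \<open>By \<open>tw_add\<close>, the last i factors of \<open>tw (k + i)\<close> are the k-th
  conjugate of \<open>tw i\<close>, and these are cancelled. \<open>H_skew\<close> rests on this
  identity.\<close>

lemma frob_untw_tw: "frob_mat q k (untw i) * transpose_mat (tw (k + i)) = transpose_mat (tw k)"
proof -
  have "transpose_mat (tw (k + i)) = transpose_mat (frob_mat q k (tw i)) * transpose_mat (tw k)"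
    by (simp add: tw_add transpose_mult[of _ N N _ N])
  then have "frob_mat q k (untw i) * transpose_mat (tw (k + i)) =
      frob_mat q k (untw i) * (transpose_mat (frob_mat q k (tw i)) * transpose_mat (tw k))" by simp
  also have "\<dots> = frob_mat q k (untw i) * transpose_mat (frob_mat q k (tw i)) * transpose_mat (tw k)"
    by (intro assoc_mult_mat[symmetric]) auto
  also have "frob_mat q k (untw i) * transpose_mat (frob_mat q k (tw i)) = 1\<^sub>m N"
    using frob_mat_mult[of "untw i" N N "transpose_mat (tw i)" N k] untw_tw
    by (simp add: frob_mat_transpose frob_mat_one)
  finally show ?thesis by simp
qed

lemma mult_transpose_index:
  assumes "A \<in> carrier_mat N N" "B \<in> carrier_mat N N" "l < N" "i < N"
  shows "(A * transpose_mat B) $$ (l, i) = (\<Sum>j<N. A $$ (l, j) * B $$ (i, j))"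
  using assms by (simp add: scalar_prod_def lessThan_atLeast0)

lemma frob_untw_tw_index:
  assumes "l < N" "i < N"
  shows "(\<Sum>j<N. untw m $$ (l, j) ^ q ^ k * tw (k + m) $$ (i, j)) = tw k $$ (i, l)"
proof -
  have "(\<Sum>j<N. untw m $$ (l, j) ^ q ^ k * tw (k + m) $$ (i, j)) =
      (frob_mat q k (untw m) * transpose_mat (tw (k + m))) $$ (l, i)"
    using assms by (subst mult_transpose_index) (auto intro!: sum.cong)
  then show ?thesis using assms by (simp add: frob_untw_tw)
qed

text \<open>The row vector of coefficients at \<open>\<tau>\<^sup>k\<close> is multiplied by the transpose of \<open>tw k\<close>.\<close>

definition H :: "'a poly mat \<Rightarrow> nat \<Rightarrow> 'a poly" where
  "H v i = (if i < N then \<Sum>j<N. coeff_scale (\<lambda>k. tw k $$ (i, j)) (v $$ (0, j)) else 0)"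

definition H_inv :: "(nat \<Rightarrow> 'a poly) \<Rightarrow> 'a poly mat" where
  "H_inv h = mat 1 N (\<lambda>(_, j). \<Sum>i<N. coeff_scale (\<lambda>k. untw k $$ (i, j)) (h i))"

lemma coeff_H: "i < N \<Longrightarrow> coeff (H v i) k = (\<Sum>j<N. tw k $$ (i, j) * coeff (v $$ (0, j)) k)"
  by (simp add: H_def coeff_sum)

text \<open>In the product, the coefficient of v at \<open>\<tau>\<^sup>s\<close> meets the s-th
  conjugate of \<open>untw m\<close> and of the coefficient of \<phi> at m = k - s, and
  \<open>H\<close> multiplies the result by \<open>tw k\<close>. By \<open>frob_untw_tw\<close> only
  \<open>tw s\<close> survives, the factor belonging to \<open>H v\<close>. So t becomes right
  multiplication by \<phi> in every coordinate.\<close>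

lemma H_skew:
  assumes v: "v \<in> carrier_mat 1 N" and i: "i < N"
  shows "H (skew_mat_mult q v Et) i = skew_mult q (H v i) \<phi>"
proof (rule poly_eqI)
  fix k
  have "coeff (H (skew_mat_mult q v Et) i) k =
      (\<Sum>j<N. tw k $$ (i, j) * (\<Sum>l<N. \<Sum>s\<le>k. coeff (v $$ (0, l)) s * (untw (k - s) $$ (l, j) * coeff \<phi> (k - s)) ^ q ^ s))"
    using v i by (simp add: coeff_H skew_mat_mult_def Et_def coeff_sum coeff_skew_mult)
  also have "\<dots> = (\<Sum>s\<le>k. \<Sum>l<N. coeff (v $$ (0, l)) s * coeff \<phi> (k - s) ^ q ^ s *
      (\<Sum>j<N. untw (k - s) $$ (l, j) ^ q ^ s * tw (s + (k - s)) $$ (i, j)))"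
      unfolding sum_distrib_left
    by (subst sum_swap3) (auto intro!: sum.cong simp: power_mult_distrib ac_simps)
  also have "\<dots> = (\<Sum>s\<le>k. \<Sum>l<N. coeff (v $$ (0, l)) s * coeff \<phi> (k - s) ^ q ^ s * tw s $$ (i, l))"
    by (rule sum.cong[OF HOL.refl], rule sum.cong[OF HOL.refl], subst frob_untw_tw_index) (use i in auto)
  also have "\<dots> = coeff (skew_mult q (H v i) \<phi>) k"
    unfolding coeff_skew_mult coeff_H[OF i] sum_distrib_right
    by (rule sum.cong[OF HOL.refl], rule sum.cong[OF HOL.refl]) (simp add: ac_simps)
  finally show "coeff (H (skew_mat_mult q v Et) i) k = coeff (skew_mult q (H v i) \<phi>) k" .
qed

lemma skew_mat_pow_carrier:
  "v \<in> carrier_mat 1 N \<Longrightarrow> ((\<lambda>w. skew_mat_mult q w Et) ^^ k) v \<in> carrier_mat 1 N"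
  by (induction k) (auto simp: skew_mat_mult_def Et_def)

lemma H_skew_pow:
  assumes "v \<in> carrier_mat 1 N" "i < N"
  shows "H (((\<lambda>w. skew_mat_mult q w Et) ^^ k) v) i = ((\<lambda>w. skew_mult q w \<phi>) ^^ k) (H v i)"
  by (induction k) (use assms skew_mat_pow_carrier in \<open>auto simp: H_skew\<close>)

lemma H_outside: "i \<ge> N \<Longrightarrow> H v i = 0"
  by (simp add: H_def)

lemma H_smult:
  assumes v: "v \<in> carrier_mat 1 N"
  shows "H (p \<odot>\<^bsub>anderson_motive q E N Et\<^esub> v) i = skew_act q \<phi> p (H v i)"
proof (cases "i < N")
  case True
  have "H (p \<odot>\<^bsub>anderson_motive q E N Et\<^esub> v) i =
      (\<Sum>k\<le>degree p. Polynomial.smult (coeff p k) (H (((\<lambda>w. skew_mat_mult q w Et) ^^ k) v) i))"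
    using True
    by (intro poly_eqI) (simp add: coeff_H anderson_motive_def coeff_sum sum_distrib_left sum.swap[of _ "{..degree p}"] ac_simps)
  then show ?thesis using True v by (simp add: H_skew_pow skew_act_def)
qed (simp add: H_outside)

lemma H_add: "v \<in> carrier_mat 1 N \<Longrightarrow> w \<in> carrier_mat 1 N \<Longrightarrow> H (v + w) = H v + H w"
  by (rule ext, rule poly_eqI) (simp add: H_def coeff_sum sum.distrib algebra_simps)

lemma H_zero: "H (0\<^sub>m 1 N) = 0"
  by (rule ext) (simp add: H_def)

text \<open>Multiplication by \<tau> moves the coefficient at m to m + 1 and raises it to the q-th
  power, while \<open>tw_Suc\<close> splits \<open>tw (Suc m)\<close> into \<Phi> and the conjugate
  of \<open>tw m\<close>. So the plain \<tau> becomes \<Phi> \<tau>.\<close>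

lemma H_tau:
  assumes v: "v \<in> carrier_mat 1 N" and i: "i < N"
  shows "H (map_mat (skew_mult q (monom 1 1)) v) i = (\<Sum>l<N. Polynomial.smult (\<Phi> $$ (i, l)) (tau_poly q (H v l)))"
proof (rule poly_eqI)
  have map: "map_mat (skew_mult q (monom 1 1)) v $$ (0, j) = tau_poly q (v $$ (0, j))" if "j < N" for j
    using v that by (simp add: tau_poly_def)
  fix k
  show "coeff (H (map_mat (skew_mult q (monom 1 1)) v) i) k =
      coeff (\<Sum>l<N. Polynomial.smult (\<Phi> $$ (i, l)) (tau_poly q (H v l))) k"
  proof (cases k)
    case 0
    have "coeff (map_mat (skew_mult q (monom 1 1)) v $$ (0, j)) 0 = 0" if "j < N" for j
      unfolding map[OF that] by (simp add: coeff_tau)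
    then show ?thesis using i unfolding 0 coeff_H[OF i] by (simp add: coeff_tau coeff_sum)
  next
    case (Suc m)
    have tw: "tw (Suc m) $$ (i, j) = (\<Sum>l<N. \<Phi> $$ (i, l) * tw m $$ (l, j) ^ q)" if "j < N" for j
      using that i \<Phi>c unfolding tw_Suc by (simp add: scalar_prod_def lessThan_atLeast0)
    have "coeff (H (map_mat (skew_mult q (monom 1 1)) v) i) k =
        (\<Sum>j<N. (\<Sum>l<N. \<Phi> $$ (i, l) * tw m $$ (l, j) ^ q) * coeff (v $$ (0, j)) m ^ q)"
      unfolding coeff_H[OF i] by (rule sum.cong[OF HOL.refl]) (simp only: map tw Suc lessThan_iff, simp add: coeff_tau)
    also have "\<dots> = (\<Sum>l<N. \<Phi> $$ (i, l) * (\<Sum>j<N. (tw m $$ (l, j) * coeff (v $$ (0, j)) m) ^ q))"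
      unfolding sum_distrib_left sum_distrib_right
      by (subst sum.swap) (simp add: power_mult_distrib ac_simps)
    also have "\<dots> = (\<Sum>l<N. \<Phi> $$ (i, l) * (\<Sum>j<N. tw m $$ (l, j) * coeff (v $$ (0, j)) m) ^ q)"
      using frob_sum[of _ "{..<N}" 1] by simp
    also have "\<dots> = coeff (\<Sum>l<N. Polynomial.smult (\<Phi> $$ (i, l)) (tau_poly q (H v l))) k"
      by (simp add: coeff_sum coeff_tau coeff_H Suc)
    finally show ?thesis .
  qed
qed

lemma H_inv_H:
  assumes v: "v \<in> carrier_mat 1 N"
  shows "H_inv (H v) = v"
proof (rule eq_matI)
  fix i j assume "i < dim_row v" "j < dim_col v"
  then have ij: "i = 0" "j < N" using v by auto
  have "coeff (H_inv (H v) $$ (0, j)) k = coeff (v $$ (0, j)) k" for k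
  proof -
    have "coeff (H_inv (H v) $$ (0, j)) k = (\<Sum>i<N. untw k $$ (i, j) * (\<Sum>l<N. tw k $$ (i, l) * coeff (v $$ (0, l)) k))"
      using ij by (simp add: H_inv_def coeff_sum coeff_H)
    also have "\<dots> = (\<Sum>l<N. (\<Sum>i<N. tw k $$ (i, l) * untw k $$ (i, j)) * coeff (v $$ (0, l)) k)"
      unfolding sum_distrib_left sum_distrib_right by (subst sum.swap) (simp add: ac_simps)
    also have "\<dots> = (\<Sum>l<N. (transpose_mat (tw k) * untw k) $$ (l, j) * coeff (v $$ (0, l)) k)"
      using ij by (intro sum.cong HOL.refl arg_cong2[of _ _ _ _ "(*)"]) (simp add: scalar_prod_def lessThan_atLeast0)
    also have "\<dots> = (\<Sum>l<N. if l = j then coeff (v $$ (0, l)) k else 0)"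
      unfolding tw_untw using ij by (intro sum.cong) auto
    finally show ?thesis using ij by simp
  qed
  then show "H_inv (H v) $$ (i, j) = v $$ (i, j)" using ij by (simp add: poly_eq_iff)
qed (use v in \<open>auto simp: H_inv_def\<close>)

lemma H_H_inv:
  assumes h: "h \<in> coord_space N S"
  shows "H (H_inv h) = h"
proof
  fix i
  show "H (H_inv h) i = h i"
  proof (cases "i < N")
    case i: True
    have "coeff (H (H_inv h) i) k = coeff (h i) k" for k
    proof -
      have "coeff (H (H_inv h) i) k = (\<Sum>j<N. tw k $$ (i, j) * (\<Sum>l<N. untw k $$ (l, j) * coeff (h l) k))"
        using i by (simp add: H_inv_def coeff_sum coeff_H)
      also have "\<dots> = (\<Sum>l<N. (\<Sum>j<N. untw k $$ (l, j) * tw k $$ (i, j)) * coeff (h l) k)"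
        unfolding sum_distrib_left sum_distrib_right by (subst sum.swap) (simp add: ac_simps)
      also have "\<dots> = (\<Sum>l<N. (untw k * transpose_mat (tw k)) $$ (l, i) * coeff (h l) k)"
        using i by (intro sum.cong HOL.refl arg_cong2[of _ _ _ _ "(*)"]) (subst mult_transpose_index, auto)
      also have "\<dots> = (\<Sum>l<N. if l = i then coeff (h l) k else 0)"
        unfolding untw_tw using i by (intro sum.cong) auto
      finally show ?thesis using i by simp
    qed
    then show ?thesis by (simp add: poly_eq_iff)
  qed (use coord_space_outside[OF h] in \<open>simp add: H_outside\<close>)
qed

lemma coeff_scale_over: "(\<And>k. c k \<in> E) \<Longrightarrow> f \<in> polys_over E \<Longrightarrow> coeff_scale c f \<in> polys_over E"
  using subfld.mult[OF E] by (auto simp: polys_over_def)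

lemma H_over: "v \<in> mats_over 1 N (polys_over E) \<Longrightarrow> H v \<in> coord_space N (polys_over E)"
  using tw_over by (intro coord_spaceI)
    (auto simp: H_def mats_over_iff intro!: subfld.polys_sum[OF E] coeff_scale_over)

lemma H_inv_over: "h \<in> coord_space N (polys_over E) \<Longrightarrow> H_inv h \<in> mats_over 1 N (polys_over E)"
  using untw_over by (auto simp: H_inv_def mats_over_iff coord_spaceD intro!: subfld.polys_sum[OF E] coeff_scale_over)

lemma H_inj: "v \<in> carrier_mat 1 N \<Longrightarrow> w \<in> carrier_mat 1 N \<Longrightarrow> H v = H w \<Longrightarrow> v = w"
  by (metis H_inv_H)

lemma Et_over: "Et \<in> mats_over N N (polys_over E)"
  using untw_over \<phi> by (auto simp: mats_over_iff Et_def intro!: coeff_scale_over)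

lemma Et_anderson:
  assumes "N > 0"
  shows "anderson_module E (coeff \<phi> 0) N Et"
proof -
  have "map_mat (\<lambda>p. coeff p 0) Et - coeff \<phi> 0 \<cdot>\<^sub>m 1\<^sub>m N = 0\<^sub>m N N"
    by (rule eq_matI) (auto simp: Et_def untw_0)
  moreover have "(0\<^sub>m N N :: 'a mat) ^\<^sub>m N = 0\<^sub>m N N"
    using assms by (cases N) auto
  ultimately show ?thesis using Et_over by (simp add: anderson_module_def)
qed

end

lemma coeff_model_poly:
  "coeff (monom \<theta> 0 + (\<Sum>i = 1..r. monom (a i) i)) m = (if m = 0 then \<theta> else if m \<le> r then a m else 0)"
proof -
  have "coeff (\<Sum>i = 1..r. monom (a i) i) m = (\<Sum>i = 1..r. if i = m then a m else 0)"
    unfolding coeff_sum coeff_monom by (intro sum.cong) auto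
  then show ?thesis by auto
qed

lemma (in twist_data) model_t_eq:
  assumes "\<phi> = monom \<theta> 0 + (\<Sum>i = 1..r. monom (a i) i)"
  shows "model_t q N \<theta> a r (mat_inv N (transpose_mat \<Phi>)) = Et"
proof (rule eq_matI)
  fix i j assume "i < dim_row Et" "j < dim_col Et"
  then have ij: "i < N" "j < N" by (auto simp: Et_def)
  have c: "coeff \<phi> m = (if m = 0 then \<theta> else if m \<le> r then a m else 0)" for m
    unfolding assms by (rule coeff_model_poly)
  have "model_t q N \<theta> a r \<Psi> $$ (i, j) =
      monom (\<theta> * untw 0 $$ (i, j)) 0 + (\<Sum>m = 1..r. monom (a m * untw m $$ (i, j)) m)"
    using ij \<Psi>(3) carrier_matD[OF untw_carrier] by (simp add: model_t_def untw_def)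
  also have "\<dots> = Et $$ (i, j)"
    using ij by (intro poly_eqI) (simp only: coeff_model_poly, simp add: Et_def c)
  finally show "model_t q N \<theta> a r (mat_inv N (transpose_mat \<Phi>)) $$ (i, j) = Et $$ (i, j)" by (simp add: \<Psi>_def)
qed (auto simp: model_t_def Et_def)

section \<open>The motive of the model as an E[t]-module\<close>

lemma (in subfld) polys_cring: "cring (ring_on (polys_over K))"
proof (rule cringI)
  show "abelian_group (ring_on (polys_over K))"
  proof (rule abelian_groupI)
    fix x assume "x \<in> carrier (ring_on (polys_over K))"
    then show "\<exists>y\<in>carrier (ring_on (polys_over K)). y \<oplus>\<^bsub>ring_on (polys_over K)\<^esub> x = \<zero>\<^bsub>ring_on (polys_over K)\<^esub>"
      by (intro bexI[of _ "- x"]) (auto simp: ring_of_type_algebra_def)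
  qed (auto simp: ring_of_type_algebra_def algebra_simps)
  show "comm_monoid (ring_on (polys_over K))"
    by unfold_locales (auto simp: ring_of_type_algebra_def algebra_simps)
qed (auto simp: ring_of_type_algebra_def algebra_simps)

context twist_data
begin

abbreviation "ME \<equiv> anderson_motive q E N Et"
abbreviation "RE \<equiv> ring_on (polys_over E)"

lemma motive_simps:
  "carrier ME = mats_over 1 N (polys_over E)" "\<zero>\<^bsub>ME\<^esub> = 0\<^sub>m 1 N" "v \<oplus>\<^bsub>ME\<^esub> w = v + w"
  "tau ME = map_mat (skew_mult q (monom 1 1))"
  by (simp_all add: anderson_motive_def)

lemma ring_simps: "carrier RE = polys_over E" "\<zero>\<^bsub>RE\<^esub> = 0" "\<one>\<^bsub>RE\<^esub> = 1"
  "x \<oplus>\<^bsub>RE\<^esub> y = x + y" "x \<otimes>\<^bsub>RE\<^esub> y = x * y"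
  "x \<oplus>\<^bsub>ring_of_type_algebra\<^esub> y = x + (y :: 'a poly)" "x \<otimes>\<^bsub>ring_of_type_algebra\<^esub> y = x * (y :: 'a poly)"
  by (simp_all add: ring_of_type_algebra_def)

lemma smult_carrier: "p \<odot>\<^bsub>ME\<^esub> v \<in> carrier_mat 1 N"
  by (simp add: anderson_motive_def)

lemma H_bij: "bij_betw H (mats_over 1 N (polys_over E)) (coord_space N (polys_over E))"
  by (rule bij_betwI[of _ _ _ H_inv])
     (use H_over H_inv_over H_inv_H[OF mats_over_carrier] H_H_inv in auto)

lemma smult_over:
  assumes "p \<in> polys_over E" "v \<in> mats_over 1 N (polys_over E)"
  shows "p \<odot>\<^bsub>ME\<^esub> v \<in> mats_over 1 N (polys_over E)"
proof -
  have "H (p \<odot>\<^bsub>ME\<^esub> v) \<in> coord_space N (polys_over E)"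
    using H_over[OF assms(2)] skew_act_closed[OF E assms(1) _ \<phi>]
    by (intro coord_spaceI) (auto simp: H_smult[OF mats_over_carrier[OF assms(2)]] coord_spaceD coord_space_outside)
  then show ?thesis using H_inv_over H_inv_H[OF smult_carrier] by metis
qed

text \<open>\<open>H\<close> is injective, additive and turns scalar multiplication into
  \<open>skew_act\<close> in every coordinate, so the axioms involving scalars are pulled back from
  E[\<tau>].\<close>

lemma motive_module: "module RE ME"
proof (rule module_criteria)
  let ?C = "mats_over 1 N (polys_over E)"
  have eqI: "v = w" if "v \<in> carrier_mat 1 N" "w \<in> carrier_mat 1 N" "\<And>i. H v i = H w i" for v w
    using H_inj[OF that(1,2)] that(3) by auto
  have car: "v \<in> carrier_mat 1 N" if "v \<in> ?C" for v using that by (rule mats_over_carrier)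
  show "cring RE" by (rule subfld.polys_cring[OF E])
  show "\<zero>\<^bsub>ME\<^esub> \<in> carrier ME" using subfld.polys_zero[OF E] by (auto simp: motive_simps mats_over_iff)
  have add: "v + w \<in> ?C" if "v \<in> ?C" "w \<in> ?C" for v w
    using that subfld.polys_add[OF E] by (auto simp: mats_over_iff)
  show "\<forall>v w. v \<in> carrier ME \<and> w \<in> carrier ME \<longrightarrow> v \<oplus>\<^bsub>ME\<^esub> w \<in> carrier ME"
    using add by (simp add: motive_simps)
  show "\<forall>v\<in>carrier ME. \<exists>w\<in>carrier ME. v \<oplus>\<^bsub>ME\<^esub> w = \<zero>\<^bsub>ME\<^esub>"
  proof
    fix v assume v: "v \<in> carrier ME"
    show "\<exists>w\<in>carrier ME. v \<oplus>\<^bsub>ME\<^esub> w = \<zero>\<^bsub>ME\<^esub>"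
      by (rule bexI[of _ "- v"]) (use v subfld.polys_minus[OF E] in \<open>auto simp: motive_simps mats_over_iff intro!: eq_matI\<close>)
  qed
  show "\<forall>c v. c \<in> carrier RE \<and> v \<in> carrier ME \<longrightarrow> c \<odot>\<^bsub>ME\<^esub> v \<in> carrier ME"
    using smult_over by (simp add: motive_simps ring_simps)
  show "\<forall>v w. v \<in> carrier ME \<and> w \<in> carrier ME \<longrightarrow> v \<oplus>\<^bsub>ME\<^esub> w = w \<oplus>\<^bsub>ME\<^esub> v"
    using comm_add_mat[OF car car] by (simp add: motive_simps del: One_nat_def)
  show "\<forall>v w x. v \<in> carrier ME \<and> w \<in> carrier ME \<and> x \<in> carrier ME \<longrightarrow>
      (v \<oplus>\<^bsub>ME\<^esub> w) \<oplus>\<^bsub>ME\<^esub> x = v \<oplus>\<^bsub>ME\<^esub> (w \<oplus>\<^bsub>ME\<^esub> x)"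
    using assoc_add_mat[OF car car car] by (simp add: motive_simps del: One_nat_def)
  show "\<forall>v\<in>carrier ME. v \<oplus>\<^bsub>ME\<^esub> \<zero>\<^bsub>ME\<^esub> = v" using car by (auto simp: motive_simps)
  show "\<forall>a b v. a \<in> carrier RE \<and> b \<in> carrier RE \<and> v \<in> carrier ME \<longrightarrow>
      (a \<otimes>\<^bsub>RE\<^esub> b) \<odot>\<^bsub>ME\<^esub> v = a \<odot>\<^bsub>ME\<^esub> (b \<odot>\<^bsub>ME\<^esub> v)"
    using car smult_carrier by (auto simp: motive_simps ring_simps H_smult skew_act_mult intro!: eqI)
  show "\<forall>v\<in>carrier ME. \<one>\<^bsub>RE\<^esub> \<odot>\<^bsub>ME\<^esub> v = v"
    using car smult_carrier by (auto simp: motive_simps ring_simps H_smult intro!: eqI)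
  show "\<forall>a b v. a \<in> carrier RE \<and> b \<in> carrier RE \<and> v \<in> carrier ME \<longrightarrow>
      (a \<oplus>\<^bsub>RE\<^esub> b) \<odot>\<^bsub>ME\<^esub> v = (a \<odot>\<^bsub>ME\<^esub> v) \<oplus>\<^bsub>ME\<^esub> (b \<odot>\<^bsub>ME\<^esub> v)"
    using car smult_carrier by (auto simp: motive_simps ring_simps H_smult H_add skew_act_add_left intro!: eqI)
  show "\<forall>a v w. a \<in> carrier RE \<and> v \<in> carrier ME \<and> w \<in> carrier ME \<longrightarrow>
      a \<odot>\<^bsub>ME\<^esub> (v \<oplus>\<^bsub>ME\<^esub> w) = (a \<odot>\<^bsub>ME\<^esub> v) \<oplus>\<^bsub>ME\<^esub> (a \<odot>\<^bsub>ME\<^esub> w)"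
    using car smult_carrier by (auto simp: motive_simps ring_simps H_smult H_add skew_act_add_right intro!: eqI)
qed

end

section \<open>The motive of a Drinfeld module is free\<close>

context finite_subfld
begin

lemma skew_mult_degree:
  assumes f: "f \<noteq> 0" and \<phi>: "(\<phi> :: 'a poly) \<noteq> 0"
  shows "degree (skew_mult q f \<phi>) = degree f + degree \<phi>" "skew_mult q f \<phi> \<noteq> 0"
proof -
  let ?n = "degree f + degree \<phi>"
  have "coeff (skew_mult q f \<phi>) ?n = (\<Sum>i\<le>?n. if i = degree f then lead_coeff f * lead_coeff \<phi> ^ q ^ degree f else 0)"
    unfolding coeff_skew_mult
  proof (rule sum.cong[OF HOL.refl])
    fix i
    show "coeff f i * coeff \<phi> (?n - i) ^ q ^ i = (if i = degree f then lead_coeff f * lead_coeff \<phi> ^ q ^ degree f else 0)"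
    proof (cases i "degree f" rule: linorder_cases)
      case less
      then have "coeff \<phi> (?n - i) = 0" by (intro coeff_eq_0) simp
      then show ?thesis using less by simp
    qed (auto simp: coeff_eq_0)
  qed
  then have lc: "coeff (skew_mult q f \<phi>) ?n \<noteq> 0" using f \<phi> by simp
  then show "skew_mult q f \<phi> \<noteq> 0" by auto
  have "degree (skew_mult q f \<phi>) \<le> ?n"
  proof (rule degree_le, intro allI impI)
    fix k assume k: "?n < k"
    have "coeff f i * coeff \<phi> (k - i) ^ q ^ i = 0" if "i \<le> k" for i
      using k by (cases "i \<le> degree f") (auto simp: coeff_eq_0)
    then show "coeff (skew_mult q f \<phi>) k = 0" unfolding coeff_skew_mult by (intro sum.neutral) auto
  qed
  then show "degree (skew_mult q f \<phi>) = ?n" using le_degree[OF lc] by simp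
qed

text \<open>Each factor t raises the degree by the positive degree of \<phi>, so the leading
  coefficient of p contributes the top term and the lower ones cannot cancel it.\<close>

lemma skew_act_degree:
  assumes "p \<noteq> 0" "f \<noteq> 0" "degree (\<phi> :: 'a poly) > 0"
  shows "degree (skew_act q \<phi> p f) = degree f + degree \<phi> * degree p \<and> skew_act q \<phi> p f \<noteq> 0"
  using assms(1,2)
proof (induction p arbitrary: f)
  case (pCons c p)
  have \<phi>: "\<phi> \<noteq> 0" using assms(3) by auto
  show ?case
  proof (cases "p = 0")
    case True
    then show ?thesis using pCons by (simp add: skew_act_pCons)
  next
    case False
    note sk = skew_mult_degree[OF pCons.prems(2) \<phi>]
    have IH: "degree (skew_act q \<phi> p (skew_mult q f \<phi>)) = degree f + degree \<phi> + degree \<phi> * degree p"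
      using pCons.IH[OF False sk(2)] sk(1) by simp
    have "degree (Polynomial.smult c f) < degree (skew_act q \<phi> p (skew_mult q f \<phi>))"
      using degree_smult_le[of c f] assms(3) unfolding IH by linarith
    then have "degree (skew_act q \<phi> (pCons c p) f) = degree (skew_act q \<phi> p (skew_mult q f \<phi>))"
      unfolding skew_act_pCons by (rule degree_add_eq_right)
    then have "degree (skew_act q \<phi> (pCons c p) f) = degree f + degree \<phi> * degree (pCons c p)"
      using IH False by (simp add: algebra_simps)
    moreover from this have "degree (skew_act q \<phi> (pCons c p) f) > 0" using assms(3) False by simp
    then have "skew_act q \<phi> (pCons c p) f \<noteq> 0" by auto
    ultimately show ?thesis by blast
  qed
qed simp

text \<open>The degrees \<open>k + r * degree (p k)\<close> of the nonzero terms lie in different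
  residue classes mod r, so the term of largest degree cannot be cancelled.\<close>

lemma skew_act_independent:
  assumes \<phi>: "degree (\<phi> :: 'a poly) = r" "r > 0"
    and s: "(\<Sum>k<r. skew_act q \<phi> (p k) (monom 1 k)) = 0" and k: "k < r"
  shows "p k = 0"
proof (rule ccontr)
  assume "p k \<noteq> 0"
  define S where "S = {k. k < r \<and> p k \<noteq> 0}"
  have S: "finite S" "S \<noteq> {}" using k \<open>p k \<noteq> 0\<close> by (auto simp: S_def)
  define D where "D k = k + r * degree (p k)" for k
  have deg: "degree (skew_act q \<phi> (p k) (monom 1 k)) = D k" "skew_act q \<phi> (p k) (monom 1 k) \<noteq> 0" if "k \<in> S" for k
    using skew_act_degree[of "p k" "monom 1 k" \<phi>] that \<phi> by (auto simp: S_def D_def degree_monom_eq)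
  obtain m where m: "m \<in> S" "\<And>k. k \<in> S \<Longrightarrow> D k \<le> D m"
  proof -
    have "Max (D ` S) \<in> D ` S" using S by (intro Max_in) auto
    then obtain m where "m \<in> S" "D m = Max (D ` S)" by auto
    then show thesis using S by (intro that[of m]) auto
  qed
  have coeff0: "coeff (skew_act q \<phi> (p k) (monom 1 k)) (D m) = 0" if "k < r" "k \<noteq> m" for k
  proof (cases "k \<in> S")
    case True
    have "D k mod r = k" "D m mod r = m" using that m by (auto simp: D_def S_def)
    then have "D k \<noteq> D m" using that by metis
    then have "D k < D m" using m(2)[OF True] by simp
    then show ?thesis using deg(1)[OF True] by (simp add: coeff_eq_0)
  qed (use that in \<open>simp add: S_def\<close>)
  have "0 = (\<Sum>k<r. coeff (skew_act q \<phi> (p k) (monom 1 k)) (D m))"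
    using arg_cong[OF s, of "\<lambda>f. coeff f (D m)"] by (simp add: coeff_sum)
  also have "\<dots> = coeff (skew_act q \<phi> (p m) (monom 1 m)) (D m)"
    using m(1) coeff0 by (subst sum.remove[of _ m]) (auto simp: S_def intro!: sum.neutral)
  finally show False using deg[OF m(1)] by (metis leading_coeff_0_iff)
qed

text \<open>Writing the degree of f as l + r m with l < r, the element t^m \<tau>^l has the same
  degree, and a scalar multiple of it removes the leading term of f.\<close>

lemma skew_act_spanning:
  assumes E: "subfld E" and \<phi>: "degree (\<phi> :: 'a poly) = r" "r > 0" "\<phi> \<in> polys_over E" and f: "f \<in> polys_over E"
  shows "\<exists>p. (\<forall>k<r. p k \<in> polys_over E) \<and> f = (\<Sum>k<r. skew_act q \<phi> (p k) (monom 1 k))"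
  using f
proof (induction "degree f" arbitrary: f rule: less_induct)
  case less
  interpret E: subfld E by fact
  show ?case
  proof (cases "f = 0")
    case True
    then show ?thesis by (intro exI[of _ "\<lambda>_. 0"]) auto
  next
    case False
    define D where "D = degree f"
    define m where "m = D div r"
    define l where "l = D mod r"
    have l: "l < r" "D = l + r * m" using \<phi> by (auto simp: l_def m_def)
    define g where "g = skew_act q \<phi> (monom 1 m) (monom 1 l)"
    have g: "degree g = D" "g \<noteq> 0"
      using skew_act_degree[of "monom 1 m" "monom 1 l" \<phi>] \<phi> l by (auto simp: g_def degree_monom_eq)
    have gE: "g \<in> polys_over E" unfolding g_def using \<phi> E by (intro skew_act_closed) auto
    define c where "c = lead_coeff f / lead_coeff g"
    have cE: "c \<in> E" unfolding c_def using less.prems gE by (intro E.divide) (auto simp: polys_over_def)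
    define f' where "f' = f - Polynomial.smult c g"
    have f'E: "f' \<in> polys_over E" unfolding f'_def using less.prems gE cE by auto
    have act: "Polynomial.smult c g = skew_act q \<phi> (monom c m) (monom 1 l)"
      unfolding g_def skew_act_smult_left[symmetric] by (simp add: smult_monom)
    have "f' = 0 \<or> degree f' < D"
    proof (rule eq_zero_or_degree_less)
      show "degree f' \<le> D" unfolding f'_def using g
        by (intro degree_diff_le) (auto simp: D_def intro: order_trans[OF degree_smult_le])
      have "coeff g D \<noteq> 0" using g by (metis leading_coeff_0_iff)
      then show "coeff f' D = 0" using g by (simp add: f'_def c_def D_def)
    qed
    then have "\<exists>p. (\<forall>k<r. p k \<in> polys_over E) \<and> f' = (\<Sum>k<r. skew_act q \<phi> (p k) (monom 1 k))"
    proof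
      assume "f' = 0"
      then show ?thesis by (intro exI[of _ "\<lambda>_. 0"]) auto
    qed (use less.hyps f'E D_def in blast)
    then obtain p where p: "\<And>k. k < r \<Longrightarrow> p k \<in> polys_over E" "f' = (\<Sum>k<r. skew_act q \<phi> (p k) (monom 1 k))"
      by blast
    define p' where "p' k = (if k = l then p l + monom c m else p k)" for k
    have "(\<Sum>k<r. skew_act q \<phi> (p' k) (monom 1 k)) =
        (\<Sum>k<r. skew_act q \<phi> (p k) (monom 1 k) + (if k = l then Polynomial.smult c g else 0))"
      by (rule sum.cong[OF HOL.refl]) (auto simp: p'_def skew_act_add_left act)
    also have "\<dots> = f' + Polynomial.smult c g" using l by (simp add: sum.distrib p(2))
    finally have "f = (\<Sum>k<r. skew_act q \<phi> (p' k) (monom 1 k))" by (simp add: f'_def)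
    moreover have "\<forall>k<r. p' k \<in> polys_over E" using p(1) cE by (auto simp: p'_def)
    ultimately show ?thesis by blast
  qed
qed

end

context twist_data
begin

lemma lincomb_H:
  assumes "finite A" "A \<subseteq> carrier ME" "a \<in> A \<rightarrow> polys_over E"
  shows "H (module.lincomb ME a A) j = (\<Sum>v\<in>A. skew_act q \<phi> (a v) (H v j)) \<and> module.lincomb ME a A \<in> carrier_mat 1 N"
proof -
  interpret M: module RE ME by (rule motive_module)
  show ?thesis
    using assms
  proof (induction A rule: finite_induct)
    case empty
    have "M.lincomb a {} = 0\<^sub>m 1 N" by (simp add: M.lincomb_def motive_simps)
    then show ?case by (simp add: H_zero del: One_nat_def)
  next
    case (insert v A)
    have v: "v \<in> carrier_mat 1 N" using insert.prems mats_over_carrier by (auto simp: motive_simps)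
    have "M.lincomb a (insert v A) = a v \<odot>\<^bsub>ME\<^esub> v \<oplus>\<^bsub>ME\<^esub> M.lincomb a A"
      unfolding M.lincomb_def using insert smult_over
      by (intro M.finsum_insert) (auto simp: motive_simps Pi_def)
    then show ?case using insert v smult_carrier by (auto simp: motive_simps H_add H_smult)
  qed
qed

text \<open>Under \<open>H\<close> the basis corresponds to the elements \<open>\<tau>\<^sup>k e\<^sub>i\<close> with \<open>k < r\<close>.\<close>

lemma abelian:
  assumes r: "degree \<phi> = r" "r > 0"
  shows "abelian_module q E N Et"
proof -
  interpret M: module RE ME by (rule motive_module)
  define e :: "nat \<times> nat \<Rightarrow> nat \<Rightarrow> 'a poly" where "e = (\<lambda>(k, i) j. if j = i then monom 1 k else 0)"
  define b where "b x = H_inv (e x)" for x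
  define I where "I = {..<r} \<times> {..<N}"
  define B where "B = b ` I"
  have e: "e x \<in> coord_space N (polys_over E)" if "x \<in> I" for x
    using that subfld.polys_monom[OF E] subfld.polys_zero[OF E] subfld.one[OF E]
    by (auto simp: e_def I_def intro!: coord_spaceI)
  have Hb: "H (b x) = e x" if "x \<in> I" for x using e[OF that] by (simp add: b_def H_H_inv)
  have bM: "b x \<in> carrier ME" if "x \<in> I" for x using e[OF that] by (simp add: b_def H_inv_over motive_simps del: One_nat_def)
  have inj: "inj_on b I"
  proof (rule inj_onI)
    fix x y assume xy: "x \<in> I" "y \<in> I" "b x = b y"
    then have "e x = e y" using Hb by metis
    then have "e x (snd x) = e y (snd x)" by simp
    then show "x = y" by (auto simp: e_def split_beta monom_eq_iff' prod_eq_iff split: if_splits)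
  qed
  have fin: "finite B" and BM: "B \<subseteq> carrier ME" using bM by (auto simp: B_def I_def)
  have sumB: "(\<Sum>v\<in>B. skew_act q \<phi> (a v) (H v j)) = (\<Sum>k<r. skew_act q \<phi> (a (b (k, j))) (monom 1 k))"
    if j: "j < N" for a j
  proof -
    have "(\<Sum>v\<in>B. skew_act q \<phi> (a v) (H v j)) = (\<Sum>x\<in>I. skew_act q \<phi> (a (b x)) (e x j))"
      unfolding B_def using inj by (subst sum.reindex) (auto simp: Hb)
    also have "\<dots> = (\<Sum>k<r. \<Sum>i<N. skew_act q \<phi> (a (b (k, i))) (e (k, i) j))"
      unfolding I_def by (simp add: sum.cartesian_product)
    also have "\<dots> = (\<Sum>k<r. \<Sum>i<N. if i = j then skew_act q \<phi> (a (b (k, j))) (monom 1 k) else 0)"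
      by (rule sum.cong[OF HOL.refl], rule sum.cong[OF HOL.refl]) (auto simp: e_def)
    finally show ?thesis using j by simp
  qed
  have indep: "M.lin_indpt B"
    unfolding M.lin_dep_def
  proof (intro notI, elim exE conjE)
    fix A a v assume A: "finite A" "A \<subseteq> B" "a \<in> A \<rightarrow> carrier RE" "M.lincomb a A = \<zero>\<^bsub>ME\<^esub>" "v \<in> A" "a v \<noteq> \<zero>\<^bsub>RE\<^esub>"
    \<comment> \<open>Dependence is stated for a subset A of the basis; extended by zero, its
      coefficients can be summed over all of B.\<close>
    define a' where "a' w = (if w \<in> A then a w else 0)" for w
    have z: "a' (b (k, j)) = 0" if "k < r" "j < N" for k j
    proof -
      have "(\<Sum>v\<in>B. skew_act q \<phi> (a' v) (H v j)) = (\<Sum>v\<in>A. skew_act q \<phi> (a' v) (H v j))"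
        using A fin by (intro sum.mono_neutral_right) (auto simp: a'_def)
      also have "\<dots> = (\<Sum>v\<in>A. skew_act q \<phi> (a v) (H v j))" by (simp add: a'_def)
      also have "\<dots> = H (M.lincomb a A) j" using lincomb_H[OF A(1), of a j] A BM by (auto simp: ring_simps)
      also have "\<dots> = 0" unfolding A(4) motive_simps by (simp add: H_zero del: One_nat_def)
      finally have "(\<Sum>k<r. skew_act q \<phi> (a' (b (k, j))) (monom 1 k)) = 0" using sumB[OF that(2)] by simp
      from skew_act_independent[OF r this that(1)] show ?thesis .
    qed
    obtain k i where "v = b (k, i)" "k < r" "i < N" using A by (auto simp: B_def I_def)
    then show False using z[of k i] A by (auto simp: a'_def ring_simps)
  qed
  have gen: "M.gen_set B"
  proof
    show "M.span B \<subseteq> carrier ME" by (rule M.span_is_subset2[OF BM])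
    show "carrier ME \<subseteq> M.span B"
    proof
      fix v assume v: "v \<in> carrier ME"
      have "\<forall>j\<in>{..<N}. \<exists>p. (\<forall>k<r. p k \<in> polys_over E) \<and> H v j = (\<Sum>k<r. skew_act q \<phi> (p k) (monom 1 k))"
        using coord_spaceD[OF H_over] v by (auto intro!: skew_act_spanning[OF E r \<phi>] simp: motive_simps)
      then obtain p where p: "\<And>j k. j < N \<Longrightarrow> k < r \<Longrightarrow> p j k \<in> polys_over E"
        "\<And>j. j < N \<Longrightarrow> H v j = (\<Sum>k<r. skew_act q \<phi> (p j k) (monom 1 k))"
        unfolding bchoice_iff by blast
      define a where "a w = (let x = the_inv_into I b w in p (snd x) (fst x))" for w
      have a: "a (b (k, j)) = p j k" if "k < r" "j < N" for k j
        using the_inv_into_f_f[OF inj, of "(k, j)"] that by (simp add: a_def I_def)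
      have aB: "a \<in> B \<rightarrow> polys_over E" using a p by (auto simp: B_def I_def)
      have "H (M.lincomb a B) j = H v j" for j
      proof (cases "j < N")
        case True
        have "H (M.lincomb a B) j = (\<Sum>k<r. skew_act q \<phi> (a (b (k, j))) (monom 1 k))"
          using lincomb_H[OF fin BM aB, of j] sumB[OF True] by simp
        then show ?thesis using True by (simp add: a p)
      qed (simp add: H_outside)
      then have "M.lincomb a B = v"
        using lincomb_H[OF fin BM aB] v mats_over_carrier by (intro H_inj) (auto simp: motive_simps)
      then show "v \<in> M.span B"
        unfolding M.span_def using fin aB by (auto simp: ring_simps)
    qed
  qed
  show ?thesis unfolding abelian_module_def Let_def using fin BM indep gen by blast
qed

end

section \<open>Invariants of the Galois representation\<close>

lemma mult_mat_index_sum: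
  "A \<in> carrier_mat m n \<Longrightarrow> B \<in> carrier_mat n l \<Longrightarrow> i < m \<Longrightarrow> j < l \<Longrightarrow>
    (A * B) $$ (i, j) = (\<Sum>k<n. A $$ (i, k) * B $$ (k, j))"
  by (auto simp: scalar_prod_def lessThan_atLeast0)

lemma mult_vec_index_sum:
  "A \<in> carrier_mat m n \<Longrightarrow> v \<in> carrier_vec n \<Longrightarrow> i < m \<Longrightarrow> (A *\<^sub>v v) $ i = (\<Sum>k<n. A $$ (i, k) * v $ k)"
  by (auto simp: scalar_prod_def lessThan_atLeast0)

text \<open>Regroups K = i + n k, the column by column numbering of \<open>vectorize\<close>, into a
  double sum.\<close>

lemma sum_mod_div:
  fixes f :: "nat \<Rightarrow> nat \<Rightarrow> 'b::comm_monoid_add"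
  shows "(\<Sum>K<n * d. f (K mod n) (K div n)) = (\<Sum>k<d. \<Sum>i<n. f i k)"
proof -
  have "(\<Sum>K<n * d. f (K mod n) (K div n)) = (\<Sum>k<d. \<Sum>K = k * n..<k * n + n. f (K mod n) (K div n))"
    by (simp add: sum.nat_group mult.commute)
  also have "\<dots> = (\<Sum>k<d. \<Sum>i<n. f i k)"
  proof (rule sum.cong[OF HOL.refl])
    fix k
    have "(\<Sum>K = k * n..<k * n + n. f (K mod n) (K div n)) = (\<Sum>i = 0..<n. f ((i + k * n) mod n) ((i + k * n) div n))"
      using sum.shift_bounds_nat_ivl[of "\<lambda>K. f (K mod n) (K div n)" 0 "k * n" n] by (simp add: add.commute)
    also have "\<dots> = (\<Sum>i<n. f i k)"
      unfolding lessThan_atLeast0 by (rule sum.cong) auto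
    finally show "(\<Sum>K = k * n..<k * n + n. f (K mod n) (K div n)) = (\<Sum>i<n. f i k)" .
  qed
  finally show ?thesis .
qed

text \<open>\<open>sol\<close> is the equation in \<open>Sol\<close> multiplied by the conjugate of
  \<rho>(g), so that no inverse matrix occurs; independence and span are explicit sums.\<close>

locale artin_data = finite_subfld F q for F :: "'a::alg_closed_field set" and q +
  fixes E :: "'a set" and n d :: nat and \<rho> :: "('a \<Rightarrow> 'a) \<Rightarrow> 'a mat" and \<alpha> :: "'a vec" and u :: "'a mat"
  assumes E: "subfld E" and FE: "F \<subseteq> E"
    and L: "subfld (coefficient_field F E \<rho>)" and FL: "F \<subseteq> coefficient_field F E \<rho>"
    and \<rho>: "g \<in> carrier (gal_group E) \<Longrightarrow> \<rho> g \<in> mats_over n n (coefficient_field F E \<rho>)"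
    and \<alpha>: "\<alpha> \<in> carrier_vec d" "lin_indep F \<alpha>"
    and span: "coefficient_field F E \<rho> = {\<Sum>k<d. c k * \<alpha> $ k | c. \<forall>k<d. c k \<in> F}"
    and u: "u \<in> mats_over n d (sep_closure E)" "lin_indep F (vectorize u)"
    and sol: "g \<in> carrier (gal_group E) \<Longrightarrow> l < d \<Longrightarrow>
      frob_mat q l (\<rho> g) *\<^sub>v (map_mat g u *\<^sub>v frob_vec q l \<alpha>) = u *\<^sub>v frob_vec q l \<alpha>"
    and n: "n \<ge> 1"
begin

abbreviation "S \<equiv> sep_closure E"
abbreviation "L \<equiv> coefficient_field F E \<rho>"
abbreviation "G \<equiv> carrier (gal_group E)"
abbreviation "N \<equiv> n * d"

lemma S: "subfld S" and ES: "E \<subseteq> S"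
  using sep_closure_subfld[OF E frob_inj of_nat_q] by auto

lemma G_fhom: "g \<in> G \<Longrightarrow> fhom S g"
  using S unfolding gal_group_carrier by (intro fhom.intro fhom_axioms.intro) auto

lemma G_closed: "g \<in> G \<Longrightarrow> x \<in> S \<Longrightarrow> g x \<in> S"
  unfolding gal_group_carrier by (auto dest: bij_betwE)

lemma G_E: "g \<in> G \<Longrightarrow> x \<in> E \<Longrightarrow> g x = x"
  unfolding gal_group_carrier by auto

lemma G_F: "g \<in> G \<Longrightarrow> x \<in> F \<Longrightarrow> g x = x"
  using G_E FE by auto

lemma FS: "x \<in> F \<Longrightarrow> x \<in> S"
  using FE ES by auto

lemma G_fixed: "x \<in> S \<Longrightarrow> (\<And>g. g \<in> G \<Longrightarrow> g x = x) \<Longrightarrow> x \<in> E"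
  using gal_group_fixed[OF E S ES] by blast

lemma d_pos: "d > 0"
proof (rule ccontr)
  assume "\<not> d > 0"
  moreover have "1 \<in> L" using L by (rule subfld.one)
  ultimately show False unfolding span by auto
qed

lemma N_pos: "N > 0"
  using n d_pos by simp

lemma N_bounds: "K < N \<Longrightarrow> K mod n < n" "K < N \<Longrightarrow> K div n < d"
  using n by (auto simp: less_mult_imp_div_less mult.commute)

section \<open>Coordinates over F on the coefficient field and on its vectors\<close>

definition ca :: "'a \<Rightarrow> nat \<Rightarrow> 'a" where
  "ca y = (SOME c. (\<forall>k<d. c k \<in> F) \<and> y = (\<Sum>k<d. c k * \<alpha> $ k))"

lemma ca: assumes "y \<in> L" shows "k < d \<Longrightarrow> ca y k \<in> F" "(\<Sum>k<d. ca y k * \<alpha> $ k) = y"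
proof -
  have "\<exists>c. (\<forall>k<d. c k \<in> F) \<and> y = (\<Sum>k<d. c k * \<alpha> $ k)" using assms unfolding span by blast
  from someI_ex[OF this] show "k < d \<Longrightarrow> ca y k \<in> F" "(\<Sum>k<d. ca y k * \<alpha> $ k) = y"
    by (auto simp: ca_def)
qed

lemma ca_unique:
  assumes "\<And>k. k < d \<Longrightarrow> c k \<in> F" "y = (\<Sum>k<d. c k * \<alpha> $ k)" "k < d"
  shows "ca y k = c k"
proof -
  have y: "y \<in> L" unfolding span using assms by blast
  have "(\<Sum>k<d. (ca y k - c k) * \<alpha> $ k) = 0"
    using ca(2)[OF y] assms(2) by (simp add: left_diff_distrib sum_subtractf)
  then have "ca y k - c k = 0"
    using \<alpha>(2)[unfolded lin_indep_def, rule_format, of "\<lambda>k. ca y k - c k" k] \<alpha>(1) assms ca(1)[OF y] by auto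
  then show ?thesis by simp
qed

lemma ca_sum:
  assumes "\<And>i. i \<in> I \<Longrightarrow> c i \<in> F" "\<And>i. i \<in> I \<Longrightarrow> y i \<in> L" "k < d"
  shows "ca (\<Sum>i\<in>I. c i * y i) k = (\<Sum>i\<in>I. c i * ca (y i) k)"
proof (rule ca_unique[OF _ _ assms(3)])
  show "(\<Sum>i\<in>I. c i * ca (y i) k) \<in> F" if "k < d" for k using assms ca(1) that by (intro sum mult) auto
  have "(\<Sum>k<d. (\<Sum>i\<in>I. c i * ca (y i) k) * \<alpha> $ k) = (\<Sum>i\<in>I. c i * (\<Sum>k<d. ca (y i) k * \<alpha> $ k))"
    unfolding sum_distrib_left sum_distrib_right by (subst sum.swap) (simp add: ac_simps)
  also have "\<dots> = (\<Sum>i\<in>I. c i * y i)" using assms(2) ca(2) by (intro sum.cong) auto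
  finally show "(\<Sum>i\<in>I. c i * y i) = (\<Sum>k<d. (\<Sum>i\<in>I. c i * ca (y i) k) * \<alpha> $ k)" by simp
qed

lemma ca_add: "x \<in> L \<Longrightarrow> y \<in> L \<Longrightarrow> k < d \<Longrightarrow> ca (x + y) k = ca x k + ca y k"
  using ca_sum[of "{True, False}" "\<lambda>_. 1" "\<lambda>b. if b then x else y" k] by simp

lemma ca_smult: "r \<in> F \<Longrightarrow> y \<in> L \<Longrightarrow> k < d \<Longrightarrow> ca (r * y) k = r * ca y k"
  using ca_sum[of "{()}" "\<lambda>_. r" "\<lambda>_. y" k] by simp

lemma sum_delta_mult: "k < d \<Longrightarrow> (\<Sum>i<d. (if i = k then 1 else 0) * f i) = (f k :: 'a)"
  by (subst sum.cong[OF HOL.refl, of _ _ "\<lambda>i. if i = k then f i else 0"]) auto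

lemma \<alpha>_L: "k < d \<Longrightarrow> \<alpha> $ k \<in> L"
  unfolding span by (intro CollectI exI[of _ "\<lambda>i. if i = k then 1 else 0"]) (auto simp: sum_delta_mult)

lemma ca_\<alpha>: "j < d \<Longrightarrow> k < d \<Longrightarrow> ca (\<alpha> $ k) j = (if j = k then 1 else 0)"
  by (rule ca_unique) (auto simp: sum_delta_mult)

definition Vc :: "'a vec set" where "Vc = {v \<in> carrier_vec n. set\<^sub>v v \<subseteq> L}"

lemma Vc_iff: "v \<in> Vc \<longleftrightarrow> v \<in> carrier_vec n \<and> (\<forall>i<n. v $ i \<in> L)"
  by (auto simp: Vc_def vec_set_def)

lemma Vc_index: "v \<in> Vc \<Longrightarrow> i < n \<Longrightarrow> v $ i \<in> L"
  by (simp add: Vc_iff)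

text \<open>The coordinates on \<open>L\<^sup>n\<close> are numbered as in \<^const>\<open>vectorize\<close>: \<open>K = j + n k\<close> belongs to \<open>\<alpha>\<^sub>k e\<^sub>j\<close>.\<close>

definition kap :: "'a vec \<Rightarrow> nat \<Rightarrow> 'a" where
  "kap v K = ca (v $ (K mod n)) (K div n)"

definition bV :: "nat \<Rightarrow> 'a vec" where
  "bV K = vec n (\<lambda>i. if i = K mod n then \<alpha> $ (K div n) else 0)"

lemma ca_zero: "k < d \<Longrightarrow> ca 0 k = 0"
  by (rule ca_unique) auto

lemma bV_Vc: "K < N \<Longrightarrow> bV K \<in> Vc"
  using \<alpha>_L N_bounds subfld.zero[OF L] by (auto simp: Vc_iff bV_def)

lemma kap_F: "v \<in> Vc \<Longrightarrow> K < N \<Longrightarrow> kap v K \<in> F"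
  using ca(1) Vc_index N_bounds by (auto simp: kap_def)

lemma kap_bV: "J < N \<Longrightarrow> K < N \<Longrightarrow> kap (bV K) J = (if J = K then 1 else 0)"
  using N_bounds[of J] N_bounds[of K]
  by (auto simp: kap_def bV_def ca_\<alpha> ca_zero) (metis div_mult_mod_eq)

lemma kap_add: "v \<in> Vc \<Longrightarrow> w \<in> Vc \<Longrightarrow> K < N \<Longrightarrow> kap (v + w) K = kap v K + kap w K"
  using N_bounds[of K] by (auto simp: kap_def Vc_iff ca_add)

lemma kap_smult: "r \<in> F \<Longrightarrow> v \<in> Vc \<Longrightarrow> K < N \<Longrightarrow> kap (r \<cdot>\<^sub>v v) K = r * kap v K"
  using N_bounds[of K] by (auto simp: kap_def Vc_iff ca_smult)

section \<open>The tensor product of E^sep and the representation in coordinates\<close>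

abbreviation "VM \<equiv> rep_space n L"
abbreviation "SM \<equiv> scalars_as_module S"
abbreviation "RF \<equiv> ring_on F"

lemma VM_simps: "carrier VM = Vc" "\<zero>\<^bsub>VM\<^esub> = 0\<^sub>v n" "v \<oplus>\<^bsub>VM\<^esub> w = v + w" "r \<odot>\<^bsub>VM\<^esub> v = r \<cdot>\<^sub>v v"
  by (simp_all add: rep_space_def Vc_def module_vec_def)

lemma SM_simps: "carrier SM = S" "\<zero>\<^bsub>SM\<^esub> = 0" "x \<oplus>\<^bsub>SM\<^esub> y = x + y" "r \<odot>\<^bsub>SM\<^esub> x = r * x"
  by (simp_all add: scalars_as_module_def)

lemma psum_VM:
  assumes "\<And>K. K < m \<Longrightarrow> b K \<in> carrier_vec n"
  shows "psum VM b m \<in> carrier_vec n \<and> (\<forall>i<n. psum VM b m $ i = (\<Sum>K<m. b K $ i))"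
  using assms
proof (induction m)
  case (Suc m)
  then have b: "dim_vec (b m) = n" by auto
  have "psum VM b m \<in> carrier_vec n \<and> (\<forall>i<n. psum VM b m $ i = (\<Sum>K<m. b K $ i))"
    using Suc by simp
  then show ?case using b by (auto simp: VM_simps)
qed (auto simp: VM_simps)

lemma V_expand:
  assumes v: "v \<in> Vc"
  shows "psum VM (\<lambda>K. kap v K \<odot>\<^bsub>VM\<^esub> bV K) N = v"
proof (rule eq_vecI)
  have c: "kap v K \<odot>\<^bsub>VM\<^esub> bV K \<in> carrier_vec n" for K by (simp add: VM_simps bV_def)
  note ps = psum_VM[of N, OF c]
  fix i assume "i < dim_vec v"
  then have i: "i < n" using v by (auto simp: Vc_iff)
  have "psum VM (\<lambda>K. kap v K \<odot>\<^bsub>VM\<^esub> bV K) N $ i =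
      (\<Sum>K<N. (\<lambda>j k. if j = i then ca (v $ i) k * \<alpha> $ k else 0) (K mod n) (K div n))"
    using ps i by (auto simp: VM_simps kap_def bV_def intro!: sum.cong)
  also have "\<dots> = (\<Sum>k<d. \<Sum>j<n. if j = i then ca (v $ i) k * \<alpha> $ k else 0)" by (rule sum_mod_div)
  also have "\<dots> = v $ i" using i ca(2) Vc_index[OF v i] by simp
  finally show "psum VM (\<lambda>K. kap v K \<odot>\<^bsub>VM\<^esub> bV K) N $ i = v $ i" .
next
  show "dim_vec (psum VM (\<lambda>K. kap v K \<odot>\<^bsub>VM\<^esub> bV K) N) = dim_vec v"
    using psum_VM[of N "\<lambda>K. kap v K \<odot>\<^bsub>VM\<^esub> bV K"] v by (auto simp: VM_simps bV_def Vc_iff)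
qed

definition \<beta>1 :: "'a \<Rightarrow> 'a vec \<Rightarrow> nat \<Rightarrow> 'a" where
  "\<beta>1 x v K = (if K < N then x * kap v K else 0)"

lemma T1_bilinear: "tensor_bilinear RF SM VM \<beta>1"
proof
  show "\<And>r x. r \<in> carrier RF \<Longrightarrow> x \<in> carrier SM \<Longrightarrow> r \<odot>\<^bsub>SM\<^esub> x \<in> carrier SM"
    using S FS by (auto simp: SM_simps intro: subfld.mult)
  show "\<And>r v. r \<in> carrier RF \<Longrightarrow> v \<in> carrier VM \<Longrightarrow> r \<odot>\<^bsub>VM\<^esub> v \<in> carrier VM"
    using subfld.mult[OF L] FL by (auto simp: VM_simps Vc_iff)
  show "\<And>v w. v \<in> carrier VM \<Longrightarrow> w \<in> carrier VM \<Longrightarrow> v \<oplus>\<^bsub>VM\<^esub> w \<in> carrier VM"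
    using subfld.add[OF L] by (auto simp: VM_simps Vc_iff)
qed (use S in \<open>auto simp: SM_simps VM_simps \<beta>1_def kap_add kap_smult algebra_simps subfld.add subfld.zero intro!: ext\<close>)

definition nf1 :: "(nat \<Rightarrow> 'a) \<Rightarrow> ('a \<times> 'a vec) multiset" where
  "nf1 x = (\<Sum>K<N. {#(x K, bV K)#})"

lemma T1_coords: "tensor_coords RF SM VM \<beta>1 (coord_space N S) nf1"
  unfolding nf1_def
proof (rule tensor_coords_basis[OF T1_bilinear])
  interpret T: tensor_bilinear RF SM VM \<beta>1 by (rule T1_bilinear)
  show "0 \<in> S" "\<And>x y. x \<in> S \<Longrightarrow> y \<in> S \<Longrightarrow> x + y \<in> S" using S by (auto intro: subfld.zero subfld.add)
  show "\<And>K x. K < N \<Longrightarrow> x \<in> S \<Longrightarrow> (x, bV K) \<in> carrier SM \<times> carrier VM"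
    using bV_Vc by (auto simp: SM_simps VM_simps)
  show "\<And>K x y. K < N \<Longrightarrow> x \<in> S \<Longrightarrow> y \<in> S \<Longrightarrow> tensor_rel RF SM VM {#(x, bV K), (y, bV K)#} {#(x + y, bV K)#}"
    using bV_Vc tensor_rel.sym[OF tensor_rel.add_left[of _ SM _ _ VM RF]] by (simp add: SM_simps VM_simps)
  show "\<And>K. K < N \<Longrightarrow> tensor_rel RF SM VM {#} {#(0, bV K)#}"
    using bV_Vc tensor_rel.sym[OF tensor_rel.zero[of _ VM RF SM]] by (simp add: SM_simps VM_simps)
  show "\<And>K x. K < N \<Longrightarrow> x \<in> S \<Longrightarrow> (case (x, bV K) of (x, v) \<Rightarrow> \<beta>1 x v) = (\<lambda>J. if J = K then x else 0)"
    by (auto simp: \<beta>1_def kap_bV intro!: ext)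
  fix x v assume xv: "x \<in> carrier SM" "v \<in> carrier VM"
  then have xv': "x \<in> S" "v \<in> Vc" by (simp_all add: SM_simps VM_simps)
  show "\<beta>1 x v \<in> coord_space N S"
    using kap_F[OF xv'(2)] xv'(1) S FS by (intro coord_spaceI) (auto simp: \<beta>1_def intro: subfld.mult)
  have "tensor_rel RF SM VM {#(x, psum VM (\<lambda>K. kap v K \<odot>\<^bsub>VM\<^esub> bV K) N)#} (\<Sum>K<N. {#(kap v K \<odot>\<^bsub>SM\<^esub> x, bV K)#})"
  proof (rule conjunct2[OF T.pure_expand_right[OF xv(1), where z = 0]])
    show "\<zero>\<^bsub>VM\<^esub> \<in> carrier VM" using subfld.zero[OF L] by (auto simp: VM_simps Vc_iff)
  qed (use bV_Vc kap_F[OF xv'(2)] in \<open>auto simp: VM_simps SM_simps\<close>)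
  also have "(\<Sum>K<N. {#(kap v K \<odot>\<^bsub>SM\<^esub> x, bV K)#}) = (\<Sum>K<N. {#(\<beta>1 x v K, bV K)#})"
    by (rule sum.cong) (auto simp: \<beta>1_def SM_simps mult.commute)
  finally show "tensor_rel RF SM VM {#(x, v)#} (\<Sum>K<N. {#(\<beta>1 x v K, bV K)#})" by (simp add: V_expand[OF xv'(2)])
qed

sublocale T1: tensor_coords RF SM VM \<beta>1 "coord_space N S" nf1
  by (rule T1_coords)

definition Dm :: "('a \<Rightarrow> 'a) \<Rightarrow> nat \<Rightarrow> nat \<Rightarrow> 'a" where
  "Dm g J K = ca (\<rho> g $$ (J mod n, K mod n) * \<alpha> $ (K div n)) (J div n)"

lemma \<rho>\<alpha>_L: "g \<in> G \<Longrightarrow> i < n \<Longrightarrow> j < n \<Longrightarrow> k < d \<Longrightarrow> \<rho> g $$ (i, j) * \<alpha> $ k \<in> L"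
  using \<rho> \<alpha>_L L by (auto simp: mats_over_iff intro!: subfld.mult)

lemma Dm_F: "g \<in> G \<Longrightarrow> J < N \<Longrightarrow> K < N \<Longrightarrow> Dm g J K \<in> F"
  unfolding Dm_def by (intro ca(1) \<rho>\<alpha>_L N_bounds)

lemma kap_\<rho>:
  assumes g: "g \<in> G" and v: "v \<in> Vc" and J: "J < N"
  shows "kap (\<rho> g *\<^sub>v v) J = (\<Sum>K<N. Dm g J K * kap v K)"
proof -
  have \<rho>c: "\<rho> g \<in> carrier_mat n n" using \<rho>[OF g] by (rule mats_over_carrier)
  let ?i = "J mod n" and ?m = "J div n"
  have J': "?i < n" "?m < d" using N_bounds[OF J] by auto
  have "(\<rho> g *\<^sub>v v) $ ?i = (\<Sum>j<n. \<rho> g $$ (?i, j) * v $ j)"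
    using \<rho>c v J' by (intro mult_vec_index_sum) (auto simp: Vc_iff)
  also have "\<dots> = (\<Sum>j<n. \<rho> g $$ (?i, j) * (\<Sum>k<d. ca (v $ j) k * \<alpha> $ k))"
    using ca(2) Vc_index[OF v] by (intro sum.cong) auto
  also have "\<dots> = (\<Sum>k<d. \<Sum>j<n. ca (v $ j) k * (\<rho> g $$ (?i, j) * \<alpha> $ k))"
    unfolding sum_distrib_left by (subst sum.swap) (simp add: ac_simps)
  also have "\<dots> = (\<Sum>K<N. kap v K * (\<rho> g $$ (?i, K mod n) * \<alpha> $ (K div n)))"
    unfolding kap_def by (rule sum_mod_div[symmetric])
  finally have "kap (\<rho> g *\<^sub>v v) J = ca (\<Sum>K<N. kap v K * (\<rho> g $$ (?i, K mod n) * \<alpha> $ (K div n))) ?m"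
    by (simp add: kap_def)
  also have "\<dots> = (\<Sum>K<N. kap v K * Dm g J K)"
    unfolding Dm_def using g v J' kap_F \<rho>\<alpha>_L N_bounds by (intro ca_sum) auto
  finally show ?thesis by (simp add: mult.commute)
qed

definition uv :: "'a vec" where "uv = vectorize u"

lemma u_carrier: "u \<in> carrier_mat n d" using u(1) by (rule mats_over_carrier)

lemma uv_carrier: "uv \<in> carrier_vec N" and uv_index: "K < N \<Longrightarrow> uv $ K = u $$ (K mod n, K div n)"
  using u_carrier by (auto simp: uv_def vectorize_def)

lemma uv_S: "K < N \<Longrightarrow> uv $ K \<in> S"
  using u(1) N_bounds by (auto simp: uv_index mats_over_iff)

text \<open>Since \<open>Dm g\<close> is the matrix of \<open>\<rho> g\<close> over \<open>F\<close>, the defining equations of a solution, one for each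
  conjugate of \<open>\<alpha>\<close>, say that \<open>Dm g\<close> maps \<open>g(u)\<close> to \<open>u\<close>: the conjugates of \<open>\<alpha>\<close> form an invertible matrix.\<close>

lemma Dm_uv:
  assumes g: "g \<in> G" and J: "J < N"
  shows "(\<Sum>K<N. Dm g J K * g (uv $ K)) = uv $ J"
proof -
  have \<rho>c: "\<rho> g \<in> carrier_mat n n" using \<rho>[OF g] by (rule mats_over_carrier)
  \<comment> \<open>This is \<open>Dm g\<close> applied to g(u), arranged as an n by d matrix; the
    claim becomes w = u.\<close>
  define w where "w = mat n d (\<lambda>(i, m). \<Sum>k<d. \<Sum>j<n. ca (\<rho> g $$ (i, j) * \<alpha> $ k) m * g (u $$ (j, k)))"
  have w: "w \<in> carrier_mat n d" by (simp add: w_def)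
  note A = moore_carrier[OF \<alpha>(1), of q]
  have fr: "frob_vec q l \<alpha> \<in> carrier_vec d" for l using \<alpha>(1) by (simp add: frob_vec_def)
  \<comment> \<open>Column l of the Moore matrix of \<alpha> is the l-th conjugate of \<alpha>, so
    after this multiplication the equations of a solution apply column by column.\<close>
  have "w * moore_matrix q \<alpha> = u * moore_matrix q \<alpha>"
  proof (rule eq_matI)
    fix i l assume "i < dim_row (u * moore_matrix q \<alpha>)" "l < dim_col (u * moore_matrix q \<alpha>)"
    then have il: "i < n" "l < d" using u_carrier A by auto
    have "(w * moore_matrix q \<alpha>) $$ (i, l) =
        (\<Sum>m<d. (\<Sum>k<d. \<Sum>j<n. ca (\<rho> g $$ (i, j) * \<alpha> $ k) m * g (u $$ (j, k))) * \<alpha> $ m ^ q ^ l)"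
      unfolding mult_mat_index_sum[OF w A il] using il \<alpha>(1) by (simp add: moore_index w_def)
    also have "\<dots> = (\<Sum>j<n. \<Sum>k<d. g (u $$ (j, k)) * (\<Sum>m<d. ca (\<rho> g $$ (i, j) * \<alpha> $ k) m * \<alpha> $ m ^ q ^ l))"
      unfolding sum_distrib_left sum_distrib_right
      by (subst sum_swap3) (simp add: ac_simps)
    also have "\<dots> = (\<Sum>j<n. \<Sum>k<d. g (u $$ (j, k)) * (\<rho> g $$ (i, j) * \<alpha> $ k) ^ q ^ l)"
    proof (rule sum.cong[OF HOL.refl], rule sum.cong[OF HOL.refl])
      fix j k assume "j \<in> {..<n}" "k \<in> {..<d}"
      then have L': "\<rho> g $$ (i, j) * \<alpha> $ k \<in> L" using \<rho>\<alpha>_L[OF g] il by auto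
      \<comment> \<open>Coordinates in F are fixed by the Frobenius, so the power affects only the
        basis \<alpha>.\<close>
      have "(\<rho> g $$ (i, j) * \<alpha> $ k) ^ q ^ l = (\<Sum>m<d. ca (\<rho> g $$ (i, j) * \<alpha> $ k) m * \<alpha> $ m) ^ q ^ l"
        using ca(2)[OF L'] by simp
      also have "\<dots> = (\<Sum>m<d. ca (\<rho> g $$ (i, j) * \<alpha> $ k) m * \<alpha> $ m ^ q ^ l)"
        unfolding frob_sum power_mult_distrib using ca(1)[OF L'] by (intro sum.cong) (auto simp: pow_q_pow)
      finally show "g (u $$ (j, k)) * (\<Sum>m<d. ca (\<rho> g $$ (i, j) * \<alpha> $ k) m * \<alpha> $ m ^ q ^ l) =
          g (u $$ (j, k)) * (\<rho> g $$ (i, j) * \<alpha> $ k) ^ q ^ l" by simp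
    qed
    also have "\<dots> = (\<Sum>j<n. frob_mat q l (\<rho> g) $$ (i, j) * (map_mat g u *\<^sub>v frob_vec q l \<alpha>) $ j)"
    proof (rule sum.cong[OF HOL.refl])
      fix j assume j: "j \<in> {..<n}"
      have "(map_mat g u *\<^sub>v frob_vec q l \<alpha>) $ j = (\<Sum>k<d. map_mat g u $$ (j, k) * frob_vec q l \<alpha> $ k)"
        using u_carrier fr j by (intro mult_vec_index_sum) auto
      then show "(\<Sum>k<d. g (u $$ (j, k)) * (\<rho> g $$ (i, j) * \<alpha> $ k) ^ q ^ l) =
          frob_mat q l (\<rho> g) $$ (i, j) * (map_mat g u *\<^sub>v frob_vec q l \<alpha>) $ j"
        using \<rho>c u_carrier \<alpha>(1) il j
        by (auto simp: frob_vec_def sum_distrib_left power_mult_distrib ac_simps intro!: sum.cong)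
    qed
    also have "\<dots> = (frob_mat q l (\<rho> g) *\<^sub>v (map_mat g u *\<^sub>v frob_vec q l \<alpha>)) $ i"
      using \<rho>c u_carrier fr il by (intro mult_vec_index_sum[symmetric]) auto
    also have "\<dots> = (u *\<^sub>v frob_vec q l \<alpha>) $ i" using sol[OF g il(2)] by simp
    also have "\<dots> = (u * moore_matrix q \<alpha>) $$ (i, l)"
      unfolding mult_mat_index_sum[OF u_carrier A il] mult_vec_index_sum[OF u_carrier fr il(1)]
      using il \<alpha>(1) by (intro sum.cong) (auto simp: moore_index frob_vec_def)
    finally show "(w * moore_matrix q \<alpha>) $$ (i, l) = (u * moore_matrix q \<alpha>) $$ (i, l)" .
  qed (use w u_carrier A in auto)
  then have "w = u" by (rule mult_right_cancel_mat[OF A moore_det[OF \<alpha>] w u_carrier])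
  then have "uv $ J = w $$ (J mod n, J div n)" using uv_index[OF J] by simp
  also have "\<dots> = (\<Sum>k<d. \<Sum>j<n. ca (\<rho> g $$ (J mod n, j) * \<alpha> $ k) (J div n) * g (u $$ (j, k)))"
    using N_bounds[OF J] by (simp add: w_def)
  also have "\<dots> = (\<Sum>K<N. Dm g J K * g (u $$ (K mod n, K div n)))"
    unfolding Dm_def by (rule sum_mod_div[symmetric])
  also have "\<dots> = (\<Sum>K<N. Dm g J K * g (uv $ K))" by (rule sum.cong) (auto simp: uv_index)
  finally show ?thesis by simp
qed

text \<open>The entries of \<open>Dm g\<close> lie in F and g commutes with powers, so the
  invariance of u passes to all its conjugates.\<close>

lemma Dm_uv_pow:
  assumes g: "g \<in> G" and J: "J < N"
  shows "(\<Sum>K<N. Dm g J K * g (uv $ K ^ q ^ i)) = uv $ J ^ q ^ i"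
proof -
  have "uv $ J ^ q ^ i = (\<Sum>K<N. Dm g J K * g (uv $ K)) ^ q ^ i" using Dm_uv[OF assms] by simp
  also have "\<dots> = (\<Sum>K<N. Dm g J K * g (uv $ K ^ q ^ i))"
    unfolding frob_sum power_mult_distrib
    using Dm_F[OF g J] fhom.hom_power[OF G_fhom[OF g]] uv_S by (intro sum.cong) (auto simp: pow_q_pow)
  finally show ?thesis by simp
qed

section \<open>Galois descent by the Moore matrix of u\<close>

definition Mm :: "'a mat" where "Mm = moore_matrix q uv"

lemma Mm: "Mm \<in> carrier_mat N N" "det Mm \<noteq> 0" "J < N \<Longrightarrow> i < N \<Longrightarrow> Mm $$ (J, i) = uv $ J ^ q ^ i"
  using uv_carrier moore_det[OF uv_carrier] u(2) by (auto simp: Mm_def moore_index uv_def)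

lemma Mm_over: "Mm \<in> mats_over N N S"
  using Mm uv_S S by (auto simp: mats_over_iff intro: subfld.power)

text \<open>\<open>xs c\<close> is the combination \<open>\<Sum>\<^sub>i c\<^sub>i u^(i)\<close>.\<close>

definition xs :: "(nat \<Rightarrow> 'a) \<Rightarrow> nat \<Rightarrow> 'a" where
  "xs c J = (if J < N then \<Sum>i<N. uv $ J ^ q ^ i * c i else 0)"

lemma xs_Mm: "J < N \<Longrightarrow> xs c J = (Mm *\<^sub>v vec N c) $ J"
  using Mm by (simp add: xs_def scalar_prod_def lessThan_atLeast0 carrier_matD[OF Mm(1)])

lemma xs_inj:
  assumes "\<And>J. J < N \<Longrightarrow> xs c J = xs c' J" "i < N"
  shows "c i = c' i"
proof (rule ccontr)
  assume "c i \<noteq> c' i"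
  define z where "z = vec N (\<lambda>i. c i - c' i)"
  have "Mm *\<^sub>v z = 0\<^sub>v N"
  proof (rule eq_vecI)
    fix J assume "J < dim_vec (0\<^sub>v N :: 'a vec)"
    then have J: "J < N" by simp
    have "(Mm *\<^sub>v z) $ J = xs c J - xs c' J"
      using J xs_Mm[OF J, of "\<lambda>i. c i - c' i"] by (simp add: z_def xs_def algebra_simps sum_subtractf)
    then show "(Mm *\<^sub>v z) $ J = 0\<^sub>v N $ J" using assms J by simp
  qed (use carrier_matD[OF Mm(1)] in simp)
  moreover have "z $ i \<noteq> 0" using \<open>c i \<noteq> c' i\<close> assms by (simp add: z_def)
  then have "z \<noteq> 0\<^sub>v N" using assms by auto
  ultimately show False
    using Mm(2) det_0_iff_vec_prod_zero_field[OF Mm(1)] by (metis vec_carrier z_def)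
qed

lemma xs_surj:
  assumes x: "x \<in> coord_space N S"
  obtains c where "c \<in> coord_space N S" "xs c = x"
proof -
  obtain B where B: "B \<in> mats_over N N S" "Mm * B = 1\<^sub>m N"
    using subfld.inverse_over[OF S Mm_over Mm(2)] by blast
  define c where "c i = (if i < N then (B *\<^sub>v vec N x) $ i else 0)" for i
  have Bc: "B \<in> carrier_mat N N" using B(1) by (rule mats_over_carrier)
  have "c \<in> coord_space N S"
    using B(1) S coord_spaceD[OF x]
    by (intro coord_spaceI) (auto simp: c_def mats_over_iff scalar_prod_def intro!: subfld.sum subfld.mult)
  moreover have "xs c = x"
  proof
    fix J
    have v: "vec N c = B *\<^sub>v vec N x" using Bc by (intro eq_vecI) (auto simp: c_def)
    have "Mm *\<^sub>v (B *\<^sub>v vec N x) = vec N x"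
      using B Mm(1) Bc by (metis assoc_mult_mat_vec one_mult_mat_vec vec_carrier)
    then show "xs c J = x J" using xs_Mm[of J c] coord_space_outside[OF x, of J] v by (cases "J < N") (auto simp: xs_def)
  qed
  ultimately show thesis using that by blast
qed

lemma xs_S: "c \<in> coord_space N S \<Longrightarrow> xs c \<in> coord_space N S"
  using S uv_S by (intro coord_spaceI) (auto simp: xs_def coord_spaceD intro!: subfld.sum subfld.mult subfld.power)

text \<open>All u^(i) are invariant, so in this basis the twisted action is just the action of g on
  the coefficients.\<close>

lemma Dm_xs:
  assumes g: "g \<in> G" and J: "J < N" and c: "c \<in> coord_space N S"
  shows "(\<Sum>K<N. Dm g J K * g (xs c K)) = xs (\<lambda>i. g (c i)) J"
proof -
  interpret g: fhom S g by (rule G_fhom[OF g])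
  have "(\<Sum>K<N. Dm g J K * g (xs c K)) = (\<Sum>K<N. Dm g J K * (\<Sum>i<N. g (uv $ K ^ q ^ i) * g (c i)))"
  proof (rule sum.cong[OF HOL.refl])
    fix K assume K: "K \<in> {..<N}"
    have uvK: "uv $ K ^ q ^ i \<in> S" for i using uv_S K by (intro g.power) auto
    have "g (\<Sum>i<N. uv $ K ^ q ^ i * c i) = (\<Sum>i<N. g (uv $ K ^ q ^ i * c i))"
      using uvK coord_spaceD[OF c] by (intro g.hom_sum g.mult) auto
    also have "\<dots> = (\<Sum>i<N. g (uv $ K ^ q ^ i) * g (c i))"
      using uvK coord_spaceD[OF c] by (intro sum.cong HOL.refl g.hom_mult) auto
    finally show "Dm g J K * g (xs c K) = Dm g J K * (\<Sum>i<N. g (uv $ K ^ q ^ i) * g (c i))"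
      using K by (simp add: xs_def)
  qed
  also have "\<dots> = (\<Sum>i<N. (\<Sum>K<N. Dm g J K * g (uv $ K ^ q ^ i)) * g (c i))"
    unfolding sum_distrib_left sum_distrib_right by (subst sum.swap) (simp add: ac_simps)
  also have "\<dots> = xs (\<lambda>i. g (c i)) J" using J by (simp add: Dm_uv_pow[OF g J] xs_def)
  finally show ?thesis .
qed

text \<open>The coefficients c are determined by \<open>xs c\<close>, so invariance means that the
  Galois group fixes each of them, and its fixed field is E.\<close>

lemma invariant_iff:
  assumes c: "c \<in> coord_space N S"
  shows "(\<forall>g\<in>G. \<forall>J<N. (\<Sum>K<N. Dm g J K * g (xs c K)) = xs c J) \<longleftrightarrow> c \<in> coord_space N E"
proof
  assume H: "\<forall>g\<in>G. \<forall>J<N. (\<Sum>K<N. Dm g J K * g (xs c K)) = xs c J"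
  show "c \<in> coord_space N E"
  proof (rule coord_spaceI)
    fix i assume i: "i < N"
    show "c i \<in> E"
    proof (rule G_fixed)
      show "c i \<in> S" using c i by (rule coord_spaceD)
      fix g assume g: "g \<in> G"
      show "g (c i) = c i"
        by (rule xs_inj[OF _ i, of "\<lambda>i. g (c i)" c]) (use H g Dm_xs[OF g _ c] in simp)
    qed
  qed (use coord_space_outside[OF c] in simp)
next
  assume E: "c \<in> coord_space N E"
  show "\<forall>g\<in>G. \<forall>J<N. (\<Sum>K<N. Dm g J K * g (xs c K)) = xs c J"
  proof (intro ballI allI impI)
    fix g J assume g: "g \<in> G" and J: "J < N"
    have "xs (\<lambda>i. g (c i)) J = xs c J"
      unfolding xs_def using coord_spaceD[OF E] G_E[OF g] by (auto intro!: sum.cong)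
    then show "(\<Sum>K<N. Dm g J K * g (xs c K)) = xs c J" using Dm_xs[OF g J c] by simp
  qed
qed

section \<open>The companion matrix as the Frobenius on the invariants\<close>

definition \<Phi> :: "'a mat" where "\<Phi> = Phi q u"

definition fv :: "'a vec" where "fv = mat_inv N Mm *\<^sub>v frob_vec q N uv"

lemma \<Phi>_companion: "\<Phi> = companion N fv"
  using uv_carrier by (simp add: \<Phi>_def Phi_def Let_def fv_def Mm_def uv_def[symmetric])

lemma fv_carrier: "fv \<in> carrier_vec N"
  unfolding fv_def by (rule mult_mat_vec_carrier[OF mat_inv_props(1)[OF Mm(1,2)]])
    (use uv_carrier in \<open>simp add: frob_vec_def\<close>)

lemma Mm_fv: "J < N \<Longrightarrow> xs (\<lambda>i. fv $ i) J = uv $ J ^ q ^ N"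
proof -
  assume J: "J < N"
  have fr: "frob_vec q N uv \<in> carrier_vec N" using uv_carrier by (simp add: frob_vec_def)
  have "vec N (\<lambda>i. fv $ i) = fv" using fv_carrier by (intro eq_vecI) auto
  moreover have "Mm *\<^sub>v fv = (Mm * mat_inv N Mm) *\<^sub>v frob_vec q N uv"
    unfolding fv_def using Mm(1) mat_inv_props(1)[OF Mm(1,2)] fr by (intro assoc_mult_mat_vec[symmetric])
  then have "Mm *\<^sub>v fv = frob_vec q N uv" using mat_inv_props(2)[OF Mm(1,2)] fr by simp
  ultimately show ?thesis using J xs_Mm[OF J, of "\<lambda>i. fv $ i"] uv_carrier by (simp add: frob_vec_def)
qed

text \<open>u^(N) is itself invariant, so descent applies to its coefficients with respect to u,
  ..., u^(N-1), and these are the entries of \<open>fv\<close>.\<close>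

lemma fv_E: "i < N \<Longrightarrow> fv $ i \<in> E"
proof -
  assume i: "i < N"
  have "(\<lambda>J. if J < N then uv $ J ^ q ^ N else 0) \<in> coord_space N S"
    using uv_S S by (intro coord_spaceI) (auto intro: subfld.power)
  then obtain c where c: "c \<in> coord_space N S" "xs c = (\<lambda>J. if J < N then uv $ J ^ q ^ N else 0)"
    by (rule xs_surj)
  have "c \<in> coord_space N E"
    unfolding invariant_iff[OF c(1), symmetric] c(2) using Dm_uv_pow by simp
  moreover have "c i = fv $ i" by (rule xs_inj[OF _ i]) (simp add: Mm_fv c(2))
  ultimately show ?thesis using coord_spaceD[of c N E i] i by simp
qed

lemma \<Phi>_carrier: "\<Phi> \<in> carrier_mat N N"
  by (simp add: \<Phi>_companion companion_def)

lemma \<Phi>_index: "i < N \<Longrightarrow> j < N \<Longrightarrow> \<Phi> $$ (i, j) = (if j = N - 1 then fv $ i else if i = Suc j then 1 else 0)"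
  by (simp add: \<Phi>_companion companion_def)

lemma \<Phi>_over: "\<Phi> \<in> mats_over N N E"
  using \<Phi>_carrier fv_E subfld.zero[OF E] subfld.one[OF E] by (auto simp: mats_over_iff \<Phi>_index)

text \<open>The relation M \<Phi> = M^(1) entry by entry: the subdiagonal shifts each column of M to
  the next one, and the last column of \<Phi> expresses u^(N) by \<open>Mm_fv\<close>.\<close>

lemma uv_\<Phi>:
  assumes J: "J < N" and j: "j < N"
  shows "(\<Sum>i<N. uv $ J ^ q ^ i * \<Phi> $$ (i, j)) = uv $ J ^ q ^ Suc j"
proof (cases "j = N - 1")
  case True
  then have "(\<Sum>i<N. uv $ J ^ q ^ i * \<Phi> $$ (i, j)) = xs (\<lambda>i. fv $ i) J"
    using J j by (simp add: xs_def \<Phi>_index)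
  also have "\<dots> = uv $ J ^ q ^ N" by (rule Mm_fv[OF J])
  moreover have "Suc j = N" using True j by simp
  ultimately show ?thesis by (simp only:)
next
  case False
  then have "(\<Sum>i<N. uv $ J ^ q ^ i * \<Phi> $$ (i, j)) = (\<Sum>i<N. if i = Suc j then uv $ J ^ q ^ i else 0)"
    using j by (intro sum.cong) (auto simp: \<Phi>_index)
  also have "\<dots> = uv $ J ^ q ^ Suc j" using False j by (subst sum.delta) auto
  finally show ?thesis .
qed

lemma \<Phi>_det: "det \<Phi> \<noteq> 0"
proof -
  have "Mm * \<Phi> = map_mat (\<lambda>x. x ^ q ^ 1) Mm"
  proof (rule eq_matI)
    fix J j assume "J < dim_row (map_mat (\<lambda>x. x ^ q ^ 1) Mm)" "j < dim_col (map_mat (\<lambda>x. x ^ q ^ 1) Mm)"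
    then have J: "J < N" "j < N" using Mm(1) by auto
    have "(Mm * \<Phi>) $$ (J, j) = (\<Sum>i<N. uv $ J ^ q ^ i * \<Phi> $$ (i, j))"
      using J Mm(1) \<Phi>_carrier by (simp add: scalar_prod_def lessThan_atLeast0 Mm(3))
    also have "\<dots> = uv $ J ^ q ^ Suc j" by (rule uv_\<Phi>[OF J])
    also have "\<dots> = (uv $ J ^ q ^ j) ^ q" by (simp add: power_mult[symmetric] mult.commute)
    finally show "(Mm * \<Phi>) $$ (J, j) = map_mat (\<lambda>x. x ^ q ^ 1) Mm $$ (J, j)"
      using J Mm(1) by (simp add: Mm(3))
  qed (use Mm(1) \<Phi>_carrier in auto)
  moreover have "det (map_mat (\<lambda>x. x ^ q ^ 1) Mm) \<noteq> 0"
    by (rule fhom.map_mat_det_nonzero[OF frob_fhom]) (use Mm in auto)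
  ultimately show ?thesis using det_mult[OF Mm(1) \<Phi>_carrier] by auto
qed

lemma xs_frob:
  assumes J: "J < N"
  shows "xs c J ^ q = xs (\<lambda>i. \<Sum>j<N. \<Phi> $$ (i, j) * c j ^ q) J"
proof -
  have "xs c J ^ q = (\<Sum>j<N. uv $ J ^ q ^ j * c j) ^ q ^ 1" using J by (simp add: xs_def)
  also have "\<dots> = (\<Sum>j<N. uv $ J ^ q ^ Suc j * c j ^ q)"
    unfolding frob_sum by (simp add: power_mult_distrib power_mult[symmetric] mult.commute)
  also have "\<dots> = (\<Sum>j<N. (\<Sum>i<N. uv $ J ^ q ^ i * \<Phi> $$ (i, j)) * c j ^ q)"
    using uv_\<Phi>[OF J] by (intro sum.cong) auto
  also have "\<dots> = xs (\<lambda>i. \<Sum>j<N. \<Phi> $$ (i, j) * c j ^ q) J"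
    unfolding xs_def sum_distrib_left sum_distrib_right using J by (subst sum.swap) (simp add: ac_simps)
  finally show ?thesis .
qed

end

section \<open>The invariants and the motive of the representation in coordinates\<close>

context artin_data
begin

lemma coord_space_E_S: "c \<in> coord_space N E \<Longrightarrow> c \<in> coord_space N S"
  using ES by (auto simp: coord_space_def)

definition gal_act :: "('a \<Rightarrow> 'a) \<Rightarrow> (nat \<Rightarrow> 'a) \<Rightarrow> nat \<Rightarrow> 'a" where
  "gal_act g x J = (if J < N then \<Sum>K<N. Dm g J K * g (x K) else 0)"

lemma gal_act_C: "g \<in> G \<Longrightarrow> x \<in> coord_space N S \<Longrightarrow> gal_act g x \<in> coord_space N S"
  using S Dm_F FS G_closed
  by (intro coord_spaceI) (auto simp: gal_act_def coord_spaceD intro!: subfld.sum subfld.mult)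

lemma \<rho>_Vc: "g \<in> G \<Longrightarrow> v \<in> Vc \<Longrightarrow> \<rho> g *\<^sub>v v \<in> Vc"
proof -
  assume g: "g \<in> G" and v: "v \<in> Vc"
  have \<rho>c: "\<rho> g \<in> carrier_mat n n" using \<rho>[OF g] by (rule mats_over_carrier)
  have vc: "v \<in> carrier_vec n" using v by (simp add: Vc_iff)
  have "(\<rho> g *\<^sub>v v) $ i \<in> L" if "i < n" for i
    unfolding mult_vec_index_sum[OF \<rho>c vc that] using \<rho>[OF g] Vc_index[OF v] that
    by (auto simp: mats_over_iff intro!: subfld.sum[OF L] subfld.mult[OF L])
  then show ?thesis using \<rho>c vc by (auto simp: Vc_iff)
qed

lemma T1_gal:
  assumes g: "g \<in> G" and x: "x \<in> coord_space N S"
  shows "tensor_map RF SM VM g (\<lambda>v. \<rho> g *\<^sub>v v) (T1.elt x) = T1.elt (gal_act g x)"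
proof (rule T1.tensor_map_elt[OF _ _ _ _ _ x])
  interpret g: fhom S g by (rule G_fhom[OF g])
  show "\<And>m. m \<in> carrier SM \<Longrightarrow> g m \<in> carrier SM" using G_closed[OF g] by (simp add: SM_simps)
  show "\<And>v. v \<in> carrier VM \<Longrightarrow> \<rho> g *\<^sub>v v \<in> carrier VM" using \<rho>_Vc[OF g] by (simp add: VM_simps)
  show "gal_act g 0 = 0" by (rule ext) (simp add: gal_act_def)
  show "gal_act g (x + y) = gal_act g x + gal_act g y" if "x \<in> coord_space N S" "y \<in> coord_space N S" for x y
    using coord_spaceD[OF that(1)] coord_spaceD[OF that(2)]
    by (intro ext) (simp add: gal_act_def g.hom_add distrib_left sum.distrib)
  show "\<beta>1 (g m) (\<rho> g *\<^sub>v v) = gal_act g (\<beta>1 m v)" if mv: "m \<in> carrier SM" "v \<in> carrier VM" for m v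
  proof
    fix J
    have v: "v \<in> Vc" and m: "m \<in> S" using mv by (simp_all add: VM_simps SM_simps)
    show "\<beta>1 (g m) (\<rho> g *\<^sub>v v) J = gal_act g (\<beta>1 m v) J"
    proof (cases "J < N")
      case True
      have "\<beta>1 (g m) (\<rho> g *\<^sub>v v) J = (\<Sum>K<N. Dm g J K * (g m * kap v K))"
        using True by (simp add: \<beta>1_def kap_\<rho>[OF g v True] sum_distrib_left ac_simps)
      also have "\<dots> = gal_act g (\<beta>1 m v) J"
        unfolding gal_act_def using True kap_F[OF v] FS m G_F[OF g]
        by (auto intro!: sum.cong simp: \<beta>1_def g.hom_mult)
      finally show ?thesis .
    qed (simp add: \<beta>1_def gal_act_def)
  qed
qed

definition wel :: "(nat \<Rightarrow> 'a) \<Rightarrow> ('a \<times> 'a vec) multiset set" where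
  "wel c = T1.elt (xs c)"

abbreviation "WM \<equiv> rep_invariants F E n \<rho>"
abbreviation "CE \<equiv> coord_space N E"

lemma xs_C: "c \<in> CE \<Longrightarrow> xs c \<in> coord_space N S"
  by (intro xs_S coord_space_E_S)

lemma WM_carrier: "carrier WM = wel ` CE"
proof -
  have inv: "tensor_map RF SM VM g (\<lambda>v. \<rho> g *\<^sub>v v) (T1.elt x) = T1.elt x \<longleftrightarrow>
      (\<forall>J<N. (\<Sum>K<N. Dm g J K * g (x K)) = x J)"
    if g: "g \<in> G" and x: "x \<in> coord_space N S" for g x
  proof -
    have "tensor_map RF SM VM g (\<lambda>v. \<rho> g *\<^sub>v v) (T1.elt x) = T1.elt x \<longleftrightarrow> gal_act g x = x"
      unfolding T1_gal[OF that] by (auto dest: T1.elt_inj[OF gal_act_C[OF that]])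
    also have "\<dots> \<longleftrightarrow> (\<forall>J<N. gal_act g x J = x J)"
      using coord_space_eqI[OF gal_act_C[OF that] x] by auto
    finally show ?thesis by (simp add: gal_act_def)
  qed
  have "carrier WM = {w \<in> T1.elt ` coord_space N S. \<forall>g\<in>G. tensor_map RF SM VM g (\<lambda>v. \<rho> g *\<^sub>v v) w = w}"
    by (simp add: rep_invariants_def Let_def T1.carrier_tensor)
  also have "\<dots> = wel ` CE"
  proof (intro equalityI subsetI)
    fix w assume "w \<in> {w \<in> T1.elt ` coord_space N S. \<forall>g\<in>G. tensor_map RF SM VM g (\<lambda>v. \<rho> g *\<^sub>v v) w = w}"
    then obtain x where x: "x \<in> coord_space N S" "w = T1.elt x"
      "\<forall>g\<in>G. tensor_map RF SM VM g (\<lambda>v. \<rho> g *\<^sub>v v) (T1.elt x) = T1.elt x" by auto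
    obtain c where c: "c \<in> coord_space N S" "xs c = x" using xs_surj[OF x(1)] .
    have "\<forall>g\<in>G. \<forall>J<N. (\<Sum>K<N. Dm g J K * g (xs c K)) = xs c J"
      using inv[OF _ x(1)] x(3) c(2) by auto
    then have "c \<in> CE" using invariant_iff[OF c(1)] by blast
    then show "w \<in> wel ` CE" using x(2) c(2) by (auto simp: wel_def)
  next
    fix w assume "w \<in> wel ` CE"
    then obtain c where c: "c \<in> CE" "w = T1.elt (xs c)" by (auto simp: wel_def)
    then show "w \<in> {w \<in> T1.elt ` coord_space N S. \<forall>g\<in>G. tensor_map RF SM VM g (\<lambda>v. \<rho> g *\<^sub>v v) w = w}"
      using inv[OF _ xs_C[OF c(1)]] invariant_iff[OF coord_space_E_S[OF c(1)]] xs_C[OF c(1)] by auto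
  qed
  finally show ?thesis .
qed

lemma wel_inj: "c \<in> CE \<Longrightarrow> c' \<in> CE \<Longrightarrow> wel c = wel c' \<Longrightarrow> c = c'"
proof (rule coord_space_eqI)
  assume c: "c \<in> CE" and eq: "wel c = wel c'"
  have "xs c = xs c'" by (rule T1.elt_inj[OF xs_C[OF c]]) (use eq in \<open>simp add: wel_def\<close>)
  show "c i = c' i" if "i < N" for i
    by (rule xs_inj[OF _ that]) (simp add: \<open>xs c = xs c'\<close>)
qed

lemma CE_zero: "0 \<in> CE" and CE_add: "c \<in> CE \<Longrightarrow> c' \<in> CE \<Longrightarrow> c + c' \<in> CE"
  and CE_smult: "e \<in> E \<Longrightarrow> c \<in> CE \<Longrightarrow> (\<lambda>i. e * c i) \<in> CE"
  using E by (auto intro!: coord_spaceI simp: coord_spaceD coord_space_outside subfld.zero subfld.add subfld.mult)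

lemma WM_zero: "\<zero>\<^bsub>WM\<^esub> = wel 0"
proof -
  have "xs 0 = 0" by (rule ext) (simp add: xs_def)
  then show ?thesis by (simp add: rep_invariants_def Let_def T1.zero_tensor wel_def)
qed

lemma WM_add:
  assumes "c \<in> CE" "c' \<in> CE" shows "wel c \<oplus>\<^bsub>WM\<^esub> wel c' = wel (c + c')"
proof -
  have "xs c + xs c' = xs (c + c')" by (rule ext) (simp add: xs_def algebra_simps sum.distrib)
  then show ?thesis
    using T1.add_tensor[OF xs_C[OF assms(1)] xs_C[OF assms(2)]] by (simp add: rep_invariants_def Let_def wel_def)
qed

lemma WM_smult:
  assumes "e \<in> E" "c \<in> CE" shows "e \<odot>\<^bsub>WM\<^esub> wel c = wel (\<lambda>i. e * c i)"
proof -
  have "tensor_map RF SM VM (\<lambda>x. e * x) (\<lambda>v. v) (T1.elt (xs c)) = T1.elt (\<lambda>J. e * xs c J)"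
    by (rule T1.tensor_map_elt[OF _ _ _ _ _ xs_C[OF assms(2)]])
       (use assms ES S in \<open>auto simp: SM_simps \<beta>1_def fun_eq_iff algebra_simps intro!: subfld.mult\<close>)
  moreover have "(\<lambda>J. e * xs c J) = xs (\<lambda>i. e * c i)"
    by (rule ext) (simp add: xs_def sum_distrib_left ac_simps)
  ultimately show ?thesis by (simp add: rep_invariants_def Let_def wel_def)
qed

definition \<Phi>f :: "(nat \<Rightarrow> 'a) \<Rightarrow> nat \<Rightarrow> 'a" where
  "\<Phi>f c i = (if i < N then \<Sum>j<N. \<Phi> $$ (i, j) * c j ^ q else 0)"

lemma \<Phi>f_CE: "c \<in> CE \<Longrightarrow> \<Phi>f c \<in> CE"
  using \<Phi>_over E
  by (intro coord_spaceI) (auto simp: \<Phi>f_def mats_over_iff coord_spaceD intro!: subfld.sum subfld.mult subfld.power)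

lemma WM_tau:
  assumes "c \<in> CE" shows "tau WM (wel c) = wel (\<Phi>f c)"
proof -
  have "tensor_map RF SM VM (\<lambda>x. x ^ q) (\<lambda>v. v) (T1.elt (xs c)) = T1.elt (\<lambda>J. xs c J ^ q)"
  proof (rule T1.tensor_map_elt[OF _ _ _ _ _ xs_C[OF assms]])
    show "\<beta>1 (x ^ q) v = (\<lambda>J. \<beta>1 x v J ^ q)" if "x \<in> carrier SM" "v \<in> carrier VM" for x v
      using kap_F[of v] that by (auto simp: \<beta>1_def VM_simps power_mult_distrib pow_q intro!: ext)
  qed (use S in \<open>auto simp: SM_simps frob_add intro!: subfld.power\<close>)
  moreover have "(\<lambda>J. xs c J ^ q) = xs (\<Phi>f c)"
  proof
    fix J show "xs c J ^ q = xs (\<Phi>f c) J"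
    proof (cases "J < N")
      case True
      then show ?thesis unfolding xs_frob[OF True] by (simp add: xs_def \<Phi>f_def)
    qed (simp add: xs_def)
  qed
  ultimately show ?thesis by (simp add: rep_invariants_def Let_def wel_def card_F)
qed

definition cw :: "('a \<times> 'a vec) multiset set \<Rightarrow> nat \<Rightarrow> 'a" where
  "cw = inv_into CE wel"

lemma cw_wel: "c \<in> CE \<Longrightarrow> cw (wel c) = c"
  unfolding cw_def by (rule inv_into_f_f) (auto intro: inj_onI wel_inj)

lemma WM_cases: assumes "w \<in> carrier WM" obtains c where "c \<in> CE" "w = wel c"
  using assms unfolding WM_carrier by blast

text \<open>Polymorphic, since it serves as unit vector over E for the invariants and over E[t] for
  the motive of \<rho>.\<close>

definition unit_coord :: "nat \<Rightarrow> nat \<Rightarrow> 'b::zero_neq_one" where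
  "unit_coord i j = (if j = i then 1 else 0)"

lemma unit_CE: "i < N \<Longrightarrow> unit_coord i \<in> CE"
  using E by (auto intro!: coord_spaceI simp: unit_coord_def subfld.zero subfld.one)

lemma psum_WM:
  assumes c: "c \<in> CE" and "m \<le> N"
  shows "psum WM (\<lambda>i. c i \<odot>\<^bsub>WM\<^esub> wel (unit_coord i)) m = wel (\<lambda>j. if j < m then c j else 0)"
  using assms(2)
proof (induction m)
  case 0
  then show ?case by (simp add: WM_zero zero_fun_def)
next
  case (Suc m)
  have "c m \<odot>\<^bsub>WM\<^esub> wel (unit_coord m) = wel (\<lambda>j. c m * unit_coord m j)"
    using Suc c by (intro WM_smult unit_CE coord_spaceD[OF c]) auto
  moreover have "(\<lambda>j. if j < m then c j else 0) \<in> CE" "(\<lambda>j. c m * unit_coord m j) \<in> CE"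
    using Suc c E by (auto intro!: coord_spaceI CE_smult unit_CE coord_spaceD[OF c] simp: subfld.zero)
  moreover have "(\<lambda>j. if j < m then c j else 0) + (\<lambda>j. c m * unit_coord m j) = (\<lambda>j. if j < Suc m then c j else 0)"
    by (rule ext) (auto simp: unit_coord_def less_Suc_eq)
  ultimately show ?case using Suc WM_add by simp
qed

lemma psum_WM_all: "c \<in> CE \<Longrightarrow> psum WM (\<lambda>i. c i \<odot>\<^bsub>WM\<^esub> wel (unit_coord i)) N = wel c"
  using psum_WM[of c N] coord_space_outside[of c N E] by (auto intro!: arg_cong[of _ _ wel])

abbreviation "PM \<equiv> polys_as_module E"
abbreviation "R0 \<equiv> ring_on E"

lemma PM_simps: "carrier PM = polys_over E" "\<zero>\<^bsub>PM\<^esub> = 0" "f \<oplus>\<^bsub>PM\<^esub> g = f + g" "e \<odot>\<^bsub>PM\<^esub> f = Polynomial.smult e f"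
  by (simp_all add: polys_as_module_def)

definition \<beta>2 :: "('a \<times> 'a vec) multiset set \<Rightarrow> 'a poly \<Rightarrow> nat \<Rightarrow> 'a poly" where
  "\<beta>2 w f i = (if i < N then Polynomial.smult (cw w i) f else 0)"

definition nf2 :: "(nat \<Rightarrow> 'a poly) \<Rightarrow> (('a \<times> 'a vec) multiset set \<times> 'a poly) multiset" where
  "nf2 h = (\<Sum>i<N. {#(wel (unit_coord i), h i)#})"

abbreviation "CP \<equiv> coord_space N (polys_over E)"

lemma T2_bilinear: "tensor_bilinear R0 WM PM \<beta>2"
proof
  show "w \<oplus>\<^bsub>WM\<^esub> w' \<in> carrier WM" if "w \<in> carrier WM" "w' \<in> carrier WM" for w w'
    using that by (auto elim!: WM_cases simp: WM_add WM_carrier CE_add)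
  show "r \<odot>\<^bsub>WM\<^esub> w \<in> carrier WM" if "r \<in> carrier R0" "w \<in> carrier WM" for r w
    using that by (auto elim!: WM_cases simp: WM_smult WM_carrier CE_smult)
  show "\<zero>\<^bsub>WM\<^esub> \<in> carrier WM" by (auto simp: WM_zero WM_carrier CE_zero)
  show "\<beta>2 (w \<oplus>\<^bsub>WM\<^esub> w') f = \<beta>2 w f + \<beta>2 w' f" if "w \<in> carrier WM" "w' \<in> carrier WM" for w w' f
    using that by (auto elim!: WM_cases simp: WM_add cw_wel CE_add \<beta>2_def smult_add_left intro!: ext)
  show "\<beta>2 (r \<odot>\<^bsub>WM\<^esub> w) f = \<beta>2 w (r \<odot>\<^bsub>PM\<^esub> f)" if "r \<in> carrier R0" "w \<in> carrier WM" for r w f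
    using that by (auto elim!: WM_cases simp: WM_smult cw_wel CE_smult \<beta>2_def PM_simps mult.commute[where 'a = 'a] intro!: ext)
  show "\<beta>2 \<zero>\<^bsub>WM\<^esub> f = 0" for f by (auto simp: WM_zero cw_wel CE_zero \<beta>2_def intro!: ext)
qed (use E in \<open>auto simp: PM_simps \<beta>2_def smult_add_right subfld.polys_add subfld.polys_smult intro!: ext\<close>)

lemma unit_WM: "i < N \<Longrightarrow> wel (unit_coord i) \<in> carrier WM"
  using unit_CE by (auto simp: WM_carrier)

lemma T2_coords: "tensor_coords R0 WM PM \<beta>2 CP nf2"
  unfolding nf2_def
proof (rule tensor_coords_basis[OF T2_bilinear])
  interpret T: tensor_bilinear R0 WM PM \<beta>2 by (rule T2_bilinear)
  show "0 \<in> polys_over E" "\<And>x y. x \<in> polys_over E \<Longrightarrow> y \<in> polys_over E \<Longrightarrow> x + y \<in> polys_over E"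
    using E by (auto intro: subfld.polys_zero subfld.polys_add)
  show "\<And>i x. i < N \<Longrightarrow> x \<in> polys_over E \<Longrightarrow> (wel (unit_coord i), x) \<in> carrier WM \<times> carrier PM"
    using unit_WM by (simp add: PM_simps)
  show "\<And>i x y. i < N \<Longrightarrow> x \<in> polys_over E \<Longrightarrow> y \<in> polys_over E \<Longrightarrow>
      tensor_rel R0 WM PM {#(wel (unit_coord i), x), (wel (unit_coord i), y)#} {#(wel (unit_coord i), x + y)#}"
    using tensor_rel.sym[OF tensor_rel.add_right[OF unit_WM, of _ _ PM _ R0]] by (simp add: PM_simps)
  show "tensor_rel R0 WM PM {#} {#(wel (unit_coord i), 0)#}" if i: "i < N" for i
  proof -
    \<comment> \<open>The zero stands in the second factor, where no generating relation removes it;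
      the scalar 0 moves it to the first.\<close>
    have "0 \<odot>\<^bsub>WM\<^esub> wel (unit_coord i) = \<zero>\<^bsub>WM\<^esub>"
      using WM_smult[OF subfld.zero[OF E] unit_CE[OF i]] by (simp add: WM_zero zero_fun_def)
    moreover have "tensor_rel R0 WM PM {#(0 \<odot>\<^bsub>WM\<^esub> wel (unit_coord i), 0)#} {#(wel (unit_coord i), 0 \<odot>\<^bsub>PM\<^esub> 0)#}"
      using unit_WM[OF i] E by (intro tensor_rel.balanced) (auto simp: PM_simps subfld.zero subfld.polys_zero)
    ultimately have "tensor_rel R0 WM PM {#(\<zero>\<^bsub>WM\<^esub>, 0)#} {#(wel (unit_coord i), 0)#}" by (simp add: PM_simps)
    moreover have "tensor_rel R0 WM PM {#} {#(\<zero>\<^bsub>WM\<^esub>, 0)#}"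
      using E by (intro tensor_rel.sym[OF tensor_rel.zero]) (simp add: PM_simps subfld.polys_zero)
    ultimately show ?thesis by (rule tensor_rel.trans[rotated])
  qed
  show "\<And>i x. i < N \<Longrightarrow> x \<in> polys_over E \<Longrightarrow>
      (case (wel (unit_coord i), x) of (w, f) \<Rightarrow> \<beta>2 w f) = (\<lambda>j. if j = i then x else 0)"
    by (auto simp: \<beta>2_def cw_wel unit_CE unit_coord_def intro!: ext)
  fix w f assume w: "w \<in> carrier WM" and f: "f \<in> carrier PM"
  obtain c where c: "c \<in> CE" "w = wel c" using w by (rule WM_cases)
  show "\<beta>2 w f \<in> CP"
    using c f E by (intro coord_spaceI) (auto simp: \<beta>2_def cw_wel coord_spaceD PM_simps intro!: subfld.polys_smult)
  have "tensor_rel R0 WM PM {#(psum WM (\<lambda>i. c i \<odot>\<^bsub>WM\<^esub> wel (unit_coord i)) N, f)#}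
      (\<Sum>i<N. {#(wel (unit_coord i), c i \<odot>\<^bsub>PM\<^esub> f)#})"
    by (rule conjunct2[OF T.pure_expand_left[OF f]]) (use unit_WM coord_spaceD[OF c(1)] in auto)
  also have "(\<Sum>i<N. {#(wel (unit_coord i), c i \<odot>\<^bsub>PM\<^esub> f)#}) = (\<Sum>i<N. {#(wel (unit_coord i), \<beta>2 w f i)#})"
    by (rule sum.cong) (auto simp: \<beta>2_def c cw_wel PM_simps)
  finally show "tensor_rel R0 WM PM {#(w, f)#} (\<Sum>i<N. {#(wel (unit_coord i), \<beta>2 w f i)#})"
    by (simp add: psum_WM_all[OF c(1)] c(2))
qed

sublocale T2: tensor_coords R0 WM PM \<beta>2 CP nf2
  by (rule T2_coords)

abbreviation "RM \<equiv> rep_motive F E n \<rho>"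

lemma RM_carrier: "carrier RM = T2.elt ` CP"
  by (simp add: rep_motive_def Let_def T2.carrier_tensor)

lemma RM_zero: "\<zero>\<^bsub>RM\<^esub> = T2.elt 0"
  by (simp add: rep_motive_def Let_def T2.zero_tensor)

lemma RM_add: "h \<in> CP \<Longrightarrow> h' \<in> CP \<Longrightarrow> T2.elt h \<oplus>\<^bsub>RM\<^esub> T2.elt h' = T2.elt (h + h')"
  by (simp add: rep_motive_def Let_def T2.add_tensor)

lemma RM_smult:
  assumes "p \<in> polys_over E" "h \<in> CP"
  shows "p \<odot>\<^bsub>RM\<^esub> T2.elt h = T2.elt (\<lambda>i. p * h i)"
proof -
  have "tensor_map R0 WM PM (\<lambda>w. w) (\<lambda>f. p * f) (T2.elt h) = T2.elt (\<lambda>i. p * h i)"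
    by (rule T2.tensor_map_elt[OF _ _ _ _ _ assms(2)])
       (use assms E in \<open>auto simp: PM_simps \<beta>2_def fun_eq_iff algebra_simps intro!: subfld.polys_mult\<close>)
  then show ?thesis by (simp add: rep_motive_def Let_def)
qed

definition \<Phi>p :: "(nat \<Rightarrow> 'a poly) \<Rightarrow> nat \<Rightarrow> 'a poly" where
  "\<Phi>p h i = (if i < N then \<Sum>j<N. Polynomial.smult (\<Phi> $$ (i, j)) (map_poly (\<lambda>c. c ^ q) (h j)) else 0)"

lemma map_frob_add: "map_poly (\<lambda>c. c ^ q) (f + g :: 'a poly) = map_poly (\<lambda>c. c ^ q) f + map_poly (\<lambda>c. c ^ q) g"
  using q_pos by (intro poly_eqI) (simp add: coeff_map_poly frob_add)

lemma map_frob_smult: "map_poly (\<lambda>c. c ^ q) (Polynomial.smult e f :: 'a poly) = Polynomial.smult (e ^ q) (map_poly (\<lambda>c. c ^ q) f)"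
  using q_pos by (intro poly_eqI) (simp add: coeff_map_poly power_mult_distrib)

lemma map_frob_over: "f \<in> polys_over E \<Longrightarrow> map_poly (\<lambda>c. c ^ q) f \<in> polys_over E"
  using q_pos subfld.power[OF E] by (auto simp: polys_over_def coeff_map_poly)

lemma \<Phi>p_CP: "h \<in> CP \<Longrightarrow> \<Phi>p h \<in> CP"
  using \<Phi>_over E
  by (intro coord_spaceI)
     (auto simp: \<Phi>p_def mats_over_iff coord_spaceD intro!: subfld.polys_sum subfld.polys_smult map_frob_over)

lemma RM_tau:
  assumes "h \<in> CP" shows "tau RM (T2.elt h) = T2.elt (\<Phi>p h)"
proof -
  have "tensor_map R0 WM PM (tau WM) (map_poly (\<lambda>c. c ^ q)) (T2.elt h) = T2.elt (\<Phi>p h)"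
  proof (rule T2.tensor_map_elt[OF _ _ _ _ _ assms])
    show "tau WM w \<in> carrier WM" if "w \<in> carrier WM" for w
      using that by (auto elim!: WM_cases simp: WM_tau WM_carrier \<Phi>f_CE)
    show "map_poly (\<lambda>c. c ^ q) f \<in> carrier PM" if "f \<in> carrier PM" for f
      using that map_frob_over by (simp add: PM_simps)
    show "\<Phi>p 0 = 0" by (rule ext) (simp add: \<Phi>p_def)
    show "\<Phi>p (x + y) = \<Phi>p x + \<Phi>p y" for x y
      by (rule ext) (simp add: \<Phi>p_def map_frob_add smult_add_right sum.distrib)
    fix w f assume w: "w \<in> carrier WM"
    obtain c where c: "c \<in> CE" "w = wel c" using w by (rule WM_cases)
    show "\<beta>2 (tau WM w) (map_poly (\<lambda>c. c ^ q) f) = \<Phi>p (\<beta>2 w f)"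
      by (rule ext) (simp add: \<beta>2_def c WM_tau cw_wel \<Phi>f_CE \<Phi>f_def \<Phi>p_def map_frob_smult smult_sum)
  qed
  then show ?thesis by (simp add: rep_motive_def Let_def card_F)
qed

lemma CP_zero: "0 \<in> CP" and CP_add: "h \<in> CP \<Longrightarrow> h' \<in> CP \<Longrightarrow> h + h' \<in> CP"
  and CP_mult: "p \<in> polys_over E \<Longrightarrow> h \<in> CP \<Longrightarrow> (\<lambda>i. p * h i) \<in> CP"
  and unit_CP: "i < N \<Longrightarrow> unit_coord i \<in> CP"
  using E by (auto intro!: coord_spaceI simp: coord_spaceD coord_space_outside unit_coord_def
      subfld.polys_zero subfld.polys_add subfld.polys_mult subfld.polys_one)

lemma psum_RM:
  assumes h: "h \<in> CP" and "m \<le> N"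
  shows "psum RM (\<lambda>i. h i \<odot>\<^bsub>RM\<^esub> T2.elt (unit_coord i)) m = T2.elt (\<lambda>j. if j < m then h j else 0)"
  using assms(2)
proof (induction m)
  case 0
  then show ?case by (simp add: RM_zero zero_fun_def)
next
  case (Suc m)
  have "h m \<odot>\<^bsub>RM\<^esub> T2.elt (unit_coord m) = T2.elt (\<lambda>j. h m * unit_coord m j)"
    using Suc h by (intro RM_smult unit_CP coord_spaceD[OF h]) auto
  moreover have "(\<lambda>j. if j < m then h j else 0) \<in> CP" "(\<lambda>j. h m * unit_coord m j) \<in> CP"
    using Suc h E by (auto intro!: coord_spaceI CP_mult unit_CP coord_spaceD[OF h] simp: subfld.polys_zero)
  moreover have "(\<lambda>j. if j < m then h j else 0) + (\<lambda>j. h m * unit_coord m j) = (\<lambda>j. if j < Suc m then h j else 0)"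
    by (rule ext) (auto simp: unit_coord_def less_Suc_eq)
  ultimately show ?case using Suc RM_add by simp
qed

lemma psum_RM_all: "h \<in> CP \<Longrightarrow> psum RM (\<lambda>i. h i \<odot>\<^bsub>RM\<^esub> T2.elt (unit_coord i)) N = T2.elt h"
  using psum_RM[of h N] coord_space_outside[of h N "polys_over E"] by (auto intro!: arg_cong[of _ _ T2.elt])

end

section \<open>The twisted motive\<close>

lemma (in finite_subfld) twist_data_trivial:
  assumes "subfld E" "\<phi> \<in> polys_over E"
  shows "twist_data F q E 1 (1\<^sub>m 1) \<phi>"
  by (intro twist_data.intro twist_data_axioms.intro assms finite_subfld_axioms subfld.mats_over_one) auto

locale artin_drinfeld = artin_data F q E n d \<rho> \<alpha> u
  for F :: "'a::alg_closed_field set" and q E n d \<rho> \<alpha> u +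
  fixes \<phi> :: "'a poly"
  assumes \<phi>: "\<phi> \<in> polys_over E"
begin

sublocale TD: twist_data F q E N \<Phi> \<phi>
  by (intro twist_data.intro twist_data_axioms.intro finite_subfld_axioms E \<Phi>_over \<Phi>_det \<phi>)

text \<open>The motive of the Drinfeld module is the trivial twist in rank 1, so
  \<open>T0.H_smult\<close> already computes its scalar multiplication.\<close>

sublocale T0: twist_data F q E 1 "1\<^sub>m 1" \<phi>
  by (rule twist_data_trivial[OF E \<phi>])

definition "M0 = anderson_motive q E 1 (mat 1 1 (\<lambda>_. \<phi>))"
abbreviation "RE \<equiv> ring_on (polys_over E)"

lemma T0_untw: "T0.untw k = 1\<^sub>m 1"
proof -
  have "T0.\<Psi> = 1\<^sub>m 1" unfolding T0.\<Psi>_def by (rule mat_inv_unique) auto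
  then show ?thesis unfolding T0.untw_def by (induction k) (auto simp: frob_mat_one simp del: One_nat_def)
qed

lemma T0_tw: "T0.tw k = 1\<^sub>m 1"
  unfolding T0.tw_def by (induction k) (auto simp: frob_mat_one simp del: One_nat_def)

lemma T0_Et: "T0.Et = mat 1 1 (\<lambda>_. \<phi>)"
  by (rule eq_matI) (auto simp: T0.Et_def T0_untw poly_eq_iff simp del: One_nat_def)

lemma T0_H: "m \<in> carrier_mat 1 1 \<Longrightarrow> T0.H m 0 = m $$ (0, 0)"
proof -
  have "{..<1::nat} = {0}" by auto
  then show ?thesis by (auto simp: T0.H_def T0_tw poly_eq_iff simp del: One_nat_def)
qed

lemma M0_simps: "carrier M0 = mats_over 1 1 (polys_over E)" "\<zero>\<^bsub>M0\<^esub> = 0\<^sub>m 1 1" "v \<oplus>\<^bsub>M0\<^esub> w = v + w"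
  "tau M0 = map_mat (skew_mult q (monom 1 1))"
  by (simp_all add: anderson_motive_def M0_def)

lemma M0_smult:
  assumes "m \<in> carrier_mat 1 1"
  shows "p \<odot>\<^bsub>M0\<^esub> m = mat 1 1 (\<lambda>_. skew_act q \<phi> p (m $$ (0, 0)))"
proof -
  have c: "p \<odot>\<^bsub>M0\<^esub> m \<in> carrier_mat 1 1" using T0.smult_carrier unfolding T0_Et M0_def .
  have "(p \<odot>\<^bsub>M0\<^esub> m) $$ (0, 0) = skew_act q \<phi> p (m $$ (0, 0))"
    using T0.H_smult[OF assms, of p 0] T0_H[OF c] T0_H[OF assms] unfolding T0_Et M0_def by simp
  then show ?thesis using c by (intro eq_matI) auto
qed

definition m1 :: "'a poly \<Rightarrow> 'a poly mat" where "m1 f = mat 1 1 (\<lambda>_. f)"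

lemma m1_simps [simp]: "m1 f $$ (0, 0) = f" "m1 f \<in> carrier_mat (Suc 0) (Suc 0)" "m1 f + m1 g = m1 (f + g)"
  by (auto simp: m1_def intro!: eq_matI)

lemma M0_carrier: "m \<in> carrier M0 \<longleftrightarrow> m \<in> carrier_mat 1 1 \<and> m $$ (0, 0) \<in> polys_over E"
  by (auto simp: M0_simps mats_over_iff simp del: One_nat_def)

lemma M0_smult_index: "m \<in> carrier_mat 1 1 \<Longrightarrow> (p \<odot>\<^bsub>M0\<^esub> m) $$ (0, 0) = skew_act q \<phi> p (m $$ (0, 0))"
  by (simp add: M0_smult)

text \<open>The second factor is free over E[t], so the product is N copies of E[\<tau>]: the
  coordinates of y act on m. That the map is balanced uses the commutativity of E[t].\<close>

definition \<beta>3 :: "'a poly mat \<Rightarrow> (('a \<times> 'a vec) multiset set \<times> 'a poly) multiset set \<Rightarrow> nat \<Rightarrow> 'a poly" where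
  "\<beta>3 m y i = (if i < N then skew_act q \<phi> (T2.co y i) (m $$ (0, 0)) else 0)"

definition nf3 :: "(nat \<Rightarrow> 'a poly) \<Rightarrow> ('a poly mat \<times> (('a \<times> 'a vec) multiset set \<times> 'a poly) multiset set) multiset" where
  "nf3 h = (\<Sum>i<N. {#(m1 (h i), T2.elt (unit_coord i))#})"

lemma RM_cases: assumes "y \<in> carrier RM" obtains h where "h \<in> CP" "y = T2.elt h"
  using assms unfolding RM_carrier by blast

lemma T3_bilinear: "tensor_bilinear RE M0 RM \<beta>3"
proof
  show "m \<oplus>\<^bsub>M0\<^esub> m' \<in> carrier M0" if "m \<in> carrier M0" "m' \<in> carrier M0" for m m'
    using that subfld.polys_add[OF E] unfolding M0_carrier by (auto simp: M0_simps)
  show "y \<oplus>\<^bsub>RM\<^esub> y' \<in> carrier RM" if "y \<in> carrier RM" "y' \<in> carrier RM" for y y'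
    using that by (auto elim!: RM_cases simp: RM_add RM_carrier CP_add)
  show "r \<odot>\<^bsub>M0\<^esub> m \<in> carrier M0" if "r \<in> carrier RE" "m \<in> carrier M0" for r m
    using that skew_act_closed[OF E _ _ \<phi>] unfolding M0_carrier by (auto simp: M0_smult)
  show "r \<odot>\<^bsub>RM\<^esub> y \<in> carrier RM" if "r \<in> carrier RE" "y \<in> carrier RM" for r y
    using that by (auto elim!: RM_cases simp: RM_smult RM_carrier CP_mult)
  show "\<zero>\<^bsub>M0\<^esub> \<in> carrier M0" unfolding M0_carrier using subfld.polys_zero[OF E] by (auto simp: M0_simps)
  show "\<beta>3 (m \<oplus>\<^bsub>M0\<^esub> m') y = \<beta>3 m y + \<beta>3 m' y" if "m \<in> carrier M0" "m' \<in> carrier M0" for m m' y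
    using that unfolding M0_carrier by (auto simp: \<beta>3_def M0_simps skew_act_add_right intro!: ext)
  show "\<beta>3 m (y \<oplus>\<^bsub>RM\<^esub> y') = \<beta>3 m y + \<beta>3 m y'" if "y \<in> carrier RM" "y' \<in> carrier RM" for m y y'
    using that by (auto elim!: RM_cases simp: RM_add T2.co_elt CP_add \<beta>3_def skew_act_add_left intro!: ext)
  show "\<beta>3 (r \<odot>\<^bsub>M0\<^esub> m) y = \<beta>3 m (r \<odot>\<^bsub>RM\<^esub> y)" if "r \<in> carrier RE" "m \<in> carrier M0" "y \<in> carrier RM" for r m y
    using that unfolding M0_carrier
    by (auto elim!: RM_cases simp: RM_smult T2.co_elt CP_mult \<beta>3_def M0_smult_index skew_act_mult[symmetric] mult.commute[where 'a = "'a poly"] intro!: ext)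
  show "\<beta>3 \<zero>\<^bsub>M0\<^esub> y = 0" for y by (auto simp: \<beta>3_def M0_simps intro!: ext)
qed

lemma unit_RM: "i < N \<Longrightarrow> T2.elt (unit_coord i) \<in> carrier RM"
  using unit_CP by (auto simp: RM_carrier)

lemma T3_coords: "tensor_coords RE M0 RM \<beta>3 CP nf3"
  unfolding nf3_def
proof (rule tensor_coords_basis[OF T3_bilinear])
  interpret T: tensor_bilinear RE M0 RM \<beta>3 by (rule T3_bilinear)
  show "0 \<in> polys_over E" "\<And>x y. x \<in> polys_over E \<Longrightarrow> y \<in> polys_over E \<Longrightarrow> x + y \<in> polys_over E"
    using E by (auto intro: subfld.polys_zero subfld.polys_add)
  show "\<And>i x. i < N \<Longrightarrow> x \<in> polys_over E \<Longrightarrow> (m1 x, T2.elt (unit_coord i)) \<in> carrier M0 \<times> carrier RM"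
    using unit_RM by (simp add: M0_carrier)
  show "tensor_rel RE M0 RM {#(m1 x, T2.elt (unit_coord i)), (m1 y, T2.elt (unit_coord i))#}
      {#(m1 (x + y), T2.elt (unit_coord i))#}" if "i < N" "x \<in> polys_over E" "y \<in> polys_over E" for i x y
    using tensor_rel.sym[OF tensor_rel.add_left[of "m1 x" M0 "m1 y" _ RM RE, OF _ _ unit_RM[OF that(1)]]] that
    by (simp add: M0_carrier M0_simps(3))
  show "tensor_rel RE M0 RM {#} {#(m1 0, T2.elt (unit_coord i))#}" if "i < N" for i
  proof -
    have "\<zero>\<^bsub>M0\<^esub> = m1 0" by (auto simp: M0_simps m1_def intro!: eq_matI)
    then show ?thesis using tensor_rel.sym[OF tensor_rel.zero[OF unit_RM[OF that], of RE M0]] by simp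
  qed
  show "\<And>i x. i < N \<Longrightarrow> x \<in> polys_over E \<Longrightarrow>
      (case (m1 x, T2.elt (unit_coord i)) of (m, y) \<Rightarrow> \<beta>3 m y) = (\<lambda>j. if j = i then x else 0)"
    by (auto simp: \<beta>3_def T2.co_elt unit_CP unit_coord_def intro!: ext)
  fix m y assume m: "m \<in> carrier M0" and y: "y \<in> carrier RM"
  have mc: "m \<in> carrier_mat 1 1" "m $$ (0, 0) \<in> polys_over E" using m unfolding M0_carrier by auto
  obtain h where h: "h \<in> CP" "y = T2.elt h" using y by (rule RM_cases)
  show "\<beta>3 m y \<in> CP"
    using h mc skew_act_closed[OF E _ _ \<phi>]
    by (intro coord_spaceI) (auto simp: \<beta>3_def T2.co_elt coord_spaceD)
  have "tensor_rel RE M0 RM {#(m, psum RM (\<lambda>i. h i \<odot>\<^bsub>RM\<^esub> T2.elt (unit_coord i)) N)#}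
      (\<Sum>i<N. {#(h i \<odot>\<^bsub>M0\<^esub> m, T2.elt (unit_coord i))#})"
  proof (rule conjunct2[OF T.pure_expand_right[OF m, where z = 0]])
    show "\<zero>\<^bsub>RM\<^esub> \<in> carrier RM" by (auto simp: RM_zero RM_carrier CP_zero)
    show "0 \<in> carrier RE" using subfld.polys_zero[OF E] by simp
    show "0 \<odot>\<^bsub>RM\<^esub> \<zero>\<^bsub>RM\<^esub> = \<zero>\<^bsub>RM\<^esub>"
      using RM_smult[OF subfld.polys_zero[OF E] CP_zero] by (simp add: RM_zero zero_fun_def)
    show "0 \<odot>\<^bsub>M0\<^esub> m = \<zero>\<^bsub>M0\<^esub>" using mc by (auto simp: M0_smult M0_simps intro!: eq_matI)
  qed (use unit_RM coord_spaceD[OF h(1)] in auto)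
  also have "(\<Sum>i<N. {#(h i \<odot>\<^bsub>M0\<^esub> m, T2.elt (unit_coord i))#}) = (\<Sum>i<N. {#(m1 (\<beta>3 m y i), T2.elt (unit_coord i))#})"
    using mc by (intro sum.cong) (auto simp: \<beta>3_def h T2.co_elt M0_smult m1_def)
  finally show "tensor_rel RE M0 RM {#(m, y)#} (\<Sum>i<N. {#(m1 (\<beta>3 m y i), T2.elt (unit_coord i))#})"
    by (simp add: psum_RM_all[OF h(1)] h(2))
qed

sublocale T3: tensor_coords RE M0 RM \<beta>3 CP nf3
  by (rule T3_coords)

abbreviation "TM \<equiv> tau_tensor RE M0 RM"

lemma TM_carrier: "carrier TM = T3.elt ` CP"
  unfolding T3.carrier_tensor[symmetric] by (simp add: tau_tensor_def module.defs)

lemma TM_simps: "a \<oplus>\<^bsub>TM\<^esub> b = a \<oplus>\<^bsub>tensor RE M0 RM\<^esub> b"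
  "r \<odot>\<^bsub>TM\<^esub> a = tensor_map RE M0 RM (\<lambda>m. r \<odot>\<^bsub>M0\<^esub> m) (\<lambda>y. y) a"
  "tau TM = tensor_map RE M0 RM (tau M0) (tau RM)"
  by (simp_all add: tau_tensor_def module.defs tensor_def)

lemma TM_smult:
  assumes r: "r \<in> polys_over E" and h: "h \<in> CP"
  shows "r \<odot>\<^bsub>TM\<^esub> T3.elt h = T3.elt (\<lambda>i. skew_act q \<phi> r (h i))"
  unfolding TM_simps
proof (rule T3.tensor_map_elt[OF _ _ _ _ _ h])
  show "r \<odot>\<^bsub>M0\<^esub> m \<in> carrier M0" if "m \<in> carrier M0" for m
    using T3.smultM[of r m] r that by simp
  show "\<beta>3 (r \<odot>\<^bsub>M0\<^esub> m) y = (\<lambda>i. skew_act q \<phi> r (\<beta>3 m y i))" if "m \<in> carrier M0" for m y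
    using that unfolding M0_carrier
    by (auto simp: \<beta>3_def M0_smult_index skew_act_mult[symmetric] mult.commute[where 'a = "'a poly"] intro!: ext)
qed (auto simp: skew_act_add_right)

definition \<Phi>t :: "(nat \<Rightarrow> 'a poly) \<Rightarrow> nat \<Rightarrow> 'a poly" where
  "\<Phi>t h i = (if i < N then \<Sum>j<N. Polynomial.smult (\<Phi> $$ (i, j)) (tau_poly q (h j)) else 0)"

lemma skew_act_sum_left: "skew_act q \<phi> (\<Sum>j\<in>I. p j) f = (\<Sum>j\<in>I. skew_act q \<phi> (p j) f)"
  by (induction I rule: infinite_finite_induct) (auto simp: skew_act_add_left)

text \<open>The diagonal \<tau> multiplies m by \<tau>, applies the Frobenius to the coefficients of
  the coordinates of y and mixes these by \<Phi>. By \<open>tau_skew_act\<close> this amounts to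
  \<tau> in each coordinate followed by \<Phi>.\<close>

lemma TM_tau:
  assumes h: "h \<in> CP"
  shows "tau TM (T3.elt h) = T3.elt (\<Phi>t h)"
  unfolding TM_simps
proof (rule T3.tensor_map_elt[OF _ _ _ _ _ h])
  have tau_idx: "tau M0 m $$ (0, 0) = tau_poly q (m $$ (0, 0))" if "m \<in> carrier_mat 1 1" for m
    using that by (simp add: M0_simps tau_poly_def)
  show "tau M0 m \<in> carrier M0" if "m \<in> carrier M0" for m
    using that skew_closed[OF E] subfld.polys_monom[OF E subfld.one[OF E]] unfolding M0_carrier
    by (auto simp: M0_simps)
  show "tau RM y \<in> carrier RM" if "y \<in> carrier RM" for y
    using that by (auto elim!: RM_cases simp: RM_tau RM_carrier \<Phi>p_CP)
  show "\<Phi>t 0 = 0" by (rule ext) (simp add: \<Phi>t_def)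
  show "\<Phi>t (x + y) = \<Phi>t x + \<Phi>t y" for x y
    by (rule ext) (simp add: \<Phi>t_def tau_add smult_add_right sum.distrib)
  fix m y assume m: "m \<in> carrier M0" and y: "y \<in> carrier RM"
  have mc: "m \<in> carrier_mat 1 1" using m unfolding M0_carrier by auto
  obtain h where h: "h \<in> CP" "y = T2.elt h" using y by (rule RM_cases)
  show "\<beta>3 (tau M0 m) (tau RM y) = \<Phi>t (\<beta>3 m y)"
    by (rule ext) (simp add: \<beta>3_def h RM_tau T2.co_elt \<Phi>p_CP \<Phi>p_def \<Phi>t_def tau_idx[OF mc]
        skew_act_sum_left skew_act_smult_left tau_skew_act)
qed

text \<open>Both sides have the same coordinates in E[\<tau>]^N, one by \<open>TD.H\<close>, the
  other by \<open>T3.elt\<close>; on both, t is right multiplication by \<phi> and the Frobenius is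
  \<Phi> \<tau>. The isomorphism matches coordinates.\<close>

lemma motive_iso: "tau_isomorphic RE (anderson_motive q E N TD.Et) TM"
proof -
  define h where "h v = T3.elt (TD.H v)" for v
  have car: "v \<in> carrier_mat 1 N" "TD.H v \<in> CP" if "v \<in> carrier TD.ME" for v
    using that mats_over_carrier TD.H_over by (auto simp: TD.motive_simps)
  have "h \<in> module_hom RE TD.ME TM"
    unfolding module_hom_def
  proof (intro CollectI conjI ballI allI impI)
    show "h \<in> carrier TD.ME \<rightarrow> carrier TM" using car by (auto simp: h_def TM_carrier)
    show "h (v \<oplus>\<^bsub>TD.ME\<^esub> w) = h v \<oplus>\<^bsub>TM\<^esub> h w" if "v \<in> carrier TD.ME \<and> w \<in> carrier TD.ME" for v w
      using that car by (simp add: h_def TD.motive_simps(3) TD.H_add TM_simps T3.add_tensor)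
    show "h (r \<odot>\<^bsub>TD.ME\<^esub> v) = r \<odot>\<^bsub>TM\<^esub> h v" if "r \<in> carrier RE \<and> v \<in> carrier TD.ME" for r v
    proof -
      have "TD.H (r \<odot>\<^bsub>TD.ME\<^esub> v) = (\<lambda>i. skew_act q \<phi> r (TD.H v i))"
        using TD.H_smult[OF car(1)] that by blast
      then show ?thesis using that car by (simp add: h_def TM_smult)
    qed
  qed
  moreover have "bij_betw h (carrier TD.ME) (carrier TM)"
  proof -
    have "bij_betw T3.elt CP (carrier TM)"
      unfolding TM_carrier by (rule inj_on_imp_bij_betw) (auto intro: inj_onI T3.elt_inj)
    from bij_betw_trans[OF TD.H_bij this] show ?thesis
      unfolding h_def by (simp add: comp_def TD.motive_simps)
  qed
  moreover have "h (tau TD.ME v) = tau TM (h v)" if v: "v \<in> carrier TD.ME" for v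
  proof -
    have "TD.H (tau TD.ME v) = \<Phi>t (TD.H v)"
      using TD.H_tau[OF car(1)[OF v]] TD.H_outside by (auto simp: \<Phi>t_def TD.motive_simps intro!: ext)
    then show ?thesis using car[OF v] by (simp add: h_def TM_tau)
  qed
  ultimately show ?thesis unfolding tau_isomorphic_def by blast
qed

end

theorem theorem4p27:
  fixes F E :: "'a::alg_closed_field set" and \<theta> :: 'a
    and q n d N r :: nat
    and a :: "nat \<Rightarrow> 'a" and \<phi> :: "'a poly \<Rightarrow> 'a poly"
    and \<rho> :: "('a \<Rightarrow> 'a) \<Rightarrow> 'a mat"
    and \<alpha> :: "'a vec" and u :: "'a mat"
  assumes "subfield F ambient" and "finite F" and "card F = q"
    and "ring.transcendental ambient F \<theta>"
    and "finite_field_extension (generate_field ambient (insert \<theta> F)) E"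
    and "drinfeld_module F E \<theta> \<phi>"
    and "\<phi> [:0, 1:] = monom \<theta> 0 + (\<Sum>i = 1..r. monom (a i) i)" and "r \<ge> 1" and "a r \<noteq> 0"
    and "n \<ge> 1" and "artin_representation F E n \<rho>"
    and "d = ring.dim ambient F (coefficient_field F E \<rho>)" and "N = n * d"
    and "\<alpha> \<in> carrier_vec d" and "is_basis F (coefficient_field F E \<rho>) \<alpha>"
    and "fundamental_solution F E n \<rho> \<alpha> u"
  shows "Phi q u \<in> carrier (GL N E) \<and>
    artin_twist F E \<theta> \<phi> n \<rho> N (model_t q N \<theta> a r (mat_inv N (transpose_mat (Phi q u))))"
proof -
  interpret A: Ring.field "ambient :: 'a ring" by (rule field_from_type_algebra)
  have carrier: "carrier (ambient :: 'a ring) = UNIV" by (simp add: ring_of_type_algebra_def)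
  define \<phi>t where "\<phi>t = \<phi> [:0, 1:]"
  have F: "subfld F" by (rule subfld_of_subfield) fact
  interpret F: finite_subfld F q by (intro finite_subfld.intro finite_subfld_axioms.intro F assms)
  have E: "subfld E" using assms(5) by (auto simp: finite_field_extension_def intro: subfld_of_subfield)
  have "insert \<theta> F \<subseteq> generate_field ambient (insert \<theta> F)" by (blast intro: generate_field.incl)
  then have FE: "F \<subseteq> E" using assms(5) by (auto simp: finite_field_extension_def)
  let ?L = "coefficient_field F E \<rho>" and ?G = "carrier (gal_group E)"
  have L: "subfld ?L"
    unfolding coefficient_field_def
    by (intro subfld_of_subfield A.generate_field_is_subfield) (simp add: carrier)
  have gen: "F \<union> (\<Union>g\<in>?G. elements_mat (\<rho> g)) \<subseteq> ?L"
    unfolding coefficient_field_def by (blast intro: generate_field.incl)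
  have GL: "\<rho> g \<in> carrier (GL n (algebraic_elements F))" if "g \<in> ?G" for g
    using assms(11) that by (auto simp: artin_representation_def hom_def)
  have \<rho>c: "\<rho> g \<in> carrier_mat n n" and \<rho>det: "det (\<rho> g) \<noteq> 0" if g: "g \<in> ?G" for g
    using GL[OF g] det_nonzero_of_inverse[of "\<rho> g" n] mats_over_carrier unfolding GL_carrier_iff by blast+
  have \<rho>L: "\<rho> g \<in> mats_over n n ?L" if "g \<in> ?G" for g
    using \<rho>c[OF that] gen that by (auto simp: mats_over_def)
  have d: "dim_vec \<alpha> = d" using assms(14) by simp
  have \<alpha>: "lin_indep F \<alpha>" and span: "?L = {\<Sum>k<d. c k * \<alpha> $ k | c. \<forall>k<d. c k \<in> F}"
    using assms(15) lin_indep_of_independent[OF assms(1), of \<alpha>] span_ambient[OF assms(1), of \<alpha>]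
    by (auto simp: is_basis_def d)
  have u: "u \<in> mats_over n d (sep_closure E)" and indu: "lin_indep F (vectorize u)"
    using assms(16) lin_indep_of_independent[OF assms(1)] by (auto simp: fundamental_solution_def Sol_def d)
  have sol: "frob_mat q l (\<rho> g) *\<^sub>v (map_mat g u *\<^sub>v frob_vec q l \<alpha>) = u *\<^sub>v frob_vec q l \<alpha>"
    if g: "g \<in> ?G" and l: "l < d" for g l
  proof -
    let ?P = "frob_mat q l (\<rho> g)" and ?w = "u *\<^sub>v frob_vec q l \<alpha>"
    \<comment> \<open>The Frobenius is a field homomorphism, so the conjugate of \<rho>(g) stays
      invertible and the inverse in \<open>Sol\<close> can be moved to the other side.\<close>
    have P: "?P \<in> carrier_mat n n" "det ?P \<noteq> 0"
      using \<rho>c[OF g] fhom.map_mat_det_nonzero[OF F.frob_fhom, of "\<rho> g" n l] \<rho>det[OF g]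
      by (auto simp: frob_mat_def)
    have w: "?w \<in> carrier_vec n"
      by (rule mult_mat_vec_carrier[OF mats_over_carrier[OF u]]) (simp add: frob_vec_def d carrier_vecI)
    have "map_mat g u *\<^sub>v frob_vec q l \<alpha> = mat_inv n ?P *\<^sub>v ?w"
      using assms(3,16) g l by (simp add: fundamental_solution_def Sol_def d)
    also have "?P *\<^sub>v \<dots> = (?P * mat_inv n ?P) *\<^sub>v ?w"
      using P(1) mat_inv_props(1)[OF P] w by (rule assoc_mult_mat_vec[symmetric])
    finally show ?thesis using mat_inv_props(2)[OF P] w by simp
  qed
  have \<phi>t: "\<phi>t = monom \<theta> 0 + (\<Sum>i = 1..r. monom (a i) i)" using assms(7) by (simp add: \<phi>t_def)
  have \<phi>E: "\<phi>t \<in> polys_over E"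
  proof -
    have "[:0, 1:] \<in> carrier (ring_on (polys_over F))" using F by (auto intro: subfld.polys_pCons)
    then show ?thesis
      using assms(6) unfolding drinfeld_module_def \<phi>t_def by (auto simp: Ring.ring_hom_def skew_poly_ring_def)
  qed
  interpret D: artin_drinfeld F q E n d \<rho> \<alpha> u \<phi>t
    by (intro artin_drinfeld.intro artin_data.intro artin_data_axioms.intro artin_drinfeld_axioms.intro
        F.finite_subfld_axioms E FE L \<rho>L \<alpha> span u indu sol \<phi>E assms) (use gen in auto)
  have N: "N = n * d" by fact
  have Et: "model_t q N \<theta> a r (mat_inv N (transpose_mat (Phi q u))) = D.TD.Et"
    using D.TD.model_t_eq[OF \<phi>t] by (simp add: N D.\<Phi>_def)
  have coeff: "coeff \<phi>t m = (if m = 0 then \<theta> else if m \<le> r then a m else 0)" for m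
    unfolding \<phi>t by (rule coeff_model_poly)
  \<comment> \<open>The degree enters the freeness of the motive, whose basis consists of the
    \<open>\<tau>\<^sup>k\<close> with k < r in each coordinate.\<close>
  have "degree \<phi>t = r"
    by (intro antisym degree_le le_degree) (use assms(8,9) in \<open>auto simp: coeff\<close>)
  then have "abelian_module q E N D.TD.Et" using D.TD.abelian assms(8) by (simp add: N)
  moreover have "anderson_module E \<theta> N D.TD.Et"
    using D.TD.Et_anderson D.N_pos coeff[of 0] by (simp add: N)
  moreover have "tau_isomorphic (ring_on (polys_over E)) (anderson_motive q E N D.TD.Et) (twisted_motive F E \<phi> n \<rho>)"
    using D.motive_iso unfolding twisted_motive_def N assms(3) \<phi>t_def[symmetric] D.M0_def[symmetric] .
  moreover have "Phi q u \<in> carrier (GL N E)"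
    using subfld.GL_iff_det[OF E] D.\<Phi>_over D.\<Phi>_det by (simp add: N D.\<Phi>_def)
  ultimately show ?thesis using assms(3) unfolding artin_twist_def Et by simp
qed

end
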